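(* Let $f(z)=\sum_{j\ge0}g_jz^j$ have $g_0=1$ and radius of convergence $\rho_1\in(0,\infty]$, with a nonremovable singularity at $\rho_1$ if $\rho_1<\infty$. Let $b_1=1$, $b_k\ge0$, such that every power series $f(z)^{b_k}=\sum_jg_{k,j}z^j$ has nonnegative coefficients, and assume $B_k=\sum_{j\le k}b_j=k^\beta\ell(k)$ with $\beta>0$ and $\ell$ measurable slowly varying. Let $F(x)=\prod_{k\ge1}f(x^k)^{b_k}=\sum_na_nx^n$ with all $a_n>0$, with radius of convergence $\rho$, and let $(\mu_x)_{0<x<\rho}$ be the associated grand canonical measures. (i) If either $\rho_1>1$, or $\rho_1=1$ and $f$ has a pole at $1$, then $(\mu_x)$ is ergodic; one may take the scaling function $\alpha_x=1/(1-x)$, and then the limit shape is $$\varphi(t)=\frac1\Omega\left(\int_0^{e^{-t}}\big(h(u)+uh'(u)\big)|\log u|^\beta du-t^\beta h(e^{-t})e^{-t}\right),$$ with $h=f'/f$ and $\Omega=\int_0^1\big(|\log u|^{\beta+1}(h(u)+uh'(u))-|\log u|^\beta h(u)\big)du$. (ii) If $\rho_1<1$ and $f$ has a pole at $\rho_1$, then $(\mu_x)$ is not ergodic.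
   Context: $\mathcal P$ is the set of all integer partitions; for $\lambda\in\mathcal P$, $R_k(\lambda)$ is the number of parts equal to $k$, $N(\lambda)=\sum_kkR_k(\lambda)$, $\varphi_\lambda(t)=\sum_{k>t}R_k(\lambda)$. For $0<x<\rho$, $\mu_x\{\lambda\}=\frac{x^{N(\lambda)}}{F(x)}\prod_{k\ge1}g_{k,R_k(\lambda)}$, with expectation $\mathbb E_x$. Given a positive function $\alpha_x$ on $(0,\rho)$, $\tilde\varphi_{x;\lambda}(t)=\frac{\alpha_x}{\mathbb E_xN}\varphi_\lambda(\alpha_xt)$. The family $(\mu_x)$ is ergodic (with scaling $\alpha_x$ and limit shape $\varphi$) if $\varphi:[0,\infty)\to[0,\infty)$ is piecewise continuous with $\int_0^\infty\varphi=1$ and for every $\varepsilon>0$ and every finite collection $0<t_1<\dots<t_\ell$ of continuity points of $\varphi$, $\lim_{x\nearrow\rho}\mu_x\{\lambda:|\tilde\varphi_{x;\lambda}(t_j)-\varphi(t_j)|<\varepsilon\ \forall j\}=1$; the family is ergodic if such $\alpha_x,\varphi$ exist. A measurable $\ell$ is slowly varying if $\ell(xy)/\ell(x)\to1$ as $x\to\infty$ for each fixed $y>0$. *)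

theory Defs
  imports "HOL-Complex_Analysis.Complex_Analysis"
begin

section \<open>Integer partitions\<close>

text \<open>A partition is the finite multiset of its parts, so \<open>R_k(p) = count p k\<close>.\<close>

definition partitions :: "nat multiset set" where
  "partitions = {p. 0 \<notin># p}"

definition weight :: "nat multiset \<Rightarrow> nat" where
  "weight p = (\<Sum>k\<in>set_mset p. k * count p k)"

definition tail_count :: "nat multiset \<Rightarrow> real \<Rightarrow> nat" where
  "tail_count p t = (\<Sum>k | k \<in># p \<and> real k > t. count p k)"


section \<open>Multiplicative measures\<close>

text \<open>
  The power series of \<open>f(z)^c\<close> for a real exponent \<open>c\<close>, where \<open>f\<close> has constant term \<open>1\<close>: the
  binomial series \<open>(1 + w)^c\<close> is composed with \<open>w = f - 1\<close>.
\<close>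

definition fps_rpow :: "real fps \<Rightarrow> real \<Rightarrow> real fps" where
  "fps_rpow f c = fps_binomial c oo (f - 1)"

text \<open>
  \<open>F(x) = \<Prod>\<^sub>k\<^sub>\<ge>\<^sub>1 f(x\<^sup>k)\<^bsup>b k\<^esup>\<close>, an infinite product in the topology of formal power series.
\<close>

definition gen_fun :: "real fps \<Rightarrow> (nat \<Rightarrow> real) \<Rightarrow> real fps" where
  "gen_fun f b = (\<Prod>k. fps_rpow f (b (Suc k)) oo fps_X ^ Suc k)"

lemma has_prod_gen_fun:
  assumes "fps_nth f 0 = 1"
  shows "(\<lambda>k. fps_rpow f (b (Suc k)) oo fps_X ^ Suc k) has_prod gen_fun f b"
proof -
  define A where "A = (\<lambda>k. fps_rpow f (b (Suc k)) oo fps_X ^ Suc k)"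
  define P where "P = (\<lambda>n. \<Prod>k\<le>n. A k)"
  have A: "fps_nth (A k) j = (if j = 0 then 1 else 0)" if "j \<le> k" for j k
    using that assms dvd_imp_le[of "Suc k" j]
    by (auto simp: A_def fps_nth_compose_X_power fps_rpow_def fps_compose_nth_0 simp del: power_Suc)
  have step: "fps_nth (P (Suc n)) j = fps_nth (P n) j" if "j \<le> n" for n j
  proof -
    have "P (Suc n) = P n * A (Suc n)"
      by (simp add: P_def mult.commute)
    then have "fps_nth (P (Suc n)) j = (\<Sum>i=0..j. fps_nth (P n) i * fps_nth (A (Suc n)) (j - i))"
      by (simp add: fps_mult_nth)
    also have "\<dots> = (\<Sum>i=0..j. if i = j then fps_nth (P n) i else 0)"
      by (rule sum.cong) (use that in \<open>auto simp: A\<close>)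
    finally show ?thesis by simp
  qed
  have stable: "fps_nth (P n) j = fps_nth (P j) j" if "n \<ge> j" for n j
    using that by (induction n rule: dec_induct) (auto simp: step)
  have "P \<longlonglongrightarrow> Abs_fps (\<lambda>j. fps_nth (P j) j)"
    by (rule tendsto_fpsI) (auto simp: eventually_at_top_linorder intro!: stable)
  moreover have "Abs_fps (\<lambda>j. fps_nth (P j) j) \<noteq> 0"
    by (auto simp: fps_eq_iff P_def A intro!: exI[of _ 0])
  ultimately have "A has_prod Abs_fps (\<lambda>j. fps_nth (P j) j)"
    by (simp add: has_prod_def raw_has_prod_def P_def)
  moreover from has_prod_unique[OF this] have "gen_fun f b = Abs_fps (\<lambda>j. fps_nth (P j) j)"
    by (simp add: gen_fun_def A_def)
  ultimately show ?thesis by (simp add: A_def)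
qed

text \<open>
  The product over all \<open>k \<ge> 1\<close> of the coefficients \<open>g\<^bsub>k, R_k(p)\<^esub>\<close> reduces to the finitely many
  \<open>k\<close> occurring in \<open>p\<close>, because \<open>g\<^bsub>k,0\<^esub> = 1\<close>.
\<close>

definition grand_canonical :: "real fps \<Rightarrow> (nat \<Rightarrow> real) \<Rightarrow> real \<Rightarrow> nat multiset measure" where
  "grand_canonical f b x = point_measure partitions (\<lambda>p. ennreal
     (x ^ weight p / eval_fps (gen_fun f b) x *
      (\<Prod>k\<in>set_mset p. fps_nth (fps_rpow f (b k)) (count p k))))"


section \<open>Ergodicity\<close>

text \<open>
  Piecewise continuity on \<open>[0,\<infinity>)\<close>: finitely many discontinuities in each bounded interval, all of
  them jumps. No right limit is required at \<open>0\<close>, since a limit shape may be unbounded near \<open>0\<close>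
  (as happens already for uniformly random partitions).
\<close>

definition piecewise_continuous :: "(real \<Rightarrow> real) \<Rightarrow> bool" where
  "piecewise_continuous \<phi> \<longleftrightarrow>
     (\<forall>a>0. finite {t \<in> {0<..a}. \<not> isCont \<phi> t}) \<and>
     (\<forall>t>0. (\<exists>l. (\<phi> \<longlongrightarrow> l) (at_left t)) \<and> (\<exists>r. (\<phi> \<longlongrightarrow> r) (at_right t)))"

definition limit_shape_function :: "(real \<Rightarrow> real) \<Rightarrow> bool" where
  "limit_shape_function \<phi> \<longleftrightarrow>
     (\<forall>t\<ge>0. \<phi> t \<ge> 0) \<and> piecewise_continuous \<phi> \<and> (\<phi> has_integral 1) {0..}"

definition scaled_tail ::
  "(real \<Rightarrow> nat multiset measure) \<Rightarrow> (real \<Rightarrow> real) \<Rightarrow> real \<Rightarrow> nat multiset \<Rightarrow> real \<Rightarrow> real" where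
  "scaled_tail \<mu> \<alpha> x p t =
     \<alpha> x / (\<integral>q. real (weight q) \<partial>\<mu> x) * real (tail_count p (\<alpha> x * t))"

text \<open>
  The radius \<open>\<rho>\<close> is extended real, so the limit of the real variable \<open>x\<close> tending to \<open>\<rho>\<close> from below
  is taken along the preimage of the filter \<open>at_left \<rho>\<close>.
\<close>

definition ergodic_with ::
  "ereal \<Rightarrow> (real \<Rightarrow> nat multiset measure) \<Rightarrow> (real \<Rightarrow> real) \<Rightarrow> (real \<Rightarrow> real) \<Rightarrow> bool" where
  "ergodic_with \<rho> \<mu> \<alpha> \<phi> \<longleftrightarrow>
     (\<forall>x. 0 < x \<and> ereal x < \<rho> \<longrightarrow> \<alpha> x > 0) \<and> limit_shape_function \<phi> \<and>
     (\<forall>\<epsilon>>0. \<forall>T. finite T \<and> T \<subseteq> {t. t > 0 \<and> isCont \<phi> t} \<longrightarrow>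
        ((\<lambda>x. measure (\<mu> x) {p \<in> partitions. \<forall>t\<in>T. \<bar>scaled_tail \<mu> \<alpha> x p t - \<phi> t\<bar> < \<epsilon>}) \<longlongrightarrow> 1)
          (filtercomap ereal (at_left \<rho>)))"

definition ergodic :: "ereal \<Rightarrow> (real \<Rightarrow> nat multiset measure) \<Rightarrow> bool" where
  "ergodic \<rho> \<mu> \<longleftrightarrow> (\<exists>\<alpha> \<phi>. ergodic_with \<rho> \<mu> \<alpha> \<phi>)"


section \<open>Singularities on the circle of convergence\<close>

definition complex_fun :: "real fps \<Rightarrow> complex \<Rightarrow> complex" where
  "complex_fun f = eval_fps (Abs_fps (\<lambda>j. complex_of_real (fps_nth f j)))"

text \<open>
  \<open>G\<close> continues \<open>f\<close>, given on its open disc of convergence, to the set \<open>A\<close>.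
\<close>

definition continues_to :: "real fps \<Rightarrow> (complex \<Rightarrow> complex) \<Rightarrow> complex set \<Rightarrow> bool" where
  "continues_to f G A \<longleftrightarrow> G holomorphic_on A \<and>
     (\<forall>z\<in>A. ereal (norm z) < fps_conv_radius f \<longrightarrow> G z = complex_fun f z)"

definition removable_at :: "real fps \<Rightarrow> complex \<Rightarrow> bool" where
  "removable_at f c \<longleftrightarrow> (\<exists>r>0. \<exists>G. continues_to f G (ball c r))"

definition has_pole_at :: "real fps \<Rightarrow> complex \<Rightarrow> bool" where
  "has_pole_at f c \<longleftrightarrow> (\<exists>r>0. \<exists>G. continues_to f G (ball c r - {c}) \<and> is_pole G c)"


section \<open>Slow variation and the limit shape\<close>

definition slowly_varying :: "(real \<Rightarrow> real) \<Rightarrow> bool" where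
  "slowly_varying L \<longleftrightarrow> L \<in> borel_measurable (lebesgue_on {0<..}) \<and>
     (\<forall>y>0. ((\<lambda>x. L (x * y) / L x) \<longlongrightarrow> 1) at_top)"

definition log_deriv :: "real fps \<Rightarrow> real \<Rightarrow> real" where
  "log_deriv f u = deriv (eval_fps f) u / eval_fps f u"

definition shape_const :: "real fps \<Rightarrow> real \<Rightarrow> real" where
  "shape_const f \<beta> = (let h = log_deriv f in
     integral {0..1} (\<lambda>u. \<bar>ln u\<bar> powr (\<beta> + 1) * (h u + u * deriv h u) - \<bar>ln u\<bar> powr \<beta> * h u))"

definition limit_shape :: "real fps \<Rightarrow> real \<Rightarrow> real \<Rightarrow> real" where
  "limit_shape f \<beta> t = (let h = log_deriv f in
     1 / shape_const f \<beta> *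
       (integral {0..exp (- t)} (\<lambda>u. (h u + u * deriv h u) * \<bar>ln u\<bar> powr \<beta>)
        - t powr \<beta> * h (exp (- t)) * exp (- t)))"

end

(* Under the grand canonical measure the numbers R_k of parts equal to k are independent, with mean
   b_k q(x^k) and variance b_k u q'(u) at u = x^k, where q(u) = u h(u) and h = f'/f; here q' >= 0.

   Case (i).  Writing q(x^k) as the integral of q' over (0, x^k) and exchanging sum and integral, the
   mean number of parts exceeding t/(1-x) becomes the integral of q'(u) (B(|log u| T) - B(t/(1-x)))^+
   over (0,1), with T = 1/|log x|.  Since B is monotone and regularly varying, dominated convergence
   (Potter's bound, and q'(u) = O((1-u)^-2)) gives the asymptotics of this mean, and likewise of the
   mean weight, with k b_k in place of b_k.  For fixed t > 0 the variance of the number of parts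
   exceeding t/(1-x) is at most a constant times its mean, which tends to infinity, so Chebyshev's
   inequality applies.  The bound on q' only needs f((1+u)/2) = O(f(u)), by convexity of f.

   Case (ii).  As x tends to rho_1 the weight carried by parts greater than 1 has bounded mean,
   whereas the mean of R_1 diverges.  Ergodicity would therefore force R_1 to concentrate around a
   deterministic value.  But for y = x / rho_1 a pole of order m gives E y^(R_1) -> 2^-m and
   E y^(2 R_1) -> 3^-m, so that y^(R_1) has a limiting variance 3^-m - 4^-m > 0. *)

theory Submission
  imports Defs "HOL-Probability.Probability_Measure" "HOL-Real_Asymp.Real_Asymp"
begin

section \<open>Real powers of power series\<close>

text \<open>Two points need care before any probability enters. The series f(z)^(b_k) might converge
  in a smaller disc than f, because f may have complex zeros; nonnegativity of its coefficients
  prevents this, and the proof reads it off the coefficient recursion of g' f = c f' g instead of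
  using complex analysis. In case (i), q' may grow like (1-u)^-2, so a majorant |log u|^\<kappa> is
  integrable against it near u = 1 only for \<kappa> > 1. The sums of k b_k have index \<beta> + 1 >
  1 and satisfy this; those of b_k need not, and there the cutoff at t > 0 removes a neighbourhood
  of u = 1. In case (ii) nothing is known about the scaling. A single continuity point t0 with
  \<phi>(t0) > 0 is enough: parts above 1 are too light to fill the tail at t0, so \<alpha> t0 < 1
  near the singularity, and the tail count becomes the number of all parts, which is R_1 up to an
  error of bounded mean. The centre of concentration of R_1 may have any size, which is why the
  bound on the variance of y^(R_1) must be uniform in it.\<close>

lemma fps_rpow_nth_0 [simp]: "fps_nth f 0 = 1 \<Longrightarrow> fps_nth (fps_rpow f c) 0 = 1"
  by (simp add: fps_rpow_def fps_compose_nth_0)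

text \<open>This is g'/g = c f'/f without division, inherited from (1 + X) B' = c B for the binomial
  series. The coefficient recursion, the moments and the growth bound for f^c all come from
  it.\<close>

lemma fps_rpow_deriv:
  assumes "fps_nth f 0 = 1"
  shows "fps_deriv (fps_rpow f c) * f = fps_const c * fps_deriv f * fps_rpow f c"
proof -
  let ?B = "fps_binomial c" and ?w = "f - 1"
  have w0: "fps_nth ?w 0 = 0" using assms by simp
  have "fps_deriv ?B = fps_const c * ?B / (1 + fps_X)"
    by (rule fps_binomial_deriv)
  then have "fps_deriv ?B * (1 + fps_X) = fps_const c * ?B"
    by (simp add: fps_divide_unit mult.assoc inverse_mult_eq_1)
  then have "(fps_deriv ?B * (1 + fps_X)) oo ?w = (fps_const c * ?B) oo ?w"
    by simp
  then have *: "(fps_deriv ?B oo ?w) * f = fps_const c * (?B oo ?w)"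
    using w0 by (simp add: fps_compose_mult_distrib fps_compose_add_distrib)
  have "fps_deriv (fps_rpow f c) * f = ((fps_deriv ?B oo ?w) * f) * fps_deriv f"
    unfolding fps_rpow_def by (simp add: fps_compose_deriv[OF w0])
  also have "\<dots> = fps_const c * fps_deriv f * fps_rpow f c"
    unfolding * fps_rpow_def by (simp add: mult_ac)
  finally show ?thesis .
qed

text \<open>In this form every coefficient with a nonnegative contribution has \<open>j > n / (c + 1)\<close>,
  so \<open>g\<^sub>n\<close> only depends on the \<open>g\<^sub>i\<close> with \<open>i < n c / (c + 1)\<close>.\<close>

lemma fps_rpow_nth_rec:
  fixes f :: "real fps" and c :: real
  assumes "fps_nth f 0 = 1"
  defines "g \<equiv> fps_nth (fps_rpow f c)"
  shows "real n * g n = (\<Sum>j=1..n. (c * real j - (real n - real j)) * fps_nth f j * g (n - j))"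
proof (cases n)
  case 0 then show ?thesis by simp
next
  case (Suc m)
  \<comment> \<open>The coefficients of degree m = n - 1 are compared. After reversal of the
    left-hand sum its term of index 0 is n g_n, because f has constant term 1, and the other terms
    move to the right.\<close>
  have "fps_nth (fps_deriv (fps_rpow f c) * f) m = fps_nth (fps_const c * (fps_deriv f * fps_rpow f c)) m"
    by (simp add: fps_rpow_deriv[OF assms(1)] mult.assoc)
  then have "(\<Sum>i=0..m. real (Suc i) * g (Suc i) * fps_nth f (m - i)) =
             (\<Sum>i=0..m. c * real (Suc i) * fps_nth f (Suc i) * g (m - i))"
    by (simp add: fps_mult_nth[of _ f] mult.assoc fps_mult_left_const_nth del: of_nat_Suc)
       (simp add: fps_mult_nth g_def sum_distrib_left mult.assoc del: of_nat_Suc)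
  moreover have "(\<Sum>i=0..m. real (Suc i) * g (Suc i) * fps_nth f (m - i))
      = (\<Sum>i=0..n. real (n - i) * g (n - i) * fps_nth f i)"
  proof -
    have "(\<Sum>i=0..m. real (Suc i) * g (Suc i) * fps_nth f (m - i))
        = (\<Sum>i=0..m. real (Suc (m - i)) * g (Suc (m - i)) * fps_nth f (m - (m - i)))"
      by (subst sum.atLeastAtMost_rev) (simp del: of_nat_Suc)
    also have "\<dots> = (\<Sum>i=0..m. real (n - i) * g (n - i) * fps_nth f i)"
      by (rule sum.cong) (auto simp: Suc Suc_diff_le)
    also have "\<dots> = (\<Sum>i=0..n. real (n - i) * g (n - i) * fps_nth f i)"
      by (simp add: Suc)
    finally show ?thesis .
  qed
  moreover have "(\<Sum>i=0..n. real (n - i) * g (n - i) * fps_nth f i)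
      = real n * g n + (\<Sum>j=1..n. real (n - j) * g (n - j) * fps_nth f j)"
    using assms(1) by (simp add: sum.atLeast_Suc_atMost)
  moreover have "(\<Sum>i=0..m. c * real (Suc i) * fps_nth f (Suc i) * g (m - i))
      = (\<Sum>j=1..n. c * real j * fps_nth f j * g (n - j))"
    unfolding Suc One_nat_def by (subst sum.atLeast_Suc_atMost_Suc_shift) simp
  moreover have "(\<Sum>j=1..n. (c * real j - (real n - real j)) * fps_nth f j * g (n - j))
    = (\<Sum>j=1..n. c * real j * fps_nth f j * g (n - j)) - (\<Sum>j=1..n. real (n - j) * g (n - j) * fps_nth f j)"
    unfolding sum_subtractf[symmetric] by (rule sum.cong) (auto simp: algebra_simps of_nat_diff)
  ultimately show ?thesis by linarith
qed

lemma fps_rpow_nth_1: "fps_nth f 0 = 1 \<Longrightarrow> fps_nth (fps_rpow f c) 1 = c * fps_nth f 1"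
  using fps_rpow_nth_rec[of f 1 c] by simp

lemma fps_rpow_1: "fps_nth f 0 = 1 \<Longrightarrow> fps_rpow f 1 = f"
  by (simp add: fps_rpow_def fps_binomial_1 fps_compose_add_distrib)

text \<open>Each value is controlled by values at indices smaller by the factor \<theta> < 1. If
  those grow like Q^i, the bound on \<open>G n\<close> is of order (n + 1) Q^(\<theta> n), far below
  Q^n; hence the growth is slower than every exponential.\<close>

lemma subexponential_of_fractional_sum_bound:
  fixes G :: "nat \<Rightarrow> real"
  assumes nonneg: "\<And>n. G n \<ge> 0" and \<theta>: "\<theta> \<ge> 0" "\<theta> < 1" and C: "C \<ge> 0"
    and bound: "\<And>n. n > 0 \<Longrightarrow> G n \<le> C * (\<Sum>i | i < n \<and> real i \<le> \<theta> * real n. G i)"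
    and Q: "Q > 1"
  obtains K where "\<And>n. G n \<le> K * Q ^ n"
proof -
  \<comment> \<open>The gain Q^(\<eta> n) between Q^(\<theta> n) and Q^n beats the polynomial factor
    C (n + 1) from some \<open>n0\<close> on. Smaller indices are absorbed by the constant
    \<open>K\<close>.\<close>
  define \<eta> where "\<eta> = 1 - \<theta>"
  have "((\<lambda>n. C * (real n + 1) / Q powr (\<eta> * real n)) \<longlongrightarrow> 0) sequentially"
    using Q \<theta> unfolding \<eta>_def by real_asymp
  then have "eventually (\<lambda>n. C * (real n + 1) / Q powr (\<eta> * real n) < 1) sequentially"
    by (rule order_tendstoD) simp
  then obtain n0 where n0: "\<And>n. n \<ge> n0 \<Longrightarrow> C * (real n + 1) / Q powr (\<eta> * real n) < 1"
    by (auto simp: eventually_sequentially)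
  define K where "K = (\<Sum>i\<le>n0. G i)"
  have K0: "K \<ge> 0" by (auto simp: K_def nonneg intro: sum_nonneg)
  have "G n \<le> K * Q ^ n" for n
  proof (induction n rule: less_induct)
    case (less n)
    show ?case
    proof (cases "n \<le> n0")
      case True
      then have "G n \<le> K" unfolding K_def by (intro member_le_sum) (auto simp: nonneg)
      also have "\<dots> \<le> K * Q ^ n" using K0 Q by (simp add: mult_le_cancel_left1)
      finally show ?thesis .
    next
      case False
      let ?I = "{i. i < n \<and> real i \<le> \<theta> * real n}"
      have card: "real (card ?I) \<le> real n + 1"
        using card_mono[of "{..<n}" ?I] by force
      have "(\<Sum>i\<in>?I. G i) \<le> (\<Sum>i\<in>?I. K * Q powr (\<theta> * real n))"
      proof (rule sum_mono)
        fix i assume i: "i \<in> ?I"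
        then have "G i \<le> K * Q ^ i" using less.IH by auto
        also have "Q ^ i = Q powr real i" using Q by (simp add: powr_realpow)
        also have "K * Q powr real i \<le> K * Q powr (\<theta> * real n)"
          using i Q K0 by (intro mult_left_mono) auto
        finally show "G i \<le> K * Q powr (\<theta> * real n)" .
      qed
      also have "\<dots> \<le> (real n + 1) * (K * Q powr (\<theta> * real n))"
        using card K0 by (simp add: mult_right_mono)
      finally have "G n \<le> C * ((real n + 1) * (K * Q powr (\<theta> * real n)))"
        using False by (intro order_trans[OF bound mult_left_mono] C) auto
      also have "\<dots> = (C * (real n + 1)) * (K * Q powr (\<theta> * real n))" by simp
      also have "\<dots> \<le> Q powr (\<eta> * real n) * (K * Q powr (\<theta> * real n))"
        using n0[of n] False Q K0 by (intro mult_right_mono) (auto simp: field_simps)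
      also have "\<dots> = K * Q ^ n"
        using Q by (simp add: \<eta>_def algebra_simps flip: powr_realpow powr_add)
      finally show ?thesis .
    qed
  qed
  then show thesis by (rule that)
qed

text \<open>A priori f^c can be singular at complex zeros of f inside the disc. With nonnegative
  coefficients a first singularity would have to lie on the positive axis, where f >= 1. The
  elementary version of this: once the nonpositive terms of the recursion are dropped, only indices
  up to \<theta> n remain, so the coefficients scaled by r^n grow subexponentially for every r below
  the radius of f.\<close>

lemma fps_conv_radius_rpow:
  fixes f :: "real fps"
  assumes f0: "fps_nth f 0 = 1" and f: "\<And>j. fps_nth f j \<ge> 0" and c: "c \<ge> 0"
    and g: "\<And>j. fps_nth (fps_rpow f c) j \<ge> 0"
  shows "fps_conv_radius (fps_rpow f c) \<ge> fps_conv_radius f"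
  unfolding fps_conv_radius_def[of "fps_rpow f c"]
proof (rule conv_radius_geI_ex)
  fix z :: real assume z: "0 < z" "ereal z < fps_conv_radius f"
  obtain r where r: "ereal z < ereal r" "ereal r < fps_conv_radius f"
    using ereal_dense2[OF z(2)] by auto
  define g where "g = fps_nth (fps_rpow f c)"
  have r0: "r > 0" "z < r" using z r by auto
  have sum: "summable (\<lambda>n. fps_nth f n * r ^ n)"
    using r r0 by (intro summable_fps) auto
  define A where "A = eval_fps f r"
  have A: "fps_nth f n * r ^ n \<le> A" for n
  proof -
    have "(\<Sum>i\<in>{n}. fps_nth f i * r ^ i) \<le> (\<Sum>i. fps_nth f i * r ^ i)"
      by (rule sum_le_suminf[OF sum]) (use f r0 in auto)
    then show ?thesis by (simp add: A_def eval_fps_def)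
  qed
  have A0: "A \<ge> 0" using A[of 0] f[of 0] by simp
  \<comment> \<open>With i = n - j, the factor c j - (n - j) of the recursion is positive exactly
    for i < c n / (c + 1).\<close>
  define \<theta> where "\<theta> = c / (c + 1)"
  have \<theta>: "\<theta> \<ge> 0" "\<theta> < 1" using c by (auto simp: \<theta>_def)
  \<comment> \<open>The midpoint of 1 and r / z: it exceeds 1, while Q z / r stays below 1 and
    yields a geometric majorant at z.\<close>
  define Q where "Q = (1 + r / z) / 2"
  have Q: "Q > 1" "Q * z / r < 1" using z r0 by (auto simp: Q_def field_simps)
  have bound: "g n * r ^ n \<le> (c * A) * (\<Sum>i | i < n \<and> real i \<le> \<theta> * real n. g i * r ^ i)" if n: "n > 0" for n
  proof -
    let ?J = "{j\<in>{1..n}. real (n - j) \<le> \<theta> * real n}"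
    have "real n * g n = (\<Sum>j=1..n. (c * real j - (real n - real j)) * fps_nth f j * g (n - j))"
      unfolding g_def by (rule fps_rpow_nth_rec[OF f0])
    also have "\<dots> \<le> (\<Sum>j=1..n. if real (n - j) \<le> \<theta> * real n then c * real n * (fps_nth f j * g (n - j)) else 0)"
    proof (rule sum_mono)
      fix j assume j: "j \<in> {1..n}"
      have fg: "fps_nth f j * g (n - j) \<ge> 0" using f g by (auto simp: g_def)
      have "c * real j \<le> c * real n" using j c by (intro mult_left_mono) auto
      then have 1: "c * real j - (real n - real j) \<le> c * real n" using j by auto
      have 2: "c * real j - (real n - real j) \<le> 0" if "\<not> real (n - j) \<le> \<theta> * real n"
        using that j c by (simp add: \<theta>_def of_nat_diff field_simps)
      show "(c * real j - (real n - real j)) * fps_nth f j * g (n - j) \<le> 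
        (if real (n - j) \<le> \<theta> * real n then c * real n * (fps_nth f j * g (n - j)) else 0)"
        using mult_right_mono[OF 1 fg] mult_right_mono[OF 2 fg] by (auto simp: mult.assoc)
    qed
    also have "\<dots> = (\<Sum>j\<in>?J. c * real n * (fps_nth f j * g (n - j)))"
      by (rule sum.inter_filter[symmetric]) simp
    also have "\<dots> = real n * (c * (\<Sum>j\<in>?J. fps_nth f j * g (n - j)))"
      unfolding sum_distrib_left by (rule sum.cong) auto
    finally have "g n \<le> c * (\<Sum>j\<in>?J. fps_nth f j * g (n - j))" using n by simp
    then have "g n * r ^ n \<le> c * (\<Sum>j\<in>?J. fps_nth f j * g (n - j)) * r ^ n"
      using r0 by (intro mult_right_mono) auto
    also have "\<dots> = c * (\<Sum>j\<in>?J. (fps_nth f j * r ^ j) * (g (n - j) * r ^ (n - j)))"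
      by (simp add: sum_distrib_right mult.assoc) 
         (intro disjI2 sum.cong refl, auto simp: algebra_simps simp flip: power_add)
    also have "\<dots> \<le> c * (\<Sum>j\<in>?J. A * (g (n - j) * r ^ (n - j)))"
      using A c g r0 by (intro mult_left_mono sum_mono mult_right_mono) (auto simp: g_def)
    also have "(\<Sum>j\<in>?J. A * (g (n - j) * r ^ (n - j))) = 
        (\<Sum>i | i < n \<and> real i \<le> \<theta> * real n. A * (g i * r ^ i))"
      by (rule sum.reindex_bij_witness[of _ "\<lambda>i. n - i" "\<lambda>i. n - i"]) auto
    finally show ?thesis by (simp add: sum_distrib_left mult.assoc)
  qed
  obtain K where K: "\<And>n. g n * r ^ n \<le> K * Q ^ n"
    by (rule subexponential_of_fractional_sum_bound[of "\<lambda>n. g n * r ^ n" \<theta> "c * A" Q])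
       (use \<theta> c A0 Q bound g r0 in \<open>auto simp: g_def\<close>)
  have "summable (\<lambda>n. g n * z ^ n)"
  proof (rule summable_comparison_test[of _ "\<lambda>n. K * (Q * z / r) ^ n"])
    have "norm (g n * z ^ n) \<le> K * (Q * z / r) ^ n" for n
    proof -
      have "g n * z ^ n = (g n * r ^ n) * (z / r) ^ n" using r0 by (simp add: field_simps)
      also have "\<dots> \<le> (K * Q ^ n) * (z / r) ^ n" using K z r0 by (intro mult_right_mono) auto
      also have "\<dots> = K * (Q * z / r) ^ n" by (simp add: power_mult_distrib power_divide)
      finally show ?thesis using g z by (simp add: g_def)
    qed
    then show "\<exists>N. \<forall>n\<ge>N. norm (g n * z ^ n) \<le> K * (Q * z / r) ^ n" by auto
    show "summable (\<lambda>n. K * (Q * z / r) ^ n)"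
      using Q z r0 by (intro summable_mult summable_geometric) auto
  qed
  then show "\<exists>w. norm w = z \<and> summable (\<lambda>n. fps_nth (fps_rpow f c) n * w ^ n)"
    using z by (intro exI[of _ z]) (auto simp: g_def)
qed

section \<open>The logarithmic derivative\<close>

lemma eval_fps_nonneg_mono:
  fixes F :: "real fps"
  assumes "\<And>j. fps_nth F j \<ge> 0" "0 \<le> u" "u \<le> v" "ereal v < fps_conv_radius F"
  shows "eval_fps F u \<le> eval_fps F v"
proof -
  have "ereal (norm u) < fps_conv_radius F" "ereal (norm v) < fps_conv_radius F"
    using assms by (auto intro: le_less_trans[of _ "ereal v"])
  from summable_fps[OF this(1)] summable_fps[OF this(2)]
  show ?thesis unfolding eval_fps_def
    using assms by (intro suminf_le mult_left_mono power_mono) auto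
qed

lemma eval_fps_ge_nth:
  fixes F :: "real fps"
  assumes "\<And>j. fps_nth F j \<ge> 0" "0 \<le> u" "ereal u < fps_conv_radius F"
  shows "fps_nth F j * u ^ j \<le> eval_fps F u"
proof -
  have "summable (\<lambda>j. fps_nth F j * u ^ j)"
    using assms by (intro summable_fps) auto
  from sum_le_suminf[OF this, of "{j}"] show ?thesis
    using assms by (simp add: eval_fps_def)
qed

lemma eval_fps_nonneg:
  fixes F :: "real fps"
  assumes "\<And>j. fps_nth F j \<ge> 0" "0 \<le> u" "ereal u < fps_conv_radius F"
  shows "eval_fps F u \<ge> 0"
  using eval_fps_ge_nth[OF assms, of 0] assms(1)[of 0] by simp

lemma fps_conv_radius_deriv_less:
  fixes F :: "real fps"
  shows "ereal u < fps_conv_radius F \<Longrightarrow> ereal u < fps_conv_radius (fps_deriv F)"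
  by (rule less_le_trans[OF _ fps_conv_radius_deriv])

text \<open>A real substitute for Cauchy's estimate: F' increases, so F grows by at least F'(u) (v -
  u) between u and v, and F(u) >= 0 is discarded.\<close>

lemma eval_fps_deriv_mult_le:
  fixes F :: "real fps"
  assumes F: "\<And>j. fps_nth F j \<ge> 0" and u: "0 \<le> u" "u < v" and v: "ereal v < fps_conv_radius F"
  shows "eval_fps (fps_deriv F) u * (v - u) \<le> eval_fps F v"
proof -
  have w: "ereal w < fps_conv_radius F" if "w \<le> v" for w
    using that v by (auto intro: le_less_trans[of _ "ereal v"])
  have "\<exists>z>u. z < v \<and> eval_fps F v - eval_fps F u = (v - u) * eval_fps (fps_deriv F) z"
    using u w by (intro MVT2 has_field_derivative_eval_fps) auto
  then obtain z where z: "u < z" "z < v" "eval_fps F v - eval_fps F u = (v - u) * eval_fps (fps_deriv F) z"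
    by auto
  have "eval_fps (fps_deriv F) u \<le> eval_fps (fps_deriv F) z"
    using F u z fps_conv_radius_deriv_less[OF w[of z]] by (intro eval_fps_nonneg_mono) auto
  then have "eval_fps (fps_deriv F) u * (v - u) \<le> eval_fps F v - eval_fps F u"
    using z u by (simp add: mult.commute mult_left_mono)
  moreover have "eval_fps F u \<ge> 0" using F u w[of u] by (intro eval_fps_nonneg) auto
  ultimately show ?thesis by linarith
qed

lemma sums_first_moment:
  fixes F :: "real fps"
  assumes "ereal \<bar>y\<bar> < fps_conv_radius F"
  shows "(\<lambda>j. real j * (fps_nth F j * y ^ j)) sums (y * eval_fps (fps_deriv F) y)"
proof -
  have "summable (\<lambda>j. fps_nth (fps_deriv F) j * y ^ j)"
    using fps_conv_radius_deriv_less[OF assms] by (intro summable_fps) auto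
  then have "(\<lambda>j. y * (fps_nth (fps_deriv F) j * y ^ j)) sums (y * eval_fps (fps_deriv F) y)"
    unfolding eval_fps_def by (intro sums_mult summable_sums)
  then have "(\<lambda>j. real (Suc j) * (fps_nth F (Suc j) * y ^ Suc j)) sums (y * eval_fps (fps_deriv F) y)"
    by (simp add: mult_ac del: of_nat_Suc)
  then show ?thesis by (subst (asm) sums_Suc_iff) simp
qed

lemma sums_second_moment:
  fixes F :: "real fps"
  assumes "ereal \<bar>y\<bar> < fps_conv_radius F"
  shows "(\<lambda>j. (real j)\<^sup>2 * (fps_nth F j * y ^ j)) sums
    (y * eval_fps (fps_deriv F) y + y\<^sup>2 * eval_fps (fps_deriv (fps_deriv F)) y)"
proof -
  \<comment> \<open>The Euler operator z d/dz multiplies the j-th coefficient by j, so the second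
    moment of F is the first moment of this series.\<close>
  define H where "H = fps_X * fps_deriv F"
  have nth: "fps_nth H j = real j * fps_nth F j" for j
    by (cases j) (auto simp: H_def)
  have d: "ereal \<bar>y\<bar> < fps_conv_radius (fps_deriv F)"
    using fps_conv_radius_deriv_less[OF assms] .
  have d2: "ereal \<bar>y\<bar> < fps_conv_radius (fps_deriv (fps_deriv F))"
    using fps_conv_radius_deriv_less[OF d] .
  have H: "ereal \<bar>y\<bar> < fps_conv_radius H"
    unfolding H_def using d fps_conv_radius_mult[of fps_X "fps_deriv F"] by auto
  have dH: "fps_deriv H = fps_deriv F + fps_X * fps_deriv (fps_deriv F)"
    by (simp add: H_def)
  have X: "ereal \<bar>y\<bar> < fps_conv_radius (fps_X * fps_deriv (fps_deriv F))"
    using d2 fps_conv_radius_mult[of fps_X "fps_deriv (fps_deriv F)"] by auto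
  have "eval_fps (fps_deriv H) y = eval_fps (fps_deriv F) y + y * eval_fps (fps_deriv (fps_deriv F)) y"
    unfolding dH using d d2 X by (subst eval_fps_add) (auto simp: eval_fps_mult)
  with sums_first_moment[OF H] show ?thesis
    by (simp add: nth power2_eq_square algebra_simps)
qed

section \<open>Mean and variance functions of f and of its powers\<close>

locale pgf =
  fixes f :: "real fps"
  assumes f0: "fps_nth f 0 = 1" and nonneg: "\<And>j. fps_nth f j \<ge> 0" and f1: "fps_nth f 1 > 0"
    and radius_pos: "fps_conv_radius f > 0"
begin

definition q :: "real \<Rightarrow> real" where "q u = u * log_deriv f u"

text \<open>Written in the form in which the integrand of the limit shape contains it;
  \<open>q_deriv\<close> identifies it with the derivative of \<open>q\<close>.\<close>

definition q' :: "real \<Rightarrow> real" where "q' u = log_deriv f u + u * deriv (log_deriv f) u"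

abbreviation E where "E \<equiv> eval_fps f"
abbreviation E1 where "E1 \<equiv> eval_fps (fps_deriv f)"
abbreviation E2 where "E2 \<equiv> eval_fps (fps_deriv (fps_deriv f))"

lemma radius_mono: "u \<le> v \<Longrightarrow> ereal v < fps_conv_radius f \<Longrightarrow> ereal u < fps_conv_radius f"
  by (rule le_less_trans[of _ "ereal v"]) auto

lemma E_ge_1: "0 \<le> u \<Longrightarrow> ereal u < fps_conv_radius f \<Longrightarrow> E u \<ge> 1"
  using eval_fps_ge_nth[OF nonneg, of u 0] f0 by simp

lemma E1_ge: "0 \<le> u \<Longrightarrow> ereal u < fps_conv_radius f \<Longrightarrow> E1 u \<ge> fps_nth f 1"
  using eval_fps_ge_nth[of "fps_deriv f" u 0] nonneg fps_conv_radius_deriv_less[of u f] by simp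

lemma E2_ge_0: "0 \<le> u \<Longrightarrow> ereal u < fps_conv_radius f \<Longrightarrow> E2 u \<ge> 0"
  using nonneg fps_conv_radius_deriv_less by (intro eval_fps_nonneg) auto

lemma E_mono: "0 \<le> u \<Longrightarrow> u \<le> v \<Longrightarrow> ereal v < fps_conv_radius f \<Longrightarrow> E u \<le> E v"
  by (rule eval_fps_nonneg_mono[OF nonneg])

lemma E1_mono: "0 \<le> u \<Longrightarrow> u \<le> v \<Longrightarrow> ereal v < fps_conv_radius f \<Longrightarrow> E1 u \<le> E1 v"
  by (rule eval_fps_nonneg_mono) (auto simp: nonneg fps_conv_radius_deriv_less)

lemma E_deriv: "ereal \<bar>u\<bar> < fps_conv_radius f \<Longrightarrow> (E has_real_derivative E1 u) (at u within A)"
  by (rule has_field_derivative_eval_fps) simp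

lemma E1_deriv: "ereal \<bar>u\<bar> < fps_conv_radius f \<Longrightarrow> (E1 has_real_derivative E2 u) (at u within A)"
  by (rule has_field_derivative_eval_fps) (simp add: fps_conv_radius_deriv_less)

lemma log_deriv_eq: "ereal \<bar>u\<bar> < fps_conv_radius f \<Longrightarrow> log_deriv f u = E1 u / E u"
  unfolding log_deriv_def using E_deriv[of u UNIV] by (simp add: DERIV_imp_deriv)

lemma log_deriv_has_deriv:
  assumes u: "0 \<le> u" "ereal u < fps_conv_radius f"
  shows "(log_deriv f has_real_derivative (E2 u / E u - (E1 u / E u)\<^sup>2)) (at u within A)"
proof -
  have E: "E u \<noteq> 0" using E_ge_1[OF u] by simp
  have u': "ereal \<bar>u\<bar> < fps_conv_radius f" using u by simp
  have "((\<lambda>v. E1 v / E v) has_real_derivative (E2 u / E u - (E1 u / E u)\<^sup>2)) (at u)"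
    by (rule derivative_eq_intros E1_deriv[OF u'] E_deriv[OF u'] E refl)+
       (use E in \<open>simp add: field_simps power2_eq_square\<close>)
  \<comment> \<open>\<open>log_deriv\<close> is known to equal \<open>E1 / E\<close> only inside the
    disc of convergence, so the derivative is transferred through a neighbourhood of u.\<close>
  moreover have "eventually (\<lambda>v. log_deriv f v = E1 v / E v) (nhds u)"
  proof -
    have "u \<in> eball 0 (fps_conv_radius f)" using u' by (simp add: in_eball_iff)
    then have "eventually (\<lambda>v. v \<in> eball 0 (fps_conv_radius f)) (nhds u)"
      by (rule eventually_nhds_in_open[OF open_eball])
    then show ?thesis by eventually_elim (simp add: log_deriv_eq in_eball_iff)
  qed
  ultimately have "(log_deriv f has_real_derivative (E2 u / E u - (E1 u / E u)\<^sup>2)) (at u)"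
    by (subst DERIV_cong_ev[OF refl _ refl])
  then show ?thesis by (rule has_field_derivative_at_within)
qed

lemma q'_eq:
  assumes u: "0 \<le> u" "ereal u < fps_conv_radius f"
  shows "q' u = E1 u / E u + u * (E2 u / E u - (E1 u / E u)\<^sup>2)"
  using log_deriv_has_deriv[OF u, of UNIV] u by (simp add: q'_def log_deriv_eq DERIV_imp_deriv)

lemma q_eq: "0 \<le> u \<Longrightarrow> ereal u < fps_conv_radius f \<Longrightarrow> q u = u * E1 u / E u"
  by (simp add: q_def log_deriv_eq)

lemma q_deriv:
  assumes u: "0 \<le> u" "ereal u < fps_conv_radius f"
  shows "(q has_real_derivative q' u) (at u within A)"
  unfolding q_def[abs_def]
  by (rule derivative_eq_intros log_deriv_has_deriv[OF u] refl)+
     (use u in \<open>simp add: q'_eq log_deriv_eq\<close>)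

lemma q_0 [simp]: "q 0 = 0" by (simp add: q_def)

lemma log_deriv_nonneg: "0 \<le> u \<Longrightarrow> ereal u < fps_conv_radius f \<Longrightarrow> log_deriv f u \<ge> 0"
  using E_ge_1[of u] E1_ge[of u] f1 by (simp add: log_deriv_eq)

lemma q_nonneg: "0 \<le> u \<Longrightarrow> ereal u < fps_conv_radius f \<Longrightarrow> q u \<ge> 0"
  by (simp add: q_def log_deriv_nonneg)

lemma q_pos: "0 < u \<Longrightarrow> ereal u < fps_conv_radius f \<Longrightarrow> q u > 0"
  using E_ge_1[of u] E1_ge[of u] f1 by (simp add: q_eq)

text \<open>\<open>u q'(u)\<close> is the variance of the distribution with weights \<open>f\<^sub>j u\<^sup>j\<close>, whose mean is \<open>q(u)\<close>.\<close>

lemma q'_nonneg: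
  assumes u: "0 \<le> u" "ereal u < fps_conv_radius f"
  shows "q' u \<ge> 0"
\<comment> \<open>The variance u q'(u) carries no information at u = 0; there q' is f'(0) /
  f(0).\<close>
proof (cases "u = 0")
  case True
  moreover have "E u > 0" "E1 u > 0" using E_ge_1[OF u] E1_ge[OF u] f1 by linarith+
  ultimately show ?thesis using q'_eq[OF u] by simp
next
  case False
  have u': "ereal \<bar>u\<bar> < fps_conv_radius f" using u by simp
  define m where "m = u * E1 u / E u"
  have E: "E u > 0" using E_ge_1[OF u] by simp
  have s0: "(\<lambda>j. fps_nth f j * u ^ j) sums E u"
    using summable_fps[of u f] u' by (simp add: eval_fps_def summable_sums)
  \<comment> \<open>The summand is (j - m)^2 f_j u^j expanded, with m the mean, so the sum is f(u)
    times the variance.\<close>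
  have s: "(\<lambda>j. (real j)\<^sup>2 * (fps_nth f j * u ^ j) - 2 * m * (real j * (fps_nth f j * u ^ j)) + m\<^sup>2 * (fps_nth f j * u ^ j))
     sums (u * E1 u + u\<^sup>2 * E2 u - 2 * m * (u * E1 u) + m\<^sup>2 * E u)"
    using sums_second_moment[OF u'] sums_first_moment[OF u'] s0
    by (intro sums_add sums_diff sums_mult)
  have "0 \<le> u * E1 u + u\<^sup>2 * E2 u - 2 * m * (u * E1 u) + m\<^sup>2 * E u"
  proof (rule sums_le[OF _ sums_zero s])
    fix j
    have "(real j)\<^sup>2 * (fps_nth f j * u ^ j) - 2 * m * (real j * (fps_nth f j * u ^ j)) + m\<^sup>2 * (fps_nth f j * u ^ j)
      = (real j - m)\<^sup>2 * (fps_nth f j * u ^ j)" by (simp add: power2_eq_square algebra_simps)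
    then show "0 \<le> (real j)\<^sup>2 * (fps_nth f j * u ^ j) - 2 * m * (real j * (fps_nth f j * u ^ j)) + m\<^sup>2 * (fps_nth f j * u ^ j)"
      using nonneg u by simp
  qed
  also have "\<dots> = u * E u * q' u"
    using E u False by (simp add: q'_eq[OF u] m_def field_simps power2_eq_square)
  finally have "0 \<le> u * E u * q' u" .
  moreover have "u * E u > 0" using E u False by simp
  ultimately show ?thesis by (simp add: zero_le_mult_iff)
qed

lemma q_mono:
  assumes "0 \<le> u" "u \<le> v" "ereal v < fps_conv_radius f"
  shows "q u \<le> q v"
proof (rule DERIV_nonneg_imp_nondecreasing[OF assms(2)])
  fix x assume "u \<le> x" "x \<le> v"
  then have "0 \<le> x" "ereal x < fps_conv_radius f" using assms radius_mono by auto
  then show "\<exists>y. (q has_real_derivative y) (at x) \<and> 0 \<le> y"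
    using q_deriv q'_nonneg by blast
qed

lemma continuous_on_q':
  assumes "ereal v < fps_conv_radius f"
  shows "continuous_on {0..v} q'"
proof -
  have r: "ereal \<bar>u\<bar> < fps_conv_radius f" if "u \<in> {0..v}" for u using that assms radius_mono by auto
  have E: "E u \<noteq> 0" if "u \<in> {0..v}" for u using E_ge_1[of u] r[OF that] that by auto
  have cE: "continuous_on {0..v} E"
    using r by (intro DERIV_continuous_on[of _ E E1] E_deriv)
  have cE1: "continuous_on {0..v} E1"
    using r by (intro DERIV_continuous_on[of _ E1 E2] E1_deriv)
  have cE2: "continuous_on {0..v} E2"
    using fps_conv_radius_deriv_less[OF fps_conv_radius_deriv_less[OF r]]
    by (intro DERIV_continuous_on[of _ E2 "eval_fps (fps_deriv (fps_deriv (fps_deriv f)))"]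
        has_field_derivative_eval_fps) auto
  have "continuous_on {0..v} (\<lambda>u. E1 u / E u + u * (E2 u / E u - (E1 u / E u)\<^sup>2))"
    using E by (intro continuous_intros cE cE1 cE2) auto
  then show ?thesis
    by (rule continuous_on_eq) (use r in \<open>auto simp: q'_eq\<close>)
qed

lemma continuous_on_q:
  assumes "ereal v < fps_conv_radius f"
  shows "continuous_on {0..v} q"
  using assms radius_mono by (intro DERIV_continuous_on[of _ q q'] q_deriv) auto

text \<open>The law with weights proportional to the terms of f^c at y has c times the mean and c
  times the variance of the one for f, as if it were a sum of c independent copies. For real c this
  follows by evaluating the differential equation of f^c and its derivative at y. The normalising
  factor \<open>G\<close> stays in place to avoid division.\<close>

lemma rpow_moments:
  assumes c: "c \<ge> 0" and g: "\<And>j. fps_nth (fps_rpow f c) j \<ge> 0"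
    and y: "0 \<le> y" "ereal y < fps_conv_radius f"
  defines "G \<equiv> eval_fps (fps_rpow f c) y"
  shows "(\<lambda>j. fps_nth (fps_rpow f c) j * y ^ j) sums G"
    and "(\<lambda>j. real j * (fps_nth (fps_rpow f c) j * y ^ j)) sums (c * q y * G)"
    and "(\<lambda>j. (real j)\<^sup>2 * (fps_nth (fps_rpow f c) j * y ^ j)) sums ((c\<^sup>2 * (q y)\<^sup>2 + c * (y * q' y)) * G)"
    and "G \<ge> 1"
proof -
  define g where "g = fps_rpow f c"
  have r: "ereal \<bar>y\<bar> < fps_conv_radius g"
    unfolding g_def by (rule less_le_trans[OF _ fps_conv_radius_rpow[OF f0 nonneg c g]]) (use y in simp)
  have rf: "ereal \<bar>y\<bar> < fps_conv_radius f" using y by simp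
  note rs = r rf fps_conv_radius_deriv_less[OF r] fps_conv_radius_deriv_less[OF rf]
     fps_conv_radius_deriv_less[OF fps_conv_radius_deriv_less[OF r]]
     fps_conv_radius_deriv_less[OF fps_conv_radius_deriv_less[OF rf]]
  have E: "E y > 0" using E_ge_1[OF y] by simp
  define G1 where "G1 = eval_fps (fps_deriv g) y"
  define G2 where "G2 = eval_fps (fps_deriv (fps_deriv g)) y"
  have mult_less: "ereal \<bar>y\<bar> < fps_conv_radius (a * b)" 
    if "ereal \<bar>y\<bar> < fps_conv_radius a" "ereal \<bar>y\<bar> < fps_conv_radius b" for a b :: "real fps"
    by (rule less_le_trans[OF _ fps_conv_radius_mult]) (use that in simp)
  have ode: "fps_deriv g * f = fps_const c * (fps_deriv f * g)"
    using fps_rpow_deriv[OF f0, of c] by (simp add: g_def mult.assoc)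
  then have "eval_fps (fps_deriv g * f) y = eval_fps (fps_const c * (fps_deriv f * g)) y" by simp
  then have 1: "G1 * E y = c * (E1 y * G)"
    using rs by (simp add: eval_fps_mult mult_less G1_def G_def flip: g_def)
  from ode have "fps_deriv (fps_deriv g * f) = fps_deriv (fps_const c * (fps_deriv f * g))" by simp
  then have "fps_deriv (fps_deriv g) * f + fps_deriv g * fps_deriv f
     = fps_const c * (fps_deriv (fps_deriv f) * g + fps_deriv f * fps_deriv g)" 
    by (simp add: algebra_simps)
  then have "eval_fps (fps_deriv (fps_deriv g) * f + fps_deriv g * fps_deriv f) y
     = eval_fps (fps_const c * (fps_deriv (fps_deriv f) * g + fps_deriv f * fps_deriv g)) y" by simp
  moreover have "ereal \<bar>y\<bar> < fps_conv_radius (fps_deriv (fps_deriv f) * g + fps_deriv f * fps_deriv g)"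
    by (rule less_le_trans[OF _ fps_conv_radius_add])
       (unfold min_less_iff_conj, intro conjI mult_less rs)
  ultimately have 2: "G2 * E y + G1 * E1 y = c * (E2 y * G + E1 y * G1)"
    using rs by (simp add: eval_fps_mult eval_fps_add mult_less G1_def G2_def G_def flip: g_def)
  have G1: "G1 = c * E1 y / E y * G" using 1 E by (simp add: field_simps)
  have "G2 * E y = (c * E2 y + c * (c - 1) * (E1 y)\<^sup>2 / E y) * G"
    using 2 unfolding G1 by (simp add: field_simps power2_eq_square diff_divide_distrib)
  then have G2: "G2 = (c * E2 y / E y + c * (c - 1) * (E1 y / E y)\<^sup>2) * G"
    using E by (simp add: field_simps power2_eq_square)
  show s: "(\<lambda>j. fps_nth (fps_rpow f c) j * y ^ j) sums G"
    using summable_fps[of y "fps_rpow f c"] r by (simp add: eval_fps_def summable_sums G_def g_def)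
  have "y * G1 = c * q y * G" using E by (simp add: G1 q_eq[OF y])
  with sums_first_moment[OF r]
  show "(\<lambda>j. real j * (fps_nth (fps_rpow f c) j * y ^ j)) sums (c * q y * G)"
    by (simp add: g_def G1_def)
  have "y * G1 + y\<^sup>2 * G2 = (c\<^sup>2 * (q y)\<^sup>2 + c * (y * q' y)) * G"
    using E by (simp add: G1 G2 q_eq[OF y] q'_eq[OF y] power2_eq_square algebra_simps diff_divide_distrib)
  with sums_second_moment[OF r]
  show "(\<lambda>j. (real j)\<^sup>2 * (fps_nth (fps_rpow f c) j * y ^ j)) sums ((c\<^sup>2 * (q y)\<^sup>2 + c * (y * q' y)) * G)"
    by (simp add: g_def G1_def G2_def)
  show "G \<ge> 1"
    using eval_fps_ge_nth[of "fps_rpow f c" y 0] g y r f0 by (simp add: G_def g_def)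
qed

text \<open>A Gronwall argument: since f >= 1, the differential equation bounds the logarithmic
  derivative of f^c on [0, y] by c f'(v), so f^c times exp (- c f'(v) y) decreases from its value 1
  at 0. The exponent is linear in y, hence at y = x^k it is summable over k together with b_k
  x^k.\<close>

lemma rpow_eval_le:
  assumes c: "c \<ge> 0" and g: "\<And>j. fps_nth (fps_rpow f c) j \<ge> 0"
    and y: "0 \<le> y" "y \<le> v" "ereal v < fps_conv_radius f"
  shows "eval_fps (fps_rpow f c) y \<le> exp (c * E1 v * y)"
proof -
  define g where "g = fps_rpow f c"
  have "eval_fps g y * exp (- c * E1 v * y) \<le> eval_fps g 0 * exp (- c * E1 v * 0)"
  proof (rule DERIV_nonpos_imp_nonincreasing[OF y(1)])
    fix x assume x: "0 \<le> x" "x \<le> y"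
    have xr: "ereal x < fps_conv_radius f" using x y radius_mono by auto
    have r: "ereal \<bar>x\<bar> < fps_conv_radius g"
      unfolding g_def by (rule less_le_trans[OF _ fps_conv_radius_rpow[OF f0 nonneg c g]]) (use x xr in simp)
    have ode: "fps_deriv g * f = fps_const c * (fps_deriv f * g)"
      using fps_rpow_deriv[OF f0, of c] by (simp add: g_def mult.assoc)
    then have "eval_fps (fps_deriv g * f) x = eval_fps (fps_const c * (fps_deriv f * g)) x" by simp
    moreover have "ereal \<bar>x\<bar> < fps_conv_radius (fps_deriv f * g)"
      by (rule less_le_trans[OF _ fps_conv_radius_mult])
         (use r x fps_conv_radius_deriv_less[OF xr] in simp)
    ultimately have 1: "eval_fps (fps_deriv g) x * E x = c * (E1 x * eval_fps g x)"
      using r xr x fps_conv_radius_deriv_less[OF r] fps_conv_radius_deriv_less[OF xr] 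
      by (simp add: eval_fps_mult)
    have E: "E x \<ge> 1" using E_ge_1 x xr by simp
    have gx: "eval_fps g x \<ge> 0" using r x g by (intro eval_fps_nonneg) (auto simp: g_def)
    have g1x: "eval_fps (fps_deriv g) x \<ge> 0" using fps_conv_radius_deriv_less[OF r] x g
      by (intro eval_fps_nonneg) (auto simp: g_def)
    have "eval_fps (fps_deriv g) x \<le> eval_fps (fps_deriv g) x * E x"
      using E g1x by (simp add: mult_le_cancel_left1)
    also have "\<dots> \<le> c * (E1 v * eval_fps g x)"
      unfolding 1 using c x y gx by (intro mult_left_mono mult_right_mono E1_mono) auto
    finally have le: "eval_fps (fps_deriv g) x - c * E1 v * eval_fps g x \<le> 0" by simp
    have d1: "(eval_fps g has_real_derivative eval_fps (fps_deriv g) x) (at x)"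
      using r by (intro has_field_derivative_eval_fps) simp
    have "((\<lambda>x. eval_fps g x * exp (- c * E1 v * x)) has_real_derivative
        (eval_fps (fps_deriv g) x - c * E1 v * eval_fps g x) * exp (- c * E1 v * x)) (at x)"
      by (rule derivative_eq_intros d1 refl)+ (simp add: algebra_simps)
    then show "\<exists>z. ((\<lambda>x. eval_fps g x * exp (- c * E1 v * x)) has_real_derivative z) (at x) \<and> z \<le> 0"
      using le by (auto simp: mult_nonpos_nonneg intro!: exI)
  qed
  also have "\<dots> = 1" using f0 by (simp add: g_def eval_fps_at_0)
  finally show ?thesis by (simp add: g_def exp_minus field_simps)
qed

end

section \<open>Integrals on open intervals with singular endpoints\<close>

lemma set_integral_FTC_nonneg:
  fixes f F :: "real \<Rightarrow> real"
  assumes "a < b"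
    and F: "\<And>x. a < x \<Longrightarrow> x < b \<Longrightarrow> (F has_real_derivative f x) (at x)"
    and f: "continuous_on {a<..<b} f" "\<And>x. a < x \<Longrightarrow> x < b \<Longrightarrow> 0 \<le> f x"
    and A: "(F \<longlongrightarrow> A) (at_right a)" and B: "(F \<longlongrightarrow> B) (at_left b)"
  shows "set_integrable lborel {a<..<b} f" "(LINT x:{a<..<b}|lborel. f x) = B - A"
proof -
  have c: "isCont f x" if "a < x" "x < b" for x
    using f(1) that by (simp add: continuous_on_eq_continuous_at)
  have e: "einterval (ereal a) (ereal b) = {a<..<b}" by (auto simp: einterval_def)
  have lims: "((F \<circ> real_of_ereal) \<longlongrightarrow> A) (at_right (ereal a))"
    "((F \<circ> real_of_ereal) \<longlongrightarrow> B) (at_left (ereal b))"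
    using A B by (simp_all add: ereal_tendsto_simps1)
  have ab: "ereal a < ereal b" using \<open>a < b\<close> by simp
  note * = interval_integral_FTC_nonneg[OF ab _ _ _ lims, of f]
  have "set_integrable lborel (einterval (ereal a) (ereal b)) f"
    by (rule *(1)) (use F f(2) c in auto)
  moreover have "(LBINT x=ereal a..ereal b. f x) = B - A"
    by (rule *(2)) (use F f(2) c in auto)
  ultimately show "set_integrable lborel {a<..<b} f" "(LINT x:{a<..<b}|lborel. f x) = B - A"
    using \<open>a < b\<close> by (auto simp: e interval_lebesgue_integral_def)
qed

text \<open>Every power of the logarithm is dominated by u^(-1/2), which is integrable at 0. Take ln
  s <= s at s = u^(-1/(2a)); the exponent is chosen so that raising to the power a gives
  u^(-1/2).\<close>

lemma neg_ln_powr_le_near_0: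
  fixes u :: real
  assumes "a > 0" "0 < u" "u < 1"
  shows "(- ln u) powr a \<le> (2 * a) powr a * u powr (-1/2)"
proof -
  have "ln (u powr (-1/(2*a))) \<le> u powr (-1/(2*a))"
    using ln_le_minus_one[of "u powr (-1/(2*a))"] assms by simp
  then have "- ln u \<le> (2*a) * u powr (-1/(2*a))"
    using assms by (simp add: ln_powr field_simps)
  then have "(- ln u) powr a \<le> ((2*a) * u powr (-1/(2*a))) powr a"
    using assms by (intro powr_mono2) auto
  also have "\<dots> = (2*a) powr a * u powr (-1/2)"
    using assms by (simp add: powr_mult powr_powr)
  finally show ?thesis .
qed

lemma neg_ln_le_near_1:
  fixes u :: real
  assumes "1/2 \<le> u" "u < 1"
  shows "- ln u \<le> 2 * (1 - u)"
proof -
  have "- ln u = ln (1/u)" using assms by (simp add: ln_div)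
  also have "\<dots> \<le> 1/u - 1" using assms by (intro ln_le_minus_one) auto
  also have "\<dots> = (1 - u) / u" using assms by (simp add: field_simps)
  also have "\<dots> \<le> (1 - u) / (1/2)" using assms by (intro divide_left_mono) auto
  finally show ?thesis by simp
qed

text \<open>Near 1 the logarithm is of order 1 - u, so the product is O((1 - u)^(a - 2)), integrable
  because a > 1. Near 0 the function g is bounded and only the logarithm matters.\<close>

lemma set_integrable_mult_neg_ln_powr:
  fixes g :: "real \<Rightarrow> real"
  assumes cont: "continuous_on {0<..<1} g"
    and g: "\<And>u. 0 < u \<Longrightarrow> u < 1 \<Longrightarrow> 0 \<le> g u \<and> g u \<le> D / (1 - u)\<^sup>2"
    and a: "a > 1"
  shows "set_integrable lborel {0<..<1} (\<lambda>u. g u * (- ln u) powr a)"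
proof -
  define w where "w = (\<lambda>u::real. u powr (-1/2) + (1 - u) powr (a - 2))"
  have D: "D \<ge> 0" using g[of "1/2"] by (auto simp: power2_eq_square)
  \<comment> \<open>The first summand serves u <= 1/2, where 1 / (1 - u)^2 <= 4; the second serves u
    > 1/2, where - ln u <= 2 (1 - u).\<close>
  define K where "K = 4 * D * (2 * a) powr a + D * 2 powr a"
  have w: "set_integrable lborel {0<..<1} w"
  proof (rule set_integral_FTC_nonneg(1))
    show "((\<lambda>u::real. 2 * u powr (1/2) - (1 - u) powr (a - 1) / (a - 1)) \<longlongrightarrow> - inverse (a - 1)) (at_right 0)"
      using a by real_asymp
    show "((\<lambda>u::real. 2 * u powr (1/2) - (1 - u) powr (a - 1) / (a - 1)) \<longlongrightarrow> 2) (at_left 1)"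
      using a by real_asymp
    show "continuous_on {0<..<1} w" unfolding w_def by (intro continuous_intros) auto
    show "((\<lambda>u. 2 * u powr (1/2) - (1 - u) powr (a - 1) / (a - 1)) has_real_derivative w x) (at x)"
      if "0 < x" "x < 1" for x
      using that a by (auto intro!: derivative_eq_intros simp: w_def)
  qed (auto simp: w_def)
  have "set_integrable lborel {0<..<1} (\<lambda>u. K * w u)" using w by simp
  then show ?thesis
  proof (rule set_integrable_bound)
    show "set_borel_measurable lborel {0<..<1} (\<lambda>u. g u * (- ln u) powr a)"
    proof -
      have "(\<lambda>u. indicat_real {0<..<1} u *\<^sub>R (g u * (- ln u) powr a)) \<in> borel_measurable borel"
        by (intro borel_measurable_continuous_on_indicator continuous_intros cont) auto
      then show ?thesis by (simp add: set_borel_measurable_def)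
    qed
    show "AE u in lborel. u \<in> {0<..<1} \<longrightarrow> norm (g u * (- ln u) powr a) \<le> norm (K * w u)"
    proof (intro AE_I2 impI)
      fix u :: real assume "u \<in> {0<..<1}"
      then have u: "0 < u" "u < 1" by auto
      have w0: "w u \<ge> 0" by (simp add: w_def)
      have "g u * (- ln u) powr a \<le> K * w u"
      proof (cases "u \<le> 1/2")
        case True
        have "(1/2)^2 \<le> (1 - u)^2" using True by (intro power_mono) auto
        then have "D / (1 - u)\<^sup>2 \<le> D / (1/2)^2"
          using D u by (intro divide_left_mono) auto
        then have "g u \<le> 4 * D" using g[OF u] by (simp add: power2_eq_square)
        then have "g u * (- ln u) powr a \<le> (4 * D) * ((2 * a) powr a * u powr (-1/2))"
          using neg_ln_powr_le_near_0[of a u] u a D by (intro mult_mono) auto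
        also have "\<dots> = (4 * D * (2 * a) powr a) * u powr (-1/2)" by simp
        also have "\<dots> \<le> K * w u" using D unfolding K_def w_def by (intro mult_mono) auto
        finally show ?thesis .
      next
        case False
        have "(- ln u) powr a \<le> (2 * (1 - u)) powr a"
          using neg_ln_le_near_1[of u] u a False by (intro powr_mono2) auto
        also have "\<dots> = 2 powr a * (1 - u) powr a" by (rule powr_mult)
        finally have "g u * (- ln u) powr a \<le> (D / (1 - u)\<^sup>2) * (2 powr a * (1 - u) powr a)"
          using g[OF u] D by (intro mult_mono) auto
        also have "\<dots> = (D * 2 powr a) * (1 - u) powr (a - 2)"
          using u by (simp add: powr_diff powr_realpow[of _ 2, simplified] field_simps)
        also have "\<dots> \<le> K * w u" using D unfolding K_def w_def by (intro mult_mono) auto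
        finally show ?thesis .
      qed
      moreover have "g u * (- ln u) powr a \<ge> 0" using g[OF u] by simp
      ultimately show "norm (g u * (- ln u) powr a) \<le> norm (K * w u)" by simp
    qed
  qed
qed

section \<open>Growth of q and q' towards 1\<close>

context pgf begin

text \<open>Derivatives are bounded by values further right: f''(u) by f'(w), and f'(w) by f(v),
  with v = (1 + u)/2 and w midway between u and v. The hypothesis brings f(v) back to f(u), so
  quotients by f(u) are controlled.\<close>

lemma q_bounds_of_ratio:
  assumes R: "fps_conv_radius f \<ge> 1"
    and C: "\<And>u. 0 \<le> u \<Longrightarrow> u < 1 \<Longrightarrow> E ((1 + u) / 2) \<le> C * E u"
  obtains D where "\<And>u. 0 \<le> u \<Longrightarrow> u < 1 \<Longrightarrow> q' u \<le> D / (1 - u)\<^sup>2"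
    "\<And>u. 0 \<le> u \<Longrightarrow> u < 1 \<Longrightarrow> q u \<le> D / (1 - u)"
proof -
  have r: "ereal u < fps_conv_radius f" if "u < 1" for u
    using that R by (auto intro: less_le_trans[of _ 1])
  have C0: "C \<ge> 0"
  proof -
    have "E (1/2) \<ge> 1" "E 0 = 1" using r[of "1/2"] E_ge_1[of "1/2"] f0 by (auto simp: eval_fps_at_0)
    then show ?thesis using C[of 0] by simp
  qed
  \<comment> \<open>18 = 2 + 16: the step from u to v has length (1 - u)/2 and gives 2 C for f'/f;
    two steps of length (1 - u)/4 give 16 C for f''/f. The negative term - u (f'/f)^2 of q' is
    dropped.\<close>
  have *: "q' u \<le> 18 * C / (1 - u)\<^sup>2 \<and> q u \<le> 18 * C / (1 - u)" if u: "0 \<le> u" "u < 1" for u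
  proof -
    define v where "v = (1 + u) / 2"
    define w where "w = (u + v) / 2"
    have vw: "u < w" "w < v" "v < 1" "0 \<le> w" "0 \<le> v" and d: "v - u = (1 - u) / 2" "w - u = (1 - u)/4" "v - w = (1 - u) / 4"
      using u by (auto simp: v_def w_def field_simps)
    have E: "E u \<ge> 1" using E_ge_1 u r by simp
    have Ev: "E v \<le> C * E u" using C[OF u] by (simp add: v_def)
    have "E1 u * ((1 - u) / 2) \<le> E v"
      using eval_fps_deriv_mult_le[OF nonneg, of u v] u vw d r by simp
    then have "E1 u * ((1 - u) / 2) \<le> C * E u" using Ev by linarith
    then have 1: "E1 u / E u \<le> 2 * C / (1 - u)" using E u by (simp add: field_simps)
    have "E2 u * ((1 - u) / 4) \<le> E1 w"
      using eval_fps_deriv_mult_le[of "fps_deriv f" u w] nonneg u vw d fps_conv_radius_deriv_less[OF r, of w] by simp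
    then have "E2 u * ((1 - u) / 4) * ((1 - u) / 4) \<le> E1 w * ((1 - u) / 4)"
      using u by (intro mult_right_mono) auto
    also have "\<dots> \<le> E v"
      using eval_fps_deriv_mult_le[OF nonneg, of w v] u vw d r by simp
    finally have "E2 u * ((1 - u) / 4) * ((1 - u) / 4) \<le> C * E u" using Ev by linarith
    then have "E2 u \<le> C * E u * 16 / (1 - u)\<^sup>2" using u by (subst pos_le_divide_eq) (simp_all add: power2_eq_square mult_ac)
    then have 2: "E2 u / E u \<le> 16 * C / (1 - u)\<^sup>2" using E by (simp add: field_simps)
    have E2: "E2 u / E u \<ge> 0" using E2_ge_0 u r E by simp
    have s: "2 * C / (1 - u) \<le> 2 * C / (1 - u)\<^sup>2"
      using u C0 by (intro divide_left_mono) (auto simp: power2_eq_square mult_le_one)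
    have "q' u = E1 u / E u + u * (E2 u / E u - (E1 u / E u)\<^sup>2)" using q'_eq u r by simp
    also have "\<dots> \<le> E1 u / E u + u * (E2 u / E u)"
      using u by (intro add_left_mono mult_left_mono) auto
    also have "\<dots> \<le> E1 u / E u + E2 u / E u"
      using u E2 by (intro add_left_mono mult_left_le_one_le) auto
    also have "\<dots> \<le> 2 * C / (1 - u)\<^sup>2 + 16 * C / (1 - u)\<^sup>2" using 1 2 s by linarith
    finally have A: "q' u \<le> 18 * C / (1 - u)\<^sup>2" by (simp flip: add_divide_distrib)
    have "E1 u / E u \<ge> 0" using E1_ge[of u] f1 u r E by simp
    then have "q u \<le> E1 u / E u"
      using u r mult_left_le_one_le[of "E1 u / E u" u] by (simp add: q_eq)
    also have "\<dots> \<le> 18 * C / (1 - u)"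
      by (rule order_trans[OF 1 divide_right_mono]) (use C0 u in auto)
    finally show ?thesis using A by blast
  qed
  show thesis by (rule that) (use * in blast)+
qed

lemma ratio_bounded_of_radius_gt_1:
  assumes "fps_conv_radius f > 1" "0 \<le> u" "u < 1"
  shows "E ((1 + u) / 2) \<le> E 1 * E u"
proof -
  have r: "ereal v < fps_conv_radius f" if "v \<le> 1" for v
    using that assms by (auto intro: le_less_trans[of _ 1])
  have "E ((1 + u) / 2) \<le> E 1" using assms r[of 1] by (intro E_mono) (auto simp: one_ereal_def)
  also have "\<dots> \<le> E 1 * E u"
    using E_ge_1[of u] E_ge_1[of 1] r[of 1] r[of u] assms by (simp add: mult_le_cancel_left1)
  finally show ?thesis .
qed

text \<open>A pole is given through a complex continuation. On the real segment below \<rho> that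
  continuation is f itself, so the leading Laurent coefficient, up to sign, is a limit of positive
  reals and therefore a positive real.\<close>

lemma pole_asymptotics:
  assumes \<rho>: "fps_conv_radius f = ereal \<rho>" and pole: "has_pole_at f (complex_of_real \<rho>)"
  obtains m c where "m \<ge> 1" "c > 0" "((\<lambda>x. (\<rho> - x) ^ m * E x) \<longlongrightarrow> c) (at_left \<rho>)"
proof -
  have \<rho>0: "\<rho> > 0" using radius_pos \<rho> by simp
  obtain r G where r: "r > 0" and G: "continues_to f G (ball (of_real \<rho>) r - {of_real \<rho>})"
    and ip: "is_pole G (of_real \<rho>)"
    using pole unfolding has_pole_at_def by blast
  define n where "n = nat (- zorder G (of_real \<rho>))"
  define H where "H = zor_poly G (of_real \<rho>)"
  have "G holomorphic_on ball (of_real \<rho>) r - {of_real \<rho>}" using G by (simp add: continues_to_def)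
  note Z = zorder_exist_pole[OF this open_ball _ ip, folded H_def n_def]
  have "of_real \<rho> \<in> ball (complex_of_real \<rho>) r" using r by simp
  note Z = Z[OF this]
  from Z have z: "zorder G (of_real \<rho>) < 0" "H (of_real \<rho>) \<noteq> 0" by blast+
  from Z[THEN conjunct2, THEN conjunct2]
obtain s where s: "s > 0"
    "cball (complex_of_real \<rho>) s \<subseteq> ball (of_real \<rho>) r" "H holomorphic_on cball (of_real \<rho>) s"
    and GH: "\<And>w. w \<in> cball (of_real \<rho>) s - {of_real \<rho>} \<Longrightarrow> G w = H w / (w - of_real \<rho>) ^ n"
    by blast
  have n: "n \<ge> 1" using z by (simp add: n_def)
  have ev: "eventually (\<lambda>x. x \<in> {max 0 (\<rho> - s)<..<\<rho>}) (at_left \<rho>)"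
    by (rule eventually_at_left_real) (use s \<rho>0 in auto)
  have eq: "complex_of_real ((x - \<rho>) ^ n * E x) = H (of_real x)" if x: "x \<in> {max 0 (\<rho> - s)<..<\<rho>}" for x
  proof -
    have inb: "complex_of_real x \<in> cball (of_real \<rho>) s - {of_real \<rho>}"
      using x by (auto simp: dist_of_real dist_real_def)
    have "G (of_real x) = complex_fun f (of_real x)"
    proof -
      have "complex_of_real x \<in> ball (of_real \<rho>) r - {of_real \<rho>}" using inb s(2) by blast
      moreover have "ereal (norm (complex_of_real x)) < fps_conv_radius f" using x \<rho> by simp
      ultimately show ?thesis using G unfolding continues_to_def by blast
    qed
    also have "\<dots> = of_real (E x)"
    proof -
      have "summable (\<lambda>j. fps_nth f j * x ^ j)" using x \<rho> by (intro summable_fps) auto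
      then show ?thesis
        unfolding complex_fun_def eval_fps_def by (subst suminf_of_real) auto
    qed
    finally have "of_real (E x) = H (of_real x) / (of_real x - of_real \<rho>) ^ n"
      using GH[OF inb] by simp
    moreover have "complex_of_real x - of_real \<rho> \<noteq> 0" using x by auto
    ultimately show ?thesis by (simp add: nonzero_eq_divide_eq mult.commute)
  qed
  have "isCont H (of_real \<rho>)"
    using s holomorphic_on_imp_continuous_on[OF s(3)]
    by (intro continuous_on_interior[of "cball (of_real \<rho>) s"]) auto
  then have "(H \<longlongrightarrow> H (of_real \<rho>)) (at (of_real \<rho>))" by (simp add: isCont_def)
  moreover have "filterlim complex_of_real (at (of_real \<rho>)) (at_left \<rho>)"
    by (rule filterlim_atI) (auto intro!: tendsto_intros simp: eventually_at_filter)
  ultimately have "((\<lambda>x. H (of_real x)) \<longlongrightarrow> H (of_real \<rho>)) (at_left \<rho>)"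
    by (rule filterlim_compose)
  then have lim: "((\<lambda>x. complex_of_real ((x - \<rho>) ^ n * E x)) \<longlongrightarrow> H (of_real \<rho>)) (at_left \<rho>)"
    by (rule Lim_transform_eventually) (use ev eq in \<open>auto elim!: eventually_mono\<close>)
  \<comment> \<open>The sign turns (x - \<rho>)^n from the Laurent expansion into (\<rho> -
    x)^n.\<close>
  define c where "c = (-1) ^ n * Re (H (of_real \<rho>))"
  have "((\<lambda>x. (x - \<rho>) ^ n * E x) \<longlongrightarrow> Re (H (of_real \<rho>))) (at_left \<rho>)"
    using tendsto_Re[OF lim] by simp
  then have "((\<lambda>x. (-1) ^ n * ((x - \<rho>) ^ n * E x)) \<longlongrightarrow> c) (at_left \<rho>)"
    unfolding c_def by (intro tendsto_intros)
  moreover have "(-1) ^ n * ((x - \<rho>) ^ n * E x) = (\<rho> - x) ^ n * E x" for x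
  proof -
    have "(\<rho> - x) ^ n = ((-1) * (x - \<rho>)) ^ n" by simp
    then show ?thesis by (simp only: power_mult_distrib mult.assoc)
  qed
  ultimately have lim_c: "((\<lambda>x. (\<rho> - x) ^ n * E x) \<longlongrightarrow> c) (at_left \<rho>)" by simp
  \<comment> \<open>The value of H at the pole is known to be nonzero only as a complex number; as a
    limit of reals it has no imaginary part, so its real part is nonzero.\<close>
  have "Im (H (of_real \<rho>)) = 0"
  proof (rule tendsto_unique)
    show "((\<lambda>x. Im (complex_of_real ((x - \<rho>) ^ n * E x))) \<longlongrightarrow> Im (H (of_real \<rho>))) (at_left \<rho>)"
      by (rule tendsto_Im[OF lim])
  qed auto
  then have "Re (H (of_real \<rho>)) \<noteq> 0" using z(2) by (auto simp: complex_eq_iff)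
  then have "c \<noteq> 0" by (simp add: c_def)
  moreover have "c \<ge> 0"
  proof (rule tendsto_lowerbound[OF lim_c])
    show "eventually (\<lambda>x. 0 \<le> (\<rho> - x) ^ n * E x) (at_left \<rho>)"
      using ev
    proof eventually_elim
      case (elim x)
      then show ?case using E_ge_1[of x] \<rho> by simp
    qed
  qed simp
  ultimately have "c > 0" by simp
  from that[OF n this lim_c] show thesis .
qed

lemma ratio_bounded_of_pole:
  assumes \<rho>: "fps_conv_radius f = 1" and pole: "has_pole_at f 1"
  obtains C where "\<And>u. 0 \<le> u \<Longrightarrow> u < 1 \<Longrightarrow> E ((1 + u) / 2) \<le> C * E u"
proof -
  obtain m c where m: "m \<ge> 1" "c > 0" and lim: "((\<lambda>x. (1 - x) ^ m * E x) \<longlongrightarrow> c) (at_left 1)"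
    by (rule pole_asymptotics[of 1]) (use assms in \<open>auto simp: one_ereal_def\<close>)
  have "filterlim (\<lambda>u::real. (1 + u) / 2) (at_left 1) (at_left 1)" by real_asymp
  from filterlim_compose[OF lim this]
  have "((\<lambda>u. ((1 - (1 + u) / 2) ^ m * E ((1 + u) / 2)) / ((1 - u) ^ m * E u)) \<longlongrightarrow> c / c) (at_left 1)"
    using m lim by (intro tendsto_divide) auto
  then have "eventually (\<lambda>u. ((1 - (1 + u) / 2) ^ m * E ((1 + u) / 2)) / ((1 - u) ^ m * E u) < 2) (at_left 1)"
    by (rule order_tendstoD) (use m in auto)
  then obtain b where b: "b < 1" 
    "\<And>u. b < u \<Longrightarrow> u < 1 \<Longrightarrow> ((1 - (1 + u) / 2) ^ m * E ((1 + u) / 2)) / ((1 - u) ^ m * E u) < 2"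
    unfolding eventually_at_left_field by blast
  define b' where "b' = max b 0"
  have r: "ereal u < fps_conv_radius f" if "u < 1" for u using that \<rho> by (simp add: one_ereal_def)
  \<comment> \<open>Halving the distance to a pole of order m multiplies f by about 2^m, with one
    factor 2 as slack in the limit. For u <= b' monotonicity and f >= 1 suffice, which gives the
    second entry.\<close>
  define C where "C = max (2 * 2 ^ m) (E ((1 + b') / 2))"
  have "E ((1 + u) / 2) \<le> C * E u" if u: "0 \<le> u" "u < 1" for u
  proof (cases "u \<le> b'")
    case True
    have "E ((1 + u) / 2) \<le> E ((1 + b') / 2)" using True u b by (intro E_mono r) (auto simp: b'_def)
    also have "\<dots> \<le> C" by (simp add: C_def)
    also have "\<dots> \<le> C * E u" using E_ge_1[of u] u r by (simp add: C_def mult_le_cancel_left1 le_max_iff_disj)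
    finally show ?thesis .
  next
    case False
    have pos: "(1 - u) ^ m * E u > 0" using E_ge_1[of u] u r by simp
    have "(1 - (1 + u) / 2) ^ m * E ((1 + u) / 2) < 2 * ((1 - u) ^ m * E u)"
      using b(2)[of u] False u pos by (simp add: b'_def divide_less_eq)
    moreover have "1 - (1 + u) / 2 = (1 - u) / 2" by (simp add: field_simps)
    ultimately have "(1 - u) ^ m * E ((1 + u) / 2) < (1 - u) ^ m * (2 * 2 ^ m * E u)"
      by (simp add: power_divide field_simps)
    then have "E ((1 + u) / 2) \<le> 2 * 2 ^ m * E u" using u by simp
    also have "\<dots> \<le> C * E u" using E_ge_1[of u] u r by (intro mult_right_mono) (auto simp: C_def)
    finally show ?thesis .
  qed
  then show thesis by (rule that)
qed

end

section \<open>Regular variation\<close>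

text \<open>The argument is real because the partial sums are evaluated at |log u| T; the sum starts
  at 1 as parts do.\<close>

definition psum :: "(nat \<Rightarrow> real) \<Rightarrow> real \<Rightarrow> real" where
  "psum c y = (\<Sum>k | 1 \<le> k \<and> real k \<le> y. c k)"

lemma finite_psum_set [simp]: "finite {k. Suc 0 \<le> k \<and> real k \<le> y}" "finite {k. 1 \<le> k \<and> real k \<le> y}"
proof -
  have "{k. Suc 0 \<le> k \<and> real k \<le> y} \<subseteq> {..nat \<lfloor>y\<rfloor>}" by (auto simp: le_nat_floor)
  then show "finite {k. Suc 0 \<le> k \<and> real k \<le> y}" by (rule finite_subset) simp
  then show "finite {k. 1 \<le> k \<and> real k \<le> y}" by simp
qed

lemma psum_of_nat: "psum c (real n) = (\<Sum>k=1..n. c k)"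
  unfolding psum_def by (rule sum.cong) auto

lemma psum_less_1: "y < 1 \<Longrightarrow> psum c y = 0"
proof -
  assume "y < 1"
  then have "{k::nat. 1 \<le> k \<and> real k \<le> y} = {}" by auto
  then show ?thesis by (simp only: psum_def sum.empty)
qed

lemma psum_mono: "(\<And>k. k \<ge> 1 \<Longrightarrow> c k \<ge> 0) \<Longrightarrow> mono (psum c)"
  unfolding psum_def by (intro monoI sum_mono2) auto

text \<open>Regular variation of index \<gamma> for a monotone function. Monotonicity takes the
  place of the uniform convergence theorem, and vanishing below 1 lets Potter's bound hold for all r
  > 0, however small r T is.\<close>

locale regularly_varying =
  fixes U :: "real \<Rightarrow> real" and \<gamma> :: real
  assumes mono: "mono U" and zero: "\<And>T. T < 1 \<Longrightarrow> U T = 0" and one: "U 1 > 0" and \<gamma>: "\<gamma> > 0"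
    and ratio: "\<And>y. y > 0 \<Longrightarrow> ((\<lambda>T. U (y * T) / U T) \<longlongrightarrow> y powr \<gamma>) at_top"
begin

lemma U_mono: "x \<le> y \<Longrightarrow> U x \<le> U y" using mono by (rule monoD)

lemma U_pos: "T \<ge> 1 \<Longrightarrow> U T > 0" using U_mono[of 1 T] one by linarith

lemma U_nonneg: "U T \<ge> 0" using U_pos[of T] zero[of T] by (cases "T < 1") auto

text \<open>Only the limit 2^\<gamma> of U(2T) / U(T) is used. It lies strictly between 2^\<kappa>
  and 2^K, so from some point on each doubling of the argument gains a factor between these two, and
  this is iterated.\<close>

lemma doubling:
  assumes "\<kappa> < \<gamma>" "\<gamma> < K"
  obtains S where "S \<ge> 1"
    "\<And>T n. T \<ge> S \<Longrightarrow> (2 powr \<kappa>) ^ n * U T \<le> U (2 ^ n * T)"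
    "\<And>T n. T \<ge> S \<Longrightarrow> U (2 ^ n * T) \<le> (2 powr K) ^ n * U T"
proof -
  have "eventually (\<lambda>T. U (2 * T) / U T > 2 powr \<kappa>) at_top"
    by (rule order_tendstoD[OF ratio]) (use assms in auto)
  moreover have "eventually (\<lambda>T. U (2 * T) / U T < 2 powr K) at_top"
    by (rule order_tendstoD[OF ratio]) (use assms in auto)
  moreover have "eventually (\<lambda>T::real. T \<ge> 1) at_top" by (rule eventually_ge_at_top)
  ultimately have "eventually (\<lambda>T. T \<ge> 1 \<and> 2 powr \<kappa> * U T \<le> U (2 * T) \<and> U (2 * T) \<le> 2 powr K * U T) at_top"
  proof eventually_elim
    case (elim T)
    then show ?case using U_pos[of T] by (simp add: pos_less_divide_eq pos_divide_less_eq)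
  qed
  then obtain S where S: "\<And>T. T \<ge> S \<Longrightarrow> T \<ge> 1 \<and> 2 powr \<kappa> * U T \<le> U (2 * T) \<and> U (2 * T) \<le> 2 powr K * U T"
    by (auto simp: eventually_at_top_linorder)
  have big: "S \<le> 2 ^ n * T" if "T \<ge> S" for T n
  proof -
    have "1 * T \<le> 2 ^ n * T" using S[OF that] by (intro mult_right_mono) auto
    with that show ?thesis by simp
  qed
  show thesis
  proof
    show "S \<ge> 1" using S[of S] by simp
    show "(2 powr \<kappa>) ^ n * U T \<le> U (2 ^ n * T)" if "T \<ge> S" for T n
    proof (induction n)
      case (Suc n)
      have "(2 powr \<kappa>) ^ Suc n * U T = 2 powr \<kappa> * ((2 powr \<kappa>) ^ n * U T)" by simp
      also have "\<dots> \<le> 2 powr \<kappa> * U (2 ^ n * T)" by (intro mult_left_mono Suc) auto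
      also have "\<dots> \<le> U (2 * (2 ^ n * T))" using S[OF big[OF that, of n]] by simp
      finally show ?case by (simp add: mult.assoc)
    qed simp
    show "U (2 ^ n * T) \<le> (2 powr K) ^ n * U T" if "T \<ge> S" for T n
    proof (induction n)
      case (Suc n)
      have "U (2 * (2 ^ n * T)) \<le> 2 powr K * U (2 ^ n * T)" using S[OF big[OF that, of n]] by simp
      also have "\<dots> \<le> 2 powr K * ((2 powr K) ^ n * U T)" by (intro mult_left_mono Suc) auto
      finally show ?case by (simp add: mult.assoc)
    qed simp
  qed
qed

lemma exists_dyadic:
  assumes "r \<ge> (1::real)"
  obtains n where "2 ^ n \<le> r" "r < 2 * 2 ^ n"
proof -
  define n where "n = nat \<lfloor>log 2 r\<rfloor>"
  have l: "log 2 r \<ge> 0" using assms by simp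
  then have n: "real n \<le> log 2 r" "log 2 r < real n + 1" unfolding n_def by linarith+
  have "2 powr real n \<le> r" using n(1) assms by (simp add: le_log_iff)
  moreover have "r < 2 powr (real n + 1)" using n(2) assms by (simp add: log_less_iff)
  ultimately show thesis using that[of n] by (simp add: powr_realpow powr_add)
qed

lemma upper_bound:
  assumes "\<gamma> < K"
  obtains C where "C \<ge> 0" "\<And>T r. T \<ge> 1 \<Longrightarrow> r \<ge> 1 \<Longrightarrow> U (r * T) \<le> C * r powr K * U T"
proof -
  obtain S where S: "S \<ge> 1" "\<And>T n. T \<ge> S \<Longrightarrow> U (2 ^ n * T) \<le> (2 powr K) ^ n * U T"
    using doubling[of 0 K] \<gamma> assms by metis
  have K: "K > 0" using \<gamma> assms by simp
  have *: "U (r * T) \<le> 2 powr K * r powr K * U T" if T: "T \<ge> S" and r: "r \<ge> 1" for T r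
  proof -
    obtain n where n: "2 ^ n \<le> r" "r < 2 * 2 ^ n" by (rule exists_dyadic[OF r])
    have "U (r * T) \<le> U (2 ^ Suc n * T)"
      using n T S r by (intro U_mono mult_right_mono) auto
    also have "\<dots> \<le> (2 powr K) ^ Suc n * U T" by (rule S(2)[OF T])
    also have "(2 powr K) ^ Suc n = 2 powr K * (2 ^ n) powr K"
      by (simp add: powr_realpow[symmetric] powr_powr powr_power mult.commute)
    also have "2 powr K * (2 ^ n) powr K * U T \<le> 2 powr K * r powr K * U T"
      using n K U_nonneg by (intro mult_right_mono mult_left_mono powr_mono2) auto
    finally show ?thesis .
  qed
  \<comment> \<open>2^K pays for rounding r up to a power of 2, and U(S) / U(1) for arguments T in
    [1, S), where U(T) >= U(1) and T is replaced by S.\<close>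
  define C where "C = 2 powr K * (U S / U 1)"
  have US: "U S / U 1 \<ge> 1" using U_mono[OF S(1)] one by simp
  show thesis
  proof (rule that[of C])
    show "C \<ge> 0" using US unfolding C_def by (intro mult_nonneg_nonneg) auto
    fix T r :: real assume T: "T \<ge> 1" and r: "r \<ge> 1"
    show "U (r * T) \<le> C * r powr K * U T"
    proof (cases "T \<ge> S")
      case True
      have "U (r * T) \<le> 2 powr K * r powr K * U T" by (rule *[OF True r])
      also have "\<dots> = (2 powr K * 1) * r powr K * U T" by simp
      also have "\<dots> \<le> C * r powr K * U T"
        unfolding C_def using US U_nonneg by (intro mult_right_mono mult_left_mono) auto
      finally show ?thesis .
    next
      case False
      have "U (r * T) \<le> U (r * S)" using False r by (intro U_mono mult_left_mono) auto
      also have "\<dots> \<le> 2 powr K * r powr K * U S" by (rule *[OF order_refl r])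
      also have "\<dots> = C * r powr K * U 1" using one by (simp add: C_def)
      also have "\<dots> \<le> C * r powr K * U T"
        using U_mono[OF T] U_nonneg one by (intro mult_left_mono) (auto simp: C_def)
      finally show ?thesis .
    qed
  qed
qed

lemma lower_bound:
  assumes "0 \<le> \<kappa>" "\<kappa> < \<gamma>"
  obtains C where "C \<ge> 0" "\<And>T a. T \<ge> 1 \<Longrightarrow> a \<ge> 1 \<Longrightarrow> a powr \<kappa> * U T \<le> C * U (a * T)"
proof -
  obtain S where S: "S \<ge> 1" "\<And>T n. T \<ge> S \<Longrightarrow> (2 powr \<kappa>) ^ n * U T \<le> U (2 ^ n * T)"
    using doubling[of \<kappa> "\<gamma> + 1"] assms by (metis less_add_one)
  obtain C1 where C1: "C1 \<ge> 0" "\<And>T r. T \<ge> 1 \<Longrightarrow> r \<ge> 1 \<Longrightarrow> U (r * T) \<le> C1 * r powr (\<gamma> + 1) * U T"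
    by (rule upper_bound[of "\<gamma> + 1"]) auto
  have *: "a powr \<kappa> * U T \<le> 2 powr \<kappa> * U (a * T)" if T: "T \<ge> S" and a: "a \<ge> 1" for T a
  proof -
    obtain n where n: "2 ^ n \<le> a" "a < 2 * 2 ^ n" by (rule exists_dyadic[OF a])
    have "a powr \<kappa> * U T \<le> (2 * 2 ^ n) powr \<kappa> * U T"
      using n a assms U_nonneg by (intro mult_right_mono powr_mono2) auto
    also have "(2 * 2 ^ n) powr \<kappa> = 2 powr \<kappa> * (2 powr \<kappa>) ^ n"
      by (simp add: powr_mult powr_realpow[symmetric] powr_powr powr_power mult.commute)
    also have "2 powr \<kappa> * (2 powr \<kappa>) ^ n * U T \<le> 2 powr \<kappa> * U (2 ^ n * T)"
      using S(2)[OF T, of n] by (simp add: mult.assoc)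
    also have "\<dots> \<le> 2 powr \<kappa> * U (a * T)"
      using n T S by (intro mult_left_mono U_mono mult_right_mono) auto
    finally show ?thesis .
  qed
  \<comment> \<open>For T below S the argument T is replaced by S. This inflates a T by at most the
    factor S, which \<open>upper_bound\<close> converts into the constant C1 S^(\<gamma> +
    1).\<close>
  define C where "C = 2 powr \<kappa> * (1 + C1 * S powr (\<gamma> + 1))"
  show thesis
  proof (rule that[of C])
    show "C \<ge> 0" using C1 by (simp add: C_def)
    fix T a :: real assume T: "T \<ge> 1" and a: "a \<ge> 1"
    have ge: "1 \<le> a * T" using a T by (metis mult_mono' mult_1 zero_le_one)
    show "a powr \<kappa> * U T \<le> C * U (a * T)"
    proof (cases "T \<ge> S")
      case True
      have "a powr \<kappa> * U T \<le> 2 powr \<kappa> * 1 * U (a * T)" using *[OF True a] by simp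
      also have "\<dots> \<le> C * U (a * T)"
        unfolding C_def using C1 U_nonneg by (intro mult_right_mono mult_left_mono) auto
      finally show ?thesis .
    next
      case False
      have "a powr \<kappa> * U T \<le> a powr \<kappa> * U S"
        using False by (intro mult_left_mono U_mono) auto
      also have "\<dots> \<le> 2 powr \<kappa> * U (a * S)" by (rule *[OF order_refl a])
      also have "U (a * S) \<le> U (S * (a * T))"
      proof (rule U_mono)
        have "a * S * 1 \<le> a * S * T" using a S T by (intro mult_left_mono) auto
        then show "a * S \<le> S * (a * T)" by (simp add: mult_ac)
      qed
      also have "\<dots> \<le> C1 * S powr (\<gamma> + 1) * U (a * T)" by (rule C1(2)[OF ge S(1)])
      also have "\<dots> \<le> (1 + C1 * S powr (\<gamma> + 1)) * U (a * T)"
        using U_nonneg by (intro mult_right_mono) auto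
      finally show ?thesis by (simp add: C_def mult.assoc)
    qed
  qed
qed

text \<open>The sum of two powers covers r < 1 and r >= 1 at once, so it can serve as an integrable
  majorant in r = |log u|.\<close>

lemma potter_bound:
  assumes "0 \<le> \<kappa>" "\<kappa> < \<gamma>" "\<gamma> < K"
  obtains C where "C \<ge> 0" "\<And>T r. T \<ge> 1 \<Longrightarrow> r > 0 \<Longrightarrow> U (r * T) \<le> C * (r powr \<kappa> + r powr K) * U T"
proof -
  obtain C1 where C1: "C1 \<ge> 0" "\<And>T r. T \<ge> 1 \<Longrightarrow> r \<ge> 1 \<Longrightarrow> U (r * T) \<le> C1 * r powr K * U T"
    using upper_bound[OF assms(3)] by metis
  obtain C2 where C2: "C2 \<ge> 0" "\<And>T a. T \<ge> 1 \<Longrightarrow> a \<ge> 1 \<Longrightarrow> a powr \<kappa> * U T \<le> C2 * U (a * T)"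
    using lower_bound[OF assms(1,2)] by metis
  show thesis
  proof (rule that[of "C1 + C2"])
    show "C1 + C2 \<ge> 0" using C1 C2 by simp
    fix T r :: real assume T: "T \<ge> 1" and r: "r > 0"
    consider "r * T < 1" | "r \<ge> 1" | "r < 1" "r * T \<ge> 1" by linarith
    then show "U (r * T) \<le> (C1 + C2) * (r powr \<kappa> + r powr K) * U T"
    proof cases
      case 1
      then show ?thesis using zero[of "r * T"] C1 C2 U_nonneg[of T] by simp
    next
      case 2
      have "U (r * T) \<le> C1 * r powr K * U T" by (rule C1(2)[OF T 2])
      also have "\<dots> \<le> (C1 + C2) * (r powr \<kappa> + r powr K) * U T"
        using C1 C2 U_nonneg by (intro mult_right_mono mult_mono) auto
      finally show ?thesis .
    next
      case 3
      \<comment> \<open>For r < 1 the lower bound is read backwards: it is applied at the base point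
        r T >= 1 with the factor 1/r.\<close>
      have "(1 / r) powr \<kappa> * U (r * T) \<le> C2 * U (1 / r * (r * T))"
        by (rule C2(2)) (use 3 r in auto)
      then have "(1 / r) powr \<kappa> * U (r * T) \<le> C2 * U T" using r by simp
      then have "U (r * T) \<le> C2 * r powr \<kappa> * U T"
        using r by (simp add: powr_divide field_simps)
      also have "\<dots> \<le> (C1 + C2) * (r powr \<kappa> + r powr K) * U T"
        using C1 C2 U_nonneg by (intro mult_right_mono mult_mono) auto
      finally show ?thesis .
    qed
  qed
qed

lemma U_at_top: "filterlim U at_top at_top"
proof -
  obtain S where S: "S \<ge> 1" "\<And>T n. T \<ge> S \<Longrightarrow> (2 powr (\<gamma>/2)) ^ n * U T \<le> U (2 ^ n * T)"
    using doubling[of "\<gamma>/2" "\<gamma> + 1"] \<gamma> by (metis half_gt_zero_iff less_add_one field_sum_of_halves less_add_same_cancel1)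
  have "2 powr (\<gamma>/2) > 1" using \<gamma> by simp
  show ?thesis unfolding filterlim_at_top
  proof
    fix Z :: real
    obtain n where n: "Z / U S < (2 powr (\<gamma>/2)) ^ n"
      using real_arch_pow[OF \<open>2 powr (\<gamma>/2) > 1\<close>] by blast
    have "eventually (\<lambda>T. T \<ge> 2 ^ n * S) at_top" by (rule eventually_ge_at_top)
    then show "eventually (\<lambda>T. Z \<le> U T) at_top"
    proof eventually_elim
      case (elim T)
      have "Z \<le> (2 powr (\<gamma>/2)) ^ n * U S" using n U_pos[OF S(1)] by (simp add: field_simps)
      also have "\<dots> \<le> U (2 ^ n * S)" by (rule S(2)) simp
      also have "\<dots> \<le> U T" by (rule U_mono[OF elim])
      finally show ?case .
    qed
  qed
qed

text \<open>The multiplier may vary with the limit: by monotonicity U(y T) lies between the values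
  at fixed multipliers slightly below and above y0, and y^\<gamma> is continuous. This is needed for
  arguments that are only asymptotically proportional to T.\<close>

lemma ratio_var:
  assumes y: "(y \<longlongrightarrow> y0) F" "y0 > 0" and T: "filterlim T at_top F"
  shows "((\<lambda>x. U (y x * T x) / U (T x)) \<longlongrightarrow> y0 powr \<gamma>) F"
proof (rule order_tendstoI)
  have T1: "eventually (\<lambda>x. T x \<ge> 1) F" using T by (simp add: filterlim_at_top)
  have cont: "isCont (\<lambda>y. y powr \<gamma>) y0" using y by (intro continuous_intros) auto
  {
    fix a assume a: "a < y0 powr \<gamma>"
    have "((\<lambda>y. y powr \<gamma>) \<longlongrightarrow> y0 powr \<gamma>) (at_left y0)"
      using cont by (auto simp: isCont_def intro: filterlim_at_split[THEN iffD1, THEN conjunct1])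
    then have "eventually (\<lambda>y. a < y powr \<gamma>) (at_left y0)" by (rule order_tendstoD) (rule a)
    moreover have "eventually (\<lambda>y. y \<in> {0<..<y0}) (at_left y0)" by (rule eventually_at_left_real) (rule y)
    ultimately have "eventually (\<lambda>y. a < y powr \<gamma> \<and> y \<in> {0<..<y0}) (at_left y0)" by (rule eventually_conj)
    then obtain y1 where y1: "a < y1 powr \<gamma>" "0 < y1" "y1 < y0"
      using eventually_happens'[OF trivial_limit_at_left_real] by fastforce
    have "eventually (\<lambda>x. a < U (y1 * T x) / U (T x)) F"
      by (rule order_tendstoD(1)[OF filterlim_compose[OF ratio[OF y1(2)] T]]) (rule y1)
    moreover have "eventually (\<lambda>x. y1 < y x) F" by (rule order_tendstoD[OF y(1)]) (rule y1)
    ultimately show "eventually (\<lambda>x. a < U (y x * T x) / U (T x)) F"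
      using T1
    proof eventually_elim
      case (elim x)
      have "U (y1 * T x) / U (T x) \<le> U (y x * T x) / U (T x)"
        using elim U_nonneg by (intro divide_right_mono U_mono mult_right_mono) auto
      with elim show ?case by linarith
    qed
  next
    fix a assume a: "y0 powr \<gamma> < a"
    have "((\<lambda>y. y powr \<gamma>) \<longlongrightarrow> y0 powr \<gamma>) (at_right y0)"
      using cont by (auto simp: isCont_def intro: filterlim_at_split[THEN iffD1, THEN conjunct2])
    then have "eventually (\<lambda>y. y powr \<gamma> < a) (at_right y0)" by (rule order_tendstoD) (rule a)
    moreover have "eventually (\<lambda>y. y \<in> {y0<..<y0+1}) (at_right y0)" by (rule eventually_at_right_real) simp
    ultimately have "eventually (\<lambda>y. y powr \<gamma> < a \<and> y \<in> {y0<..<y0+1}) (at_right y0)" by (rule eventually_conj)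
    then obtain y1 where y1: "y1 powr \<gamma> < a" "y0 < y1"
      using eventually_happens'[OF trivial_limit_at_right_real] by fastforce
    have "eventually (\<lambda>x. U (y1 * T x) / U (T x) < a) F"
      by (rule order_tendstoD(2)[OF filterlim_compose[OF ratio[of y1] T]]) (use y1 y in auto)
    moreover have "eventually (\<lambda>x. y x < y1) F" by (rule order_tendstoD[OF y(1)]) (rule y1)
    ultimately show "eventually (\<lambda>x. U (y x * T x) / U (T x) < a) F"
      using T1
    proof eventually_elim
      case (elim x)
      have "U (y x * T x) / U (T x) \<le> U (y1 * T x) / U (T x)"
        using elim U_nonneg by (intro divide_right_mono U_mono mult_right_mono) auto
      with elim show ?case by linarith
    qed
  }
qed

end

text \<open>The hypothesis on \<open>b\<close> controls \<open>psum b\<close> only at integer multiples; monotonicity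
  extends the asymptotics to real arguments.\<close>

lemma regularly_varying_psum:
  assumes b: "\<And>k. k \<ge> 1 \<Longrightarrow> b k \<ge> 0" and b1: "b 1 > 0" and \<beta>: "\<beta> > 0" and L: "slowly_varying L"
    and B: "\<And>k. k \<ge> 1 \<Longrightarrow> (\<Sum>j=1..k. b j) = real k powr \<beta> * L (real k)"
  shows "regularly_varying (psum b) \<beta>"
proof
  let ?U = "psum b"
  show mono: "mono ?U" using b by (rule psum_mono)
  show "?U T = 0" if "T < 1" for T by (rule psum_less_1[OF that])
  show U1: "?U 1 > 0" using b1 psum_of_nat[of b 1] by simp
  show "\<beta> > 0" by (rule \<beta>)
  have pos: "?U T > 0" if "T \<ge> 1" for T using monoD[OF mono that] U1 by linarith
  have nn: "?U T \<ge> 0" for T using pos[of T] psum_less_1[of T b] by (cases "T < 1") auto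
  \<comment> \<open>At integers both partial sums are given by the hypothesis on b, so the slow
    variation of L with the fixed factor p applies directly; quotients of two such limits handle
    rational multipliers.\<close>
  have mult: "(\<lambda>m. ?U (real p * real m) / ?U (real m)) \<longlonglongrightarrow> real p powr \<beta>" if p: "p \<ge> 1" for p
  proof -
    have "((\<lambda>x. L (x * real p) / L x) \<longlongrightarrow> 1) at_top"
      using L p by (simp add: slowly_varying_def)
    then have "(\<lambda>m. L (real m * real p) / L (real m)) \<longlonglongrightarrow> 1"
      by (rule filterlim_compose) (rule filterlim_real_sequentially)
    then have "(\<lambda>m. real p powr \<beta> * (L (real m * real p) / L (real m))) \<longlonglongrightarrow> real p powr \<beta> * 1"
      by (intro tendsto_intros)
    moreover have "eventually (\<lambda>m. real p powr \<beta> * (L (real m * real p) / L (real m))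
        = ?U (real p * real m) / ?U (real m)) sequentially"
      using eventually_ge_at_top[of 1]
    proof eventually_elim
      case (elim m)
      have "?U (real p * real m) = real (p * m) powr \<beta> * L (real (p * m))"
        using psum_of_nat[of b "p * m"] B[of "p * m"] p elim by simp
      moreover have "?U (real m) = real m powr \<beta> * L (real m)"
        using psum_of_nat[of b m] B[of m] elim by simp
      ultimately show ?case using elim p by (simp add: powr_mult mult_ac)
    qed
    ultimately show ?thesis by (simp add: tendsto_cong)
  qed
  have mult2: "(\<lambda>m. ?U (real p * real m) / ?U (real r * real m)) \<longlonglongrightarrow> (real p / real r) powr \<beta>"
    if p: "p \<ge> 1" "r \<ge> 1" for p r
  proof -
    have "(\<lambda>m. (?U (real p * real m) / ?U (real m)) / (?U (real r * real m) / ?U (real m))) 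
        \<longlonglongrightarrow> real p powr \<beta> / real r powr \<beta>"
      by (intro tendsto_divide mult) (use p in auto)
    moreover have "eventually (\<lambda>m. (?U (real p * real m) / ?U (real m)) / (?U (real r * real m) / ?U (real m))
      = ?U (real p * real m) / ?U (real r * real m)) sequentially"
      using eventually_ge_at_top[of 1]
      by eventually_elim (use pos in \<open>auto simp: less_imp_neq[symmetric]\<close>)
    ultimately have "(\<lambda>m. ?U (real p * real m) / ?U (real r * real m)) \<longlonglongrightarrow> real p powr \<beta> / real r powr \<beta>"
      by (rule Lim_transform_eventually)
    then show ?thesis by (simp add: powr_divide)
  qed
  fix y :: real assume y: "y > 0"
  have m_lim: "filterlim (\<lambda>T::real. nat \<lfloor>T / real q\<rfloor>) sequentially at_top" if "q \<ge> 1" for q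
    using that by real_asymp
  show "((\<lambda>T. ?U (y * T) / ?U T) \<longlongrightarrow> y powr \<beta>) at_top"
  proof (rule order_tendstoI)
    fix a assume a: "y powr \<beta> < a"
    \<comment> \<open>With N = ceiling (q y) and m = floor (T/q) one has y T <= N (m + 1) <= (N + 1)
      m as soon as m >= N. The added 1 absorbs the rounding of T, and (N + 1)/q still tends to
      y.\<close>
    have "(\<lambda>q. (real (nat \<lceil>real q * y\<rceil> + 1) / real q) powr \<beta>) \<longlonglongrightarrow> y powr \<beta>"
      using y \<beta> by real_asymp
    then have "eventually (\<lambda>q. (real (nat \<lceil>real q * y\<rceil> + 1) / real q) powr \<beta> < a) sequentially"
      by (rule order_tendstoD) (rule a)
    then have "eventually (\<lambda>q. (real (nat \<lceil>real q * y\<rceil> + 1) / real q) powr \<beta> < a \<and> q \<ge> 1) sequentially"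
      using eventually_ge_at_top[of 1] by (rule eventually_conj)
    then obtain q where q: "(real (nat \<lceil>real q * y\<rceil> + 1) / real q) powr \<beta> < a" "q \<ge> 1"
      by (auto simp: eventually_sequentially)
    define N where "N = nat \<lceil>real q * y\<rceil>"
    have N: "real q * y \<le> real N" unfolding N_def by linarith
    have "eventually (\<lambda>m. ?U (real (N + 1) * real m) / ?U (real q * real m) < a) sequentially"
      by (rule order_tendstoD(2)[OF mult2]) (use q in \<open>auto simp: N_def\<close>)
    then have "eventually (\<lambda>m. ?U (real (N + 1) * real m) / ?U (real q * real m) < a \<and> m \<ge> max 1 N) sequentially"
      using eventually_ge_at_top by (rule eventually_conj)
    from eventually_compose_filterlim[OF this m_lim[OF q(2)]] eventually_ge_at_top[of 1]
    show "eventually (\<lambda>T. ?U (y * T) / ?U T < a) at_top"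
    proof eventually_elim
      case (elim T)
      define m where "m = nat \<lfloor>T / real q\<rfloor>"
      have "real m = real_of_int \<lfloor>T / real q\<rfloor>" using elim unfolding m_def by simp
      then have m: "real m \<le> T / real q" "T / real q < real m + 1" by linarith+
      have mN: "m \<ge> 1" "m \<ge> N" using elim by (auto simp: m_def)
      have 1: "real q * real m \<le> T" using m q by (simp add: field_simps)
      have "y * T \<le> y * (real q * (real m + 1))" using m q y by (intro mult_left_mono) (auto simp: field_simps)
      also have "\<dots> = (real q * y) * (real m + 1)" by simp
      also have "\<dots> \<le> real N * (real m + 1)" using N by (intro mult_right_mono) auto
      also have "\<dots> \<le> real (N + 1) * real m" using mN by (simp add: algebra_simps)
      finally have 2: "y * T \<le> real (N + 1) * real m" .
      have q1: "real q * real m \<ge> 1" using q mN by (metis mult_mono' mult_1 zero_le_one of_nat_1 of_nat_le_iff)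
      have "?U (y * T) / ?U T \<le> ?U (real (N + 1) * real m) / ?U (real q * real m)"
        using monoD[OF mono 2] monoD[OF mono 1] pos[OF q1] nn by (intro frac_le) auto
      also have "\<dots> < a" using elim by (simp add: m_def)
      finally show ?case .
    qed
  next
    fix a assume a: "a < y powr \<beta>"
    \<comment> \<open>For the lower bound the 1 goes to the denominator: T <= q (m + 1) <= (q + 1) m
      as soon as m >= q.\<close>
    have "(\<lambda>q. (real (nat \<lfloor>real q * y\<rfloor>) / real (q + 1)) powr \<beta>) \<longlonglongrightarrow> y powr \<beta>"
      using y \<beta> by real_asymp
    then have "eventually (\<lambda>q. (real (nat \<lfloor>real q * y\<rfloor>) / real (q + 1)) powr \<beta> > a) sequentially"
      by (rule order_tendstoD) (rule a)
    moreover have "eventually (\<lambda>q. nat \<lfloor>real q * y\<rfloor> \<ge> 1) sequentially"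
      using y by real_asymp
    ultimately have "eventually (\<lambda>q. (real (nat \<lfloor>real q * y\<rfloor>) / real (q + 1)) powr \<beta> > a \<and> nat \<lfloor>real q * y\<rfloor> \<ge> 1 \<and> q \<ge> 1) sequentially"
      using eventually_ge_at_top[of 1] by eventually_elim auto
    then obtain q where q: "(real (nat \<lfloor>real q * y\<rfloor>) / real (q + 1)) powr \<beta> > a" "q \<ge> 1" "nat \<lfloor>real q * y\<rfloor> \<ge> 1"
      by (auto simp: eventually_sequentially)
    define N where "N = nat \<lfloor>real q * y\<rfloor>"
    have N: "real q * y \<ge> real N" using y unfolding N_def by (intro of_nat_floor) auto
    have "eventually (\<lambda>m. ?U (real N * real m) / ?U (real (q + 1) * real m) > a) sequentially"
      by (rule order_tendstoD(1)[OF mult2]) (use q in \<open>auto simp: N_def\<close>)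
    then have "eventually (\<lambda>m. ?U (real N * real m) / ?U (real (q + 1) * real m) > a \<and> m \<ge> max 1 q) sequentially"
      using eventually_ge_at_top by (rule eventually_conj)
    from eventually_compose_filterlim[OF this m_lim[OF q(2)]] eventually_ge_at_top[of 1]
    show "eventually (\<lambda>T. ?U (y * T) / ?U T > a) at_top"
    proof eventually_elim
      case (elim T)
      define m where "m = nat \<lfloor>T / real q\<rfloor>"
      have "real m = real_of_int \<lfloor>T / real q\<rfloor>" using elim unfolding m_def by simp
      then have m: "real m \<le> T / real q" "T / real q < real m + 1" by linarith+
      have mN: "m \<ge> 1" "m \<ge> q" using elim by (auto simp: m_def)
      have "real N * real m \<le> (real q * y) * real m" using N by (intro mult_right_mono) auto
      also have "\<dots> = y * (real q * real m)" by simp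
      also have "\<dots> \<le> y * T" using m q y by (intro mult_left_mono) (auto simp: field_simps)
      finally have 1: "real N * real m \<le> y * T" .
      have "T \<le> real q * (real m + 1)" using m q by (simp add: field_simps)
      also have "\<dots> \<le> real (q + 1) * real m" using mN by (simp add: algebra_simps)
      finally have 2: "T \<le> real (q + 1) * real m" .
      have "a < ?U (real N * real m) / ?U (real (q + 1) * real m)" using elim by (simp add: m_def)
      also have "\<dots> \<le> ?U (y * T) / ?U T"
        using monoD[OF mono 2] monoD[OF mono 1] pos[of T] nn elim by (intro frac_le) auto
      finally show ?case .
    qed
  qed
qed

text \<open>Abel summation as an integral: k / y is the length of the set of s in (0,1) with s < k /
  y, and these are the s for which the term k is missing from \<open>psum b (s * y)\<close>.\<close>

lemma psum_weighted_integral: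
  assumes y: "y > 0"
  shows "psum (\<lambda>k. real k * b k) y = y * (LINT s:{0<..<1}|lborel. psum b y - psum b (s * y))"
proof -
  define I where "I = {k. 1 \<le> k \<and> real k \<le> y}"
  have fin: "finite I" by (simp add: I_def)
  have eq: "psum b y - psum b (s * y) = (\<Sum>k\<in>I. b k * indicator {s. s < real k / y} s)" if s: "s \<in> {0<..<1}" for s
  proof -
    have "real k \<le> s * y \<Longrightarrow> real k \<le> y" for k
      using s y mult_right_mono[of s 1 y] by (auto intro: order_trans)
    then have "{k. 1 \<le> k \<and> real k \<le> s * y} = {k\<in>I. real k \<le> s * y}" by (auto simp: I_def)
    then have "psum b (s * y) = (\<Sum>k\<in>I. if real k \<le> s * y then b k else 0)"
      by (simp only: psum_def) (rule sum.inter_filter[OF fin])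
    then have "psum b y - psum b (s * y) = (\<Sum>k\<in>I. b k - (if real k \<le> s * y then b k else 0))"
      by (simp add: psum_def I_def sum_subtractf)
    also have "\<dots> = (\<Sum>k\<in>I. b k * indicator {s. s < real k / y} s)"
      using y by (intro sum.cong) (auto simp: field_simps indicator_def)
    finally show ?thesis .
  qed
  have "(LINT s:{0<..<1}|lborel. psum b y - psum b (s * y)) = 
        (LINT s:{0<..<1}|lborel. (\<Sum>k\<in>I. b k * indicator {s. s < real k / y} s))"
    by (rule set_lebesgue_integral_cong) (use eq in auto)
  also have "\<dots> = (LINT s|lborel. (\<Sum>k\<in>I. b k * indicator {0<..<real k / y} s))"
    unfolding set_lebesgue_integral_def
  proof (rule Bochner_Integration.integral_cong[OF refl])
    fix s :: real
    have "real k / y \<le> 1" if "k \<in> I" for k using that y by (auto simp: I_def)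
    then have "indicat_real {0<..<1} s * (b k * indicator {s. s < real k / y} s) = b k * indicator {0<..<real k / y} s"
      if "k \<in> I" for k using that by (force simp: indicator_def)
    then show "indicat_real {0<..<1} s *\<^sub>R (\<Sum>k\<in>I. b k * indicator {s. s < real k / y} s) 
       = (\<Sum>k\<in>I. b k * indicator {0<..<real k / y} s)"
      unfolding real_scaleR_def sum_distrib_left by (rule sum.cong[OF refl])
  qed
  also have "\<dots> = (\<Sum>k\<in>I. LINT s|lborel. b k * indicator {0<..<real k / y} s)"
    by (rule Bochner_Integration.integral_sum) (use y in \<open>auto intro!: integrable_mult_right simp: integrable_indicator_iff\<close>)
  also have "\<dots> = (\<Sum>k\<in>I. b k * (real k / y))"
    using y by (intro sum.cong) auto
  finally show ?thesis using y by (simp add: psum_def I_def sum_distrib_left mult_ac)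
qed

context regularly_varying begin

lemma integral_ratio:
  "((\<lambda>T. LINT s:{0<..<1}|lborel. 1 - U (s * T) / U T) \<longlongrightarrow> \<gamma> / (\<gamma> + 1)) at_top"
proof -
  have meas: "U \<in> borel_measurable borel" using mono by (rule borel_measurable_mono)
  have I: "set_integrable lborel {0<..<1::real} (\<lambda>_. 1::real)" by (simp add: set_integrable_def)
  have p: "set_integrable lborel {0<..<1} (\<lambda>s. s powr \<gamma>)" "(LINT s:{0<..<1}|lborel. s powr \<gamma>) = 1 / (\<gamma> + 1) - 0"
  proof -
    have a: "((\<lambda>s::real. s powr (\<gamma> + 1) / (\<gamma> + 1)) \<longlongrightarrow> 0) (at_right 0)" using \<gamma> by real_asymp
    have b: "((\<lambda>s::real. s powr (\<gamma> + 1) / (\<gamma> + 1)) \<longlongrightarrow> 1 / (\<gamma> + 1)) (at_left 1)" 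
      using \<gamma> by (auto intro!: tendsto_eq_intros)
    have c: "continuous_on {0<..<1} (\<lambda>s::real. s powr \<gamma>)" by (intro continuous_intros) auto
    have d: "((\<lambda>s. s powr (\<gamma> + 1) / (\<gamma> + 1)) has_real_derivative x powr \<gamma>) (at x)" if "0 < x" "x < 1" for x
      using that \<gamma> by (auto intro!: derivative_eq_intros)
    show "set_integrable lborel {0<..<1} (\<lambda>s. s powr \<gamma>)"
      by (rule set_integral_FTC_nonneg(1)[OF _ d c _ a b]) auto
    show "(LINT s:{0<..<1}|lborel. s powr \<gamma>) = 1 / (\<gamma> + 1) - 0"
      by (rule set_integral_FTC_nonneg(2)[OF _ d c _ a b]) auto
  qed
  have "((\<lambda>T. LINT s:{0<..<1}|lborel. 1 - U (s * T) / U T) \<longlongrightarrow> (LINT s:{0<..<1}|lborel. 1 - s powr \<gamma>)) at_top"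
    unfolding set_lebesgue_integral_def
  proof (rule integral_dominated_convergence_at_top)
    show "integrable lborel (indicat_real {0<..<1::real})" by (simp add: integrable_indicator_iff)
    show "(\<lambda>s. indicat_real {0<..<1} s *\<^sub>R (1 - U (s * T) / U T)) \<in> borel_measurable lborel" for T
      using meas by simp
    show "(\<lambda>s. indicat_real {0<..<1} s *\<^sub>R (1 - s powr \<gamma>)) \<in> borel_measurable lborel" by simp
    show "eventually (\<lambda>T. AE s in lborel. norm (indicat_real {0<..<1} s *\<^sub>R (1 - U (s * T) / U T)) \<le> indicat_real {0<..<1} s) at_top"
      using eventually_ge_at_top[of 1]
    proof eventually_elim
      case (elim T)
      have "norm (1 - U (s * T) / U T) \<le> 1" if "0 < s" "s < 1" for s
      proof -
        have "U (s * T) \<le> U T" using that elim by (intro U_mono) (simp add: mult_le_cancel_right1)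
        then have "0 \<le> U (s * T) / U T" "U (s * T) / U T \<le> 1" using U_pos[OF elim] U_nonneg[of "s * T"] by auto
        then show ?thesis by simp
      qed
      then show ?case by (intro AE_I2) (auto simp: indicator_def)
    qed
    show "AE s in lborel. ((\<lambda>T. indicat_real {0<..<1} s *\<^sub>R (1 - U (s * T) / U T)) \<longlongrightarrow> 
        indicat_real {0<..<1} s *\<^sub>R (1 - s powr \<gamma>)) at_top"
      by (intro AE_I2) (auto simp: indicator_def intro!: tendsto_intros ratio)
  qed
  also have "(LINT s:{0<..<1}|lborel. 1 - s powr \<gamma>) = 1 - 1 / (\<gamma> + 1)"
    using p I by (subst set_integral_diff) (auto simp: set_lebesgue_integral_def)
  also have "\<dots> = \<gamma> / (\<gamma> + 1)" using \<gamma> by (simp add: field_simps)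
  finally show ?thesis .
qed

end

text \<open>The integral identity is divided by T times the partial sum of b, so that only ratios
  U(s T) / U(T) remain; their limit s^\<gamma> gives 1 - 1/(\<gamma> + 1). With index \<beta> this
  constant is the factor in \<open>shape_const_eq\<close>.\<close>

lemma psum_weighted_asymp:
  assumes "regularly_varying (psum b) \<gamma>"
  shows "((\<lambda>T. psum (\<lambda>k. real k * b k) T / (T * psum b T)) \<longlongrightarrow> \<gamma> / (\<gamma> + 1)) at_top"
proof -
  interpret regularly_varying "psum b" \<gamma> by (rule assms)
  have "eventually (\<lambda>T. (LINT s:{0<..<1}|lborel. 1 - psum b (s * T) / psum b T) = 
     psum (\<lambda>k. real k * b k) T / (T * psum b T)) at_top"
    using eventually_ge_at_top[of 1]
  proof eventually_elim
    case (elim T)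
    have "(LINT s:{0<..<1}|lborel. 1 - psum b (s * T) / psum b T)
       = (LINT s:{0<..<1}|lborel. (psum b T - psum b (s * T)) / psum b T)"
      using U_pos[OF elim] by (simp add: diff_divide_distrib)
    also have "\<dots> = (LINT s:{0<..<1}|lborel. psum b T - psum b (s * T)) / psum b T"
      by (rule set_integral_divide_zero)
    also have "\<dots> = psum (\<lambda>k. real k * b k) T / (T * psum b T)"
      using elim by (subst psum_weighted_integral) auto
    finally show ?case .
  qed
  from Lim_transform_eventually[OF integral_ratio this] show ?thesis .
qed

text \<open>The new index exceeds 1, which is what integrability against q' near u = 1 demands of
  the mean weight.\<close>

lemma regularly_varying_psum_weighted:
  assumes b: "\<And>k. k \<ge> 1 \<Longrightarrow> b k \<ge> 0" and rv: "regularly_varying (psum b) \<gamma>"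
  shows "regularly_varying (psum (\<lambda>k. real k * b k)) (\<gamma> + 1)"
proof
  interpret regularly_varying "psum b" \<gamma> by (rule rv)
  let ?V = "psum (\<lambda>k. real k * b k)"
  show "mono ?V" using b by (intro psum_mono) auto
  show "?V T = 0" if "T < 1" for T by (rule psum_less_1[OF that])
  show "?V 1 > 0" using one psum_of_nat[of b 1] psum_of_nat[of "\<lambda>k. real k * b k" 1] by simp
  show "\<gamma> + 1 > 0" using \<gamma> by simp
  fix y :: real assume y: "y > 0"
  \<comment> \<open>The weighted sum is T times the partial sum of b times \<open>?g\<close>. Since
    \<open>?g\<close> has a positive limit, it cancels from the ratio and leaves y
    y^\<gamma>.\<close>
  let ?g = "\<lambda>T. ?V T / (T * psum b T)"
  have g: "(?g \<longlongrightarrow> \<gamma> / (\<gamma> + 1)) at_top" by (rule psum_weighted_asymp[OF rv])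
  have gy: "((\<lambda>T. ?g (y * T)) \<longlongrightarrow> \<gamma> / (\<gamma> + 1)) at_top"
    by (rule filterlim_compose[OF g]) (use y in real_asymp)
  have "((\<lambda>T. ?g (y * T) / ?g T * y * (psum b (y * T) / psum b T)) \<longlongrightarrow> 
      (\<gamma> / (\<gamma> + 1)) / (\<gamma> / (\<gamma> + 1)) * y * y powr \<gamma>) at_top"
    by (intro tendsto_intros g gy ratio) (use y \<gamma> in auto)
  also have "(\<gamma> / (\<gamma> + 1)) / (\<gamma> / (\<gamma> + 1)) * y * y powr \<gamma> = y powr (\<gamma> + 1)"
    using y \<gamma> by (simp add: powr_add)
  finally have lim: "((\<lambda>T. ?g (y * T) / ?g T * y * (psum b (y * T) / psum b T)) \<longlongrightarrow> y powr (\<gamma> + 1)) at_top" .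
  have "eventually (\<lambda>T. ?g (y * T) / ?g T * y * (psum b (y * T) / psum b T) = ?V (y * T) / ?V T) at_top"
    using eventually_ge_at_top[of "max 1 (1 / y)"]
  proof eventually_elim
    case (elim T)
    have "T \<ge> 1" "y * T \<ge> 1" using elim y by (auto simp: field_simps)
    then show ?case using U_pos[of T] U_pos[of "y * T"] y by simp
  qed
  from Lim_transform_eventually[OF lim this] show "((\<lambda>T. ?V (y * T) / ?V T) \<longlongrightarrow> y powr (\<gamma> + 1)) at_top" .
qed

section \<open>Sums over a regularly varying sequence\<close>

text \<open>The two alternatives of case (i), radius above 1 and a pole at 1, meet here: from now on
  only these bounds on q and q' are used.\<close>

locale tame_pgf = pgf +
  fixes D :: real
  assumes radius_ge_1: "fps_conv_radius f \<ge> 1"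
    and q'_le: "\<And>u. 0 \<le> u \<Longrightarrow> u < 1 \<Longrightarrow> q' u \<le> D / (1 - u)\<^sup>2"
    and q_le: "\<And>u. 0 \<le> u \<Longrightarrow> u < 1 \<Longrightarrow> q u \<le> D / (1 - u)"
begin

lemma in_radius: "u < 1 \<Longrightarrow> ereal u < fps_conv_radius f"
  using radius_ge_1 by (auto intro: less_le_trans[of _ 1])

lemma continuous_on_q'_01: "continuous_on {0<..<1} q'"
proof (rule continuous_on_open_UN[of UNIV "\<lambda>n::nat. {0<..<1 - 1 / real (Suc n)}", THEN continuous_on_subset])
  show "continuous_on {0<..<1 - 1 / real (Suc n)} q'" for n
    by (rule continuous_on_subset[OF continuous_on_q'[of "1 - 1 / real (Suc n)"]]) (auto intro!: in_radius)
  show "{0<..<1} \<subseteq> (\<Union>n. {0::real<..<1 - 1 / real (Suc n)})"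
  proof
    fix u :: real assume u: "u \<in> {0<..<1}"
    then obtain n where "1 / real (Suc n) < 1 - u" using nat_approx_posE[of "1 - u"] by auto
    with u show "u \<in> (\<Union>n. {0<..<1 - 1 / real (Suc n)})" by (auto intro!: exI[of _ n])
  qed
qed auto

lemma q'_measurable: "(\<lambda>u. indicat_real {0<..<1} u * q' u) \<in> borel_measurable borel"
  using borel_measurable_continuous_on_indicator[OF _ continuous_on_q'_01] by simp

lemma integrable_q'_powr:
  "a > 1 \<Longrightarrow> set_integrable lborel {0<..<1} (\<lambda>u. q' u * (- ln u) powr a)"
  by (rule set_integrable_mult_neg_ln_powr[OF continuous_on_q'_01, of D])
     (use q'_le q'_nonneg in_radius in auto)

text \<open>All v share the integration domain (0,1), and v enters through an indicator. A sum over
  k with v = x^k can then be moved inside the integral, and in \<open>ennreal\<close> this needs no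
  convergence.\<close>

lemma q_eq_nn_integral:
  assumes v: "0 \<le> v" "v < 1"
  shows "ennreal (q v) = (\<integral>\<^sup>+u. ennreal (indicator {0<..<1} u * q' u * indicator {..v} u) \<partial>lborel)"
proof (cases "v = 0")
  case True
  then have eq0: "indicat_real {0<..<1} u * q' u * indicator {..v} u = 0" for u by (auto simp: indicator_def)
  show ?thesis unfolding eq0 using True by simp
next
  case False
  then have v0: "0 < v" using v by simp
  have r: "ereal u < fps_conv_radius f" if "u \<le> v" for u using that v in_radius by simp
  have cq: "continuous_on {0..v} q" by (rule continuous_on_q[OF r]) simp
  have "(q \<longlongrightarrow> q 0) (at_right 0)" "(q \<longlongrightarrow> q v) (at_left v)"
    by (rule continuous_on_Icc_at_rightD[OF cq v0], rule continuous_on_Icc_at_leftD[OF cq v0])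
  moreover have d: "(q has_real_derivative q' x) (at x)" if "0 < x" "x < v" for x
    using that r by (intro q_deriv) auto
  moreover have c: "continuous_on {0<..<v} q'"
    by (rule continuous_on_subset[OF continuous_on_q'_01]) (use v in auto)
  moreover have n: "0 \<le> q' x" if "0 < x" "x < v" for x using q'_nonneg[of x] r that by auto
  ultimately have I: "set_integrable lborel {0<..<v} q'" "(LINT u:{0<..<v}|lborel. q' u) = q v - q 0"
    by (intro set_integral_FTC_nonneg[where F = q and A = "q 0" and B = "q v"] v0; simp)+
  have "ennreal (q v) = ennreal (LINT u:{0<..<v}|lborel. q' u)" using I by simp
  also have "\<dots> = (\<integral>\<^sup>+u. ennreal (indicator {0<..<v} u *\<^sub>R q' u) \<partial>lborel)"
    unfolding set_lebesgue_integral_def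
    by (rule nn_integral_eq_integral[symmetric])
       (use I n in \<open>auto simp: set_integrable_def indicator_def\<close>)
  also have "\<dots> = (\<integral>\<^sup>+u. ennreal (indicator {0<..<1} u * q' u * indicator {..v} u) \<partial>lborel)"
  proof (rule nn_integral_cong_AE)
    have "AE u in lborel. u \<noteq> v" by (rule AE_lborel_singleton)
    then show "AE u in lborel. ennreal (indicator {0<..<v} u *\<^sub>R q' u) = ennreal (indicator {0<..<1} u * q' u * indicator {..v} u)"
      by eventually_elim (use v in \<open>auto simp: indicator_def\<close>)
  qed
  finally show ?thesis .
qed

lemma sum_q_eq_nn_integral:
  assumes c: "\<And>k. k \<ge> 1 \<Longrightarrow> c k \<ge> 0" and T: "T > 0" and s: "s \<ge> 0"
  shows "(\<Sum>k. ennreal (if real k > s then c k * q (exp (- 1 / T) ^ k) else 0)) =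
    (\<integral>\<^sup>+u. ennreal (indicator {0<..<1} u * (q' u * max 0 (psum c ((- ln u) * T) - psum c s))) \<partial>lborel)"
proof -
  define x where "x = exp (- 1 / T)"
  have x: "0 < x" "x < 1" using T by (auto simp: x_def)
  have xk: "x ^ k < 1" if "k \<ge> 1" for k using x that by (simp add: power_less_one_iff)
  define d where "d = (\<lambda>k. if real k > s then c k else 0)"
  have d: "d k \<ge> 0" for k using c[of k] s by (auto simp: d_def)
  have "ennreal (if real k > s then c k * q (x ^ k) else 0) = 
      (\<integral>\<^sup>+u. ennreal (d k) * ennreal (indicator {0<..<1} u * q' u * indicator {..x ^ k} u) \<partial>lborel)" for k
  proof (cases "real k > s")
    case True
    then have k: "k \<ge> 1" using s by simp
    have q0: "q (x ^ k) \<ge> 0" using x xk[OF k] by (intro q_nonneg in_radius) auto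
    have m: "(\<lambda>u. ennreal (indicator {0<..<1} u * q' u * indicator {..x ^ k} u)) \<in> borel_measurable lborel"
      using q'_measurable by simp
    show ?thesis using True k c[OF k] x xk[OF k] q0 q_eq_nn_integral[of "x ^ k"]
      by (simp add: nn_integral_cmult[OF m] d_def ennreal_mult)
  next
    case False
    then show ?thesis by (simp add: d_def)
  qed
  then have "(\<Sum>k. ennreal (if real k > s then c k * q (x ^ k) else 0)) = 
     (\<integral>\<^sup>+u. (\<Sum>k. ennreal (d k) * ennreal (indicator {0<..<1} u * q' u * indicator {..x ^ k} u)) \<partial>lborel)"
    using q'_measurable by (subst nn_integral_suminf) auto
  also have "\<dots> = (\<integral>\<^sup>+u. ennreal (indicator {0<..<1} u * (q' u * max 0 (psum c ((- ln u) * T) - psum c s))) \<partial>lborel)"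
  proof (rule nn_integral_cong)
    fix u :: real
    show "(\<Sum>k. ennreal (d k) * ennreal (indicator {0<..<1} u * q' u * indicator {..x ^ k} u)) =
      ennreal (indicator {0<..<1} u * (q' u * max 0 (psum c ((- ln u) * T) - psum c s)))"
    proof (cases "u \<in> {0<..<1}")
      case False then show ?thesis by simp
    next
      case True
      then have u: "0 < u" "u < 1" by auto
      \<comment> \<open>The parametrisation x = exp (- 1/T) makes the condition u <= x^k linear in
        k, so the inner sum over k is a partial sum up to |log u| T.\<close>
      have iff: "u \<le> x ^ k \<longleftrightarrow> real k \<le> (- ln u) * T" for k
      proof -
        have "x ^ k = exp (- real k / T)" by (simp add: x_def flip: exp_of_nat_mult)
        then have "u \<le> x ^ k \<longleftrightarrow> ln u \<le> - real k / T" using u by (simp add: ln_le_cancel_iff[symmetric] del: ln_le_cancel_iff)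
        also have "\<dots> \<longleftrightarrow> ln u * T \<le> - real k" using T by (rule pos_le_divide_eq)
        also have "\<dots> \<longleftrightarrow> real k \<le> (- ln u) * T" by auto
        finally show ?thesis .
      qed
      let ?A = "{k. 1 \<le> k \<and> real k \<le> (- ln u) * T}"
      have fin: "finite ?A" by simp
      have "(\<Sum>k. ennreal (d k) * ennreal (indicator {0<..<1} u * q' u * indicator {..x ^ k} u)) = 
        (\<Sum>k\<in>?A. ennreal (d k) * ennreal (indicator {0<..<1} u * q' u * indicator {..x ^ k} u))"
      proof (rule suminf_finite[OF fin])
        fix k assume "k \<notin> ?A"
        \<comment> \<open>The index 0 lies outside \<open>?A\<close> although 0 <= |log u| T; it
          contributes nothing because s >= 0 forces \<open>d 0 = 0\<close>.\<close>
        then have "k = 0 \<or> \<not> u \<le> x ^ k" using iff[of k] by auto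
        then show "ennreal (d k) * ennreal (indicator {0<..<1} u * q' u * indicator {..x ^ k} u) = 0"
          using s by (auto simp: d_def)
      qed
      also have "\<dots> = (\<Sum>k\<in>?A. ennreal (d k * q' u))"
        using u iff d q'_nonneg[of u] in_radius[of u] by (intro sum.cong) (auto simp: ennreal_mult)
      also have "\<dots> = ennreal (\<Sum>k\<in>?A. d k * q' u)"
        using d q'_nonneg[of u] in_radius[of u] u by (intro sum_ennreal) auto
      also have "(\<Sum>k\<in>?A. d k * q' u) = q' u * (\<Sum>k\<in>?A. d k)" by (simp add: sum_distrib_left mult.commute)
      also have "(\<Sum>k\<in>?A. d k) = max 0 (psum c ((- ln u) * T) - psum c s)"
      proof (cases "s \<le> (- ln u) * T")
        case True
        have "?A = {k. 1 \<le> k \<and> real k \<le> s} \<union> {k\<in>?A. real k > s}" using True by auto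
        then have "psum c ((- ln u) * T) = (\<Sum>k\<in>{k. 1 \<le> k \<and> real k \<le> s} \<union> {k\<in>?A. real k > s}. c k)"
          unfolding psum_def by (rule arg_cong)
        also have "\<dots> = psum c s + (\<Sum>k | k \<in> ?A \<and> real k > s. c k)"
          unfolding psum_def
          by (rule sum.union_disjoint[OF finite_psum_set(2) finite_subset[OF _ fin]]) auto
        also have "(\<Sum>k | k \<in> ?A \<and> real k > s. c k) = (\<Sum>k\<in>?A. d k)"
          unfolding d_def by (rule sum.inter_filter) (rule fin)
        finally show ?thesis using sum_nonneg[of ?A d] d by simp
      next
        case False
        have "psum c ((- ln u) * T) \<le> psum c s"
          using False by (intro monoD[OF psum_mono]) (auto simp: c)
        moreover have "(\<Sum>k\<in>?A. d k) = 0" using False by (intro sum.neutral) (auto simp: d_def)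
        ultimately show ?thesis by simp
      qed
      finally show ?thesis using True by simp
    qed
  qed
  finally show ?thesis unfolding x_def .
qed

text \<open>The limit of the layer-cake integrals after division by the partial sum at T. For
  \<gamma> = \<beta> and t > 0 it is the limit shape up to normalisation; for \<gamma> = \<beta> + 1
  and t = 0, where \<open>0 powr \<gamma>\<close> vanishes, it governs the mean weight.\<close>

definition shape_integral :: "real \<Rightarrow> real \<Rightarrow> real" where
  "shape_integral \<gamma> t = (LINT u:{0<..<1}|lborel. q' u * max 0 ((- ln u) powr \<gamma> - t powr \<gamma>))"

text \<open>A Karamata-type theorem: after the layer-cake representation of the sum, the regularly
  varying function only appears as \<open>psum c (r T) / psum c T\<close>, which converges dominatedly.\<close>

lemma karamata:
  assumes c: "\<And>k. k \<ge> 1 \<Longrightarrow> c k \<ge> 0" and rv: "regularly_varying (psum c) \<gamma>"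
    and s: "\<And>T. T \<ge> 1 \<Longrightarrow> s T \<ge> 0" "((\<lambda>T. psum c (s T) / psum c T) \<longlongrightarrow> t powr \<gamma>) at_top"
    and \<kappa>: "\<kappa> > 1" "K > 1"
    and dom: "eventually (\<lambda>T. \<forall>r>0. max 0 (psum c (r * T) - psum c (s T)) \<le> C * (r powr \<kappa> + r powr K) * psum c T) at_top"
  obtains J where "(J \<longlongrightarrow> shape_integral \<gamma> t) at_top"
    "eventually (\<lambda>T. J T \<ge> 0 \<and> (\<Sum>k. ennreal (if real k > s T then c k * q (exp (- 1 / T) ^ k) else 0))
       = ennreal (psum c T * J T)) at_top"
proof -
  interpret rv: regularly_varying "psum c" \<gamma> by (rule rv)
  define h where "h = (\<lambda>T u. indicator {0<..<1} u * (q' u * (max 0 (psum c ((- ln u) * T) - psum c (s T)) / psum c T)))"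
  \<comment> \<open>The majorant: \<open>dom\<close> at r = |log u|, multiplied by q'. Both
    exponents exceed 1, so it is integrable up to u = 1.\<close>
  define w where "w = (\<lambda>u. C * (indicat_real {0<..<1} u * (q' u * (- ln u) powr \<kappa>)) + C * (indicat_real {0<..<1} u * (q' u * (- ln u) powr K)))"
  have w: "integrable lborel w"
    unfolding w_def using integrable_q'_powr[OF \<kappa>(1)] integrable_q'_powr[OF \<kappa>(2)]
    by (intro Bochner_Integration.integrable_add integrable_mult_right) (auto simp: set_integrable_def)
  have meas_U: "psum c \<in> borel_measurable borel" using rv.mono by (rule borel_measurable_mono)
  have meas: "h T \<in> borel_measurable lborel" for T
  proof -
    have "(\<lambda>u. (indicat_real {0<..<1} u * q' u) * (max 0 (psum c ((- ln u) * T) - psum c (s T)) / psum c T)) \<in> borel_measurable borel"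
      using q'_measurable meas_U by measurable
    then show ?thesis by (simp add: h_def mult.assoc)
  qed
  have q'0: "q' u \<ge> 0" if "0 < u" "u < 1" for u using that q'_nonneg[of u] in_radius by simp
  have bound: "norm (h T u) \<le> w u" 
    if T: "T \<ge> 1" and le: "\<forall>r>0. max 0 (psum c (r * T) - psum c (s T)) \<le> C * (r powr \<kappa> + r powr K) * psum c T" for T u
  proof (cases "u \<in> {0<..<1}")
    case True
    have "max 0 (psum c ((- ln u) * T) - psum c (s T)) / psum c T \<le> C * ((- ln u) powr \<kappa> + (- ln u) powr K)"
      using le[rule_format, of "- ln u"] True rv.U_pos[OF T] by (simp add: pos_divide_le_eq)
    then have "q' u * (max 0 (psum c ((- ln u) * T) - psum c (s T)) / psum c T) \<le> q' u * (C * ((- ln u) powr \<kappa> + (- ln u) powr K))"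
      using q'0[of u] True by (intro mult_left_mono) auto
    moreover have "0 \<le> h T u" using q'0[of u] True rv.U_nonneg[of T] by (auto simp: h_def intro!: mult_nonneg_nonneg divide_nonneg_nonneg)
    ultimately show ?thesis using True by (simp add: h_def w_def algebra_simps)
  qed (simp add: h_def w_def)
  have ev: "eventually (\<lambda>T. T \<ge> 1 \<and> (\<forall>r>0. max 0 (psum c (r * T) - psum c (s T)) \<le> C * (r powr \<kappa> + r powr K) * psum c T)) at_top"
    using eventually_ge_at_top dom by (rule eventually_conj)
  have lim: "((\<lambda>T. integral\<^sup>L lborel (h T)) \<longlongrightarrow> 
      integral\<^sup>L lborel (\<lambda>u. indicator {0<..<1} u * (q' u * max 0 ((- ln u) powr \<gamma> - t powr \<gamma>)))) at_top"
  proof (rule integral_dominated_convergence_at_top[OF _ meas w])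
    have "(\<lambda>u. (indicat_real {0<..<1} u * q' u) * max 0 ((- ln u) powr \<gamma> - t powr \<gamma>)) \<in> borel_measurable borel"
      using q'_measurable by measurable
    then show "(\<lambda>u. indicat_real {0<..<1} u * (q' u * max 0 ((- ln u) powr \<gamma> - t powr \<gamma>))) \<in> borel_measurable lborel"
      by (simp add: mult.assoc)
    show "eventually (\<lambda>T. AE u in lborel. norm (h T u) \<le> w u) at_top"
      using ev by eventually_elim (use bound in auto)
    have "((\<lambda>T. h T u) \<longlongrightarrow> indicator {0<..<1} u * (q' u * max 0 ((- ln u) powr \<gamma> - t powr \<gamma>))) at_top" for u
    proof (cases "u \<in> {0<..<1}")
      case True
      have "((\<lambda>T. psum c ((- ln u) * T) / psum c T) \<longlongrightarrow> (- ln u) powr \<gamma>) at_top"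
        by (rule rv.ratio) (use True in auto)
      then have "((\<lambda>T. max 0 (psum c ((- ln u) * T) / psum c T - psum c (s T) / psum c T)) \<longlongrightarrow> max 0 ((- ln u) powr \<gamma> - t powr \<gamma>)) at_top"
        by (intro tendsto_intros s)
      moreover have "eventually (\<lambda>T. max 0 (psum c ((- ln u) * T) / psum c T - psum c (s T) / psum c T) 
         = max 0 (psum c ((- ln u) * T) - psum c (s T)) / psum c T) at_top"
        using eventually_ge_at_top[of 1]
      proof eventually_elim
        case (elim T)
        from rv.U_pos[OF elim] show ?case 
          by (simp add: max_def divide_simps diff_divide_distrib[symmetric])
      qed
      ultimately have "((\<lambda>T. max 0 (psum c ((- ln u) * T) - psum c (s T)) / psum c T) \<longlongrightarrow> max 0 ((- ln u) powr \<gamma> - t powr \<gamma>)) at_top"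
        by (rule Lim_transform_eventually)
      then show ?thesis unfolding h_def by (intro tendsto_intros)
    qed (simp add: h_def)
    then show "AE u in lborel. ((\<lambda>T. h T u) \<longlongrightarrow> indicator {0<..<1} u * (q' u * max 0 ((- ln u) powr \<gamma> - t powr \<gamma>))) at_top"
      by simp
  qed
  show thesis
  proof (rule that[of "\<lambda>T. integral\<^sup>L lborel (h T)"])
    show "((\<lambda>T. integral\<^sup>L lborel (h T)) \<longlongrightarrow> shape_integral \<gamma> t) at_top"
      using lim by (simp add: shape_integral_def set_lebesgue_integral_def)
    show "eventually (\<lambda>T. integral\<^sup>L lborel (h T) \<ge> 0 \<and> (\<Sum>k. ennreal (if real k > s T then c k * q (exp (- 1 / T) ^ k) else 0))
       = ennreal (psum c T * integral\<^sup>L lborel (h T))) at_top"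
      using ev
    proof eventually_elim
      case (elim T)
      then have T: "T \<ge> 1" by simp
      have int: "integrable lborel (h T)"
      proof (rule Bochner_Integration.integrable_bound[OF w meas])
        have "norm (h T u) \<le> norm (w u)" for u
          by (rule order_trans[OF bound]) (use elim in auto)
        then show "AE u in lborel. norm (h T u) \<le> norm (w u)" by simp
      qed
      have h0: "h T u \<ge> 0" for u
        using q'0[of u] rv.U_nonneg[of T] by (auto simp: h_def indicator_def intro!: mult_nonneg_nonneg divide_nonneg_nonneg)
      have "(\<Sum>k. ennreal (if real k > s T then c k * q (exp (- 1 / T) ^ k) else 0)) =
        (\<integral>\<^sup>+u. ennreal (indicator {0<..<1} u * (q' u * max 0 (psum c ((- ln u) * T) - psum c (s T)))) \<partial>lborel)"
        using s(1)[OF T] T c by (intro sum_q_eq_nn_integral) auto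
      also have "\<dots> = (\<integral>\<^sup>+u. ennreal (psum c T * h T u) \<partial>lborel)"
        using rv.U_pos[OF T] by (intro nn_integral_cong) (simp add: h_def)
      also have "\<dots> = ennreal (integral\<^sup>L lborel (\<lambda>u. psum c T * h T u))"
        using int h0 rv.U_nonneg[of T] by (intro nn_integral_eq_integral) auto
      finally show ?case using h0 by simp
    qed
  qed
qed

end

section \<open>Asymptotic means of the weight and of the tail counts\<close>

context tame_pgf begin

lemma shape_integral_0: 
  "shape_integral \<gamma> 0 = (LINT u:{0<..<1}|lborel. q' u * (- ln u) powr \<gamma>)"
  unfolding shape_integral_def by simp

lemma shape_integral_pos:
  assumes \<gamma>: "\<gamma> > 1"
  shows "shape_integral \<gamma> 0 > 0"
proof -
  have cq: "continuous_on {0..1/2} q" by (intro continuous_on_q in_radius) auto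
  have I: "set_integrable lborel {0<..<1/2} q'" "(LINT u:{0<..<1/2}|lborel. q' u) = q (1/2) - q 0"
  proof -
    have h: "(0::real) < 1/2" by simp
    have d: "(q has_real_derivative q' x) (at x)" if "0 < x" "x < 1/2" for x
      using that by (intro q_deriv in_radius) auto
    have c: "continuous_on {0<..<1/2} q'"
      by (rule continuous_on_subset[OF continuous_on_q'_01]) auto
    have n: "0 \<le> q' x" if "0 < x" "x < 1/2" for x using q'_nonneg[of x] in_radius[of x] that by auto
    note lims = continuous_on_Icc_at_rightD[OF cq h] continuous_on_Icc_at_leftD[OF cq h]
    show "set_integrable lborel {0<..<1/2} q'" by (rule set_integral_FTC_nonneg(1)[OF h d c n lims])
    show "(LINT u:{0<..<1/2}|lborel. q' u) = q (1/2) - q 0" by (rule set_integral_FTC_nonneg(2)[OF h d c n lims])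
  qed
  \<comment> \<open>On (0, 1/2) the logarithmic factor is at least (ln 2)^\<gamma> and q' integrates
    to q(1/2) > 0; the rest of the integrand is nonnegative.\<close>
  have "0 < ln 2 powr \<gamma> * q (1/2)" using q_pos[of "1/2"] in_radius[of "1/2"] by simp
  also have "\<dots> = (LINT u:{0<..<1/2}|lborel. ln 2 powr \<gamma> * q' u)" using I by simp
  also have "\<dots> \<le> (LINT u:{0<..<1}|lborel. q' u * (- ln u) powr \<gamma>)"
    unfolding set_lebesgue_integral_def
  proof (rule integral_mono)
    show "integrable lborel (\<lambda>u. indicat_real {0<..<1/2} u *\<^sub>R (ln 2 powr \<gamma> * q' u))"
      using set_integrable_mult_right[OF I(1), of "ln 2 powr \<gamma>"] unfolding set_integrable_def by simp
    show "integrable lborel (\<lambda>u. indicat_real {0<..<1} u *\<^sub>R (q' u * (- ln u) powr \<gamma>))"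
      using integrable_q'_powr[OF \<gamma>] unfolding set_integrable_def .
    fix u :: real
    show "indicat_real {0<..<1/2} u *\<^sub>R (ln 2 powr \<gamma> * q' u) \<le> indicat_real {0<..<1} u *\<^sub>R (q' u * (- ln u) powr \<gamma>)"
    proof (cases "u \<in> {0<..<1}")
      case True
      then have q'0: "q' u \<ge> 0" using q'_nonneg in_radius by simp
      have "ln 2 powr \<gamma> \<le> (- ln u) powr \<gamma>" if "u < 1/2"
      proof (rule powr_mono2)
        have "ln u \<le> ln (1/2)" using True that by (subst ln_le_cancel_iff) auto
        then show "ln 2 \<le> - ln u" by (simp add: ln_div)
      qed (use \<gamma> in auto)
      then show ?thesis using True q'0 
        by (auto simp: indicator_def mult.commute[of "q' u"] intro!: mult_right_mono mult_nonneg_nonneg)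
    qed auto
  qed
  finally show ?thesis by (simp add: shape_integral_0)
qed

text \<open>The mean \<open>M\<close> of the weight and the mean \<open>\<Phi>\<close> of the number of parts exceeding \<open>t / (1 - x)\<close>,
  for \<open>x = exp (- 1 / T)\<close>.\<close>

lemma mean_asymptotics:
  assumes b: "\<And>k. k \<ge> 1 \<Longrightarrow> b k \<ge> 0" and rv: "regularly_varying (psum b) \<beta>"
  defines "\<alpha> \<equiv> \<lambda>T. 1 / (1 - exp (- 1 / T))"
  obtains M where
    "eventually (\<lambda>T. M T > 0 \<and> (\<Sum>k. ennreal (real k * b k * q (exp (- 1 / T) ^ k))) = ennreal (M T)) at_top"
    "((\<lambda>T. \<alpha> T / M T) \<longlongrightarrow> 0) at_top"
    "\<And>t. t > 0 \<Longrightarrow> \<exists>\<Phi>. eventually (\<lambda>T. \<Phi> T \<ge> 0 \<and> (\<Sum>k. ennreal (if real k > \<alpha> T * t then b k * q (exp (- 1 / T) ^ k) else 0)) = ennreal (\<Phi> T)) at_top \<and>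
       ((\<lambda>T. \<alpha> T * \<Phi> T / M T) \<longlongrightarrow> shape_integral \<beta> t / (\<beta> / (\<beta> + 1) * shape_integral (\<beta> + 1) 0)) at_top"
proof -
  interpret U: regularly_varying "psum b" \<beta> by (rule rv)
  define c where "c = (\<lambda>k. real k * b k)"
  have c: "c k \<ge> 0" if "k \<ge> 1" for k using b[OF that] by (simp add: c_def)
  have rvc: "regularly_varying (psum c) (\<beta> + 1)"
    unfolding c_def by (rule regularly_varying_psum_weighted[OF b rv])
  interpret V: regularly_varying "psum c" "\<beta> + 1" by (rule rvc)
  have \<beta>: "\<beta> > 0" by (rule U.\<gamma>)
  \<comment> \<open>The weighted partial sums have index \<beta> + 1, and 1 + \<beta>/2 is an
    exponent below that index but still above 1.\<close>
  obtain C where C: "C \<ge> 0" 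
    "\<And>T r. T \<ge> 1 \<Longrightarrow> r > 0 \<Longrightarrow> psum c (r * T) \<le> C * (r powr (1 + \<beta>/2) + r powr (\<beta> + 2)) * psum c T"
    using V.potter_bound[of "1 + \<beta>/2" "\<beta> + 2"] \<beta> by auto
  have dom: "eventually (\<lambda>T. \<forall>r>0. max 0 (psum c (r * T) - psum c 0) \<le> C * (r powr (1 + \<beta>/2) + r powr (\<beta> + 2)) * psum c T) at_top"
    using eventually_ge_at_top[of 1]
  proof eventually_elim
    case (elim T)
    show ?case
    proof (intro allI impI)
      fix r :: real assume "r > 0"
      then show "max 0 (psum c (r * T) - psum c 0) \<le> C * (r powr (1 + \<beta>/2) + r powr (\<beta> + 2)) * psum c T"
        using C(2)[OF elim, of r] V.U_nonneg[of "r * T"] V.zero[of 0] by simp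
    qed
  qed
  obtain J where J: "(J \<longlongrightarrow> shape_integral (\<beta> + 1) 0) at_top"
    "eventually (\<lambda>T. J T \<ge> 0 \<and> (\<Sum>k. ennreal (if real k > 0 then c k * q (exp (- 1 / T) ^ k) else 0))
       = ennreal (psum c T * J T)) at_top"
    by (rule karamata[OF c rvc _ _ _ _ dom, where t = 0]) (use \<beta> V.zero[of 0] in auto)
  define M where "M = (\<lambda>T. psum c T * J T)"
  have Jpos: "shape_integral (\<beta> + 1) 0 > 0" using \<beta> by (intro shape_integral_pos) auto
  have evJ: "eventually (\<lambda>T. J T > 0) at_top" by (rule order_tendstoD(1)[OF J(1) Jpos])
  have M: "eventually (\<lambda>T. M T > 0 \<and> (\<Sum>k. ennreal (real k * b k * q (exp (- 1 / T) ^ k))) = ennreal (M T)) at_top"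
    using evJ J(2) eventually_ge_at_top[of 1]
  proof eventually_elim
    case (elim T)
    have "(\<lambda>k. ennreal (if real k > 0 then c k * q (exp (- 1 / T) ^ k) else 0)) = 
        (\<lambda>k. ennreal (real k * b k * q (exp (- 1 / T) ^ k)))" by (auto simp: c_def)
    then show ?case using elim V.U_pos[of T] by (simp add: M_def)
  qed
  have \<alpha>: "((\<lambda>T. \<alpha> T / T) \<longlongrightarrow> 1) at_top" unfolding \<alpha>_def by real_asymp
  have VU: "((\<lambda>T. psum c T / (T * psum b T)) \<longlongrightarrow> \<beta> / (\<beta> + 1)) at_top"
    unfolding c_def by (rule psum_weighted_asymp[OF rv])
  have UV: "((\<lambda>T. T * psum b T / psum c T) \<longlongrightarrow> (\<beta> + 1) / \<beta>) at_top"
    using tendsto_inverse[OF VU] \<beta> by simp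
  \<comment> \<open>The mean weight is of order T times the partial sum of b and \<alpha> is of
    order T, so \<alpha>/M decays like the reciprocal of that partial sum, which tends to infinity.
    This quotient later drives Chebyshev's bound to 0.\<close>
  have "((\<lambda>T. (\<alpha> T / T) * (T * psum b T / psum c T) / J T * inverse (psum b T)) \<longlongrightarrow> 
      1 * ((\<beta> + 1) / \<beta>) / shape_integral (\<beta> + 1) 0 * 0) at_top"
    by (rule tendsto_mult[OF tendsto_divide[OF tendsto_mult[OF \<alpha> UV] J(1)] tendsto_inverse_0_at_top[OF U.U_at_top]])
       (use Jpos in simp)
  moreover have "eventually (\<lambda>T. (\<alpha> T / T) * (T * psum b T / psum c T) / J T * inverse (psum b T) = \<alpha> T / M T) at_top"
    using eventually_ge_at_top[of 1]
  proof eventually_elim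
    case (elim T)
    then show ?case using U.U_pos[of T] V.U_pos[of T] by (simp add: M_def)
  qed
  ultimately have \<alpha>M: "((\<lambda>T. \<alpha> T / M T) \<longlongrightarrow> 0) at_top" by (auto intro: Lim_transform_eventually)
  have \<alpha>0: "\<alpha> T \<ge> 0" if "T \<ge> 1" for T using that by (simp add: \<alpha>_def)
  show thesis
  proof (rule that[OF M \<alpha>M])
    fix t :: real assume t: "t > 0"
    have \<alpha>t: "((\<lambda>T. \<alpha> T / T * t) \<longlongrightarrow> t) at_top" using tendsto_mult_right[OF \<alpha>, of t] by simp
    have "((\<lambda>T. psum b (\<alpha> T / T * t * T) / psum b T) \<longlongrightarrow> t powr \<beta>) at_top"
      by (rule U.ratio_var[OF \<alpha>t t filterlim_ident])
    moreover have "eventually (\<lambda>T. psum b (\<alpha> T / T * t * T) / psum b T = psum b (\<alpha> T * t) / psum b T) at_top"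
      using eventually_ge_at_top[of 1] by eventually_elim simp
    ultimately have s: "((\<lambda>T. psum b (\<alpha> T * t) / psum b T) \<longlongrightarrow> t powr \<beta>) at_top"
      by (rule Lim_transform_eventually)
    obtain C0 where C0: "C0 \<ge> 0" 
      "\<And>T r. T \<ge> 1 \<Longrightarrow> r > 0 \<Longrightarrow> psum b (r * T) \<le> C0 * (r powr 0 + r powr (\<beta> + 1)) * psum b T"
      using U.potter_bound[of 0 "\<beta> + 1"] \<beta> by auto
    \<comment> \<open>Potter's bound for b offers only exponents below \<beta>, possibly all below
      1. The cutoff repairs this: for r < t/2 the difference of partial sums is not positive, and
      for r >= t/2 the constant r^0 is at most (4/t^2) r^2.\<close>
    define C where "C = C0 * max 1 (4 / t\<^sup>2)"
    have "eventually (\<lambda>T. \<alpha> T / T * t > t / 2) at_top" by (rule order_tendstoD[OF \<alpha>t]) (use t in auto)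
    then have dom: "eventually (\<lambda>T. \<forall>r>0. max 0 (psum b (r * T) - psum b (\<alpha> T * t)) \<le> C * (r powr 2 + r powr (\<beta> + 1)) * psum b T) at_top"
      using eventually_ge_at_top[of 1]
    proof eventually_elim
      case (elim T)
      show ?case
      proof (intro allI impI)
        fix r :: real assume r: "r > 0"
        have nn: "C * (r powr 2 + r powr (\<beta> + 1)) * psum b T \<ge> 0" 
          using C0 U.U_nonneg[of T] by (simp add: C_def)
        show "max 0 (psum b (r * T) - psum b (\<alpha> T * t)) \<le> C * (r powr 2 + r powr (\<beta> + 1)) * psum b T"
        proof (cases "r < t / 2")
          case True
          then have "r \<le> \<alpha> T / T * t" using elim by linarith
          then have "r * T \<le> \<alpha> T * t" using elim by (simp add: field_simps)
          then show ?thesis using U.U_mono nn by simp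
        next
          case False
          have "(t/2) powr 2 \<le> r powr 2" using False t by (intro powr_mono2) auto
          then have "1 \<le> 4 / t\<^sup>2 * r powr 2"
            using t r by (simp add: field_simps power2_eq_square powr_numeral)
          also have "\<dots> \<le> max 1 (4 / t\<^sup>2) * r powr 2" by (intro mult_right_mono) auto
          finally have 1: "r powr 0 \<le> max 1 (4 / t\<^sup>2) * r powr 2" using r by simp
          have 2: "1 * r powr (\<beta> + 1) \<le> max 1 (4 / t\<^sup>2) * r powr (\<beta> + 1)" by (intro mult_right_mono) auto
          have "psum b (r * T) \<le> C0 * (r powr 0 + r powr (\<beta> + 1)) * psum b T" using C0 elim r by blast
          also have "\<dots> \<le> C0 * (max 1 (4 / t\<^sup>2) * r powr 2 + max 1 (4 / t\<^sup>2) * r powr (\<beta> + 1)) * psum b T"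
            using 1 2 C0 U.U_nonneg[of T] by (intro mult_right_mono mult_left_mono) auto
          also have "\<dots> = C * (r powr 2 + r powr (\<beta> + 1)) * psum b T" by (simp add: C_def algebra_simps)
          finally show ?thesis using nn U.U_nonneg[of "\<alpha> T * t"] by simp
        qed
      qed
    qed
    obtain I where I: "(I \<longlongrightarrow> shape_integral \<beta> t) at_top"
      "eventually (\<lambda>T. I T \<ge> 0 \<and> (\<Sum>k. ennreal (if real k > \<alpha> T * t then b k * q (exp (- 1 / T) ^ k) else 0))
         = ennreal (psum b T * I T)) at_top"
      by (rule karamata[OF b rv _ s _ _ dom]) (use \<alpha>0 t \<beta> in auto)
    have "((\<lambda>T. (\<alpha> T / T) * (T * psum b T / psum c T) / J T * I T) \<longlongrightarrow> 
        1 * ((\<beta> + 1) / \<beta>) / shape_integral (\<beta> + 1) 0 * shape_integral \<beta> t) at_top"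
      by (rule tendsto_mult[OF tendsto_divide[OF tendsto_mult[OF \<alpha> UV] J(1)] I(1)]) (use Jpos in simp)
    moreover have "eventually (\<lambda>T. (\<alpha> T / T) * (T * psum b T / psum c T) / J T * I T = \<alpha> T * (psum b T * I T) / M T) at_top"
      using eventually_ge_at_top[of 1]
    proof eventually_elim
      case (elim T)
      then show ?case using V.U_pos[of T] by (simp add: M_def)
    qed
    ultimately have lim: "((\<lambda>T. \<alpha> T * (psum b T * I T) / M T) \<longlongrightarrow> 1 * ((\<beta> + 1) / \<beta>) / shape_integral (\<beta> + 1) 0 * shape_integral \<beta> t) at_top"
      by (rule Lim_transform_eventually)
    have eq: "1 * ((\<beta> + 1) / \<beta>) / shape_integral (\<beta> + 1) 0 * shape_integral \<beta> t = shape_integral \<beta> t / (\<beta> / (\<beta> + 1) * shape_integral (\<beta> + 1) 0)"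
      using \<beta> by (simp add: field_simps)
    show "\<exists>\<Phi>. eventually (\<lambda>T. \<Phi> T \<ge> 0 \<and> (\<Sum>k. ennreal (if real k > \<alpha> T * t then b k * q (exp (- 1 / T) ^ k) else 0)) = ennreal (\<Phi> T)) at_top \<and>
       ((\<lambda>T. \<alpha> T * \<Phi> T / M T) \<longlongrightarrow> shape_integral \<beta> t / (\<beta> / (\<beta> + 1) * shape_integral (\<beta> + 1) 0)) at_top"
    proof (intro exI[of _ "\<lambda>T. psum b T * I T"] conjI)
      show "eventually (\<lambda>T. psum b T * I T \<ge> 0 \<and> (\<Sum>k. ennreal (if real k > \<alpha> T * t then b k * q (exp (- 1 / T) ^ k) else 0)) = ennreal (psum b T * I T)) at_top"
        using I(2) by eventually_elim (use U.U_nonneg in auto)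
    qed (rule lim[unfolded eq])
  qed
qed

end

section \<open>Sums over partitions\<close>

definition pweight :: "(nat \<Rightarrow> nat \<Rightarrow> ennreal) \<Rightarrow> nat multiset \<Rightarrow> ennreal" where
  "pweight w p = (\<Prod>k\<in>set_mset p. w k (count p k))"

text \<open>An integral against counting measure with values in \<open>ennreal\<close>, so that sums
  over partitions can be rearranged before anything is known to converge.\<close>

definition partition_sum :: "(nat multiset \<Rightarrow> ennreal) \<Rightarrow> ennreal" where
  "partition_sum F = (\<integral>\<^sup>+p. F p \<partial>count_space partitions)"

definition partitions_without :: "nat \<Rightarrow> nat multiset set" where
  "partitions_without k = {p \<in> partitions. k \<notin># p}"

lemma partition_sum_cmult: "partition_sum (\<lambda>p. c * F p) = c * partition_sum F"
  by (simp add: partition_sum_def nn_integral_cmult)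

lemma partition_sum_add: "partition_sum (\<lambda>p. F p + G p) = partition_sum F + partition_sum G"
  by (simp add: partition_sum_def nn_integral_add)

lemma partition_sum_suminf: "partition_sum (\<lambda>p. \<Sum>i. F i p) = (\<Sum>i. partition_sum (F i))"
  by (simp add: partition_sum_def nn_integral_suminf)

lemma partition_sum_mono: "(\<And>p. p \<in> partitions \<Longrightarrow> F p \<le> G p) \<Longrightarrow> partition_sum F \<le> partition_sum G"
  unfolding partition_sum_def by (rule nn_integral_mono) simp

lemma partition_sum_cong: "(\<And>p. p \<in> partitions \<Longrightarrow> F p = G p) \<Longrightarrow> partition_sum F = partition_sum G"
  unfolding partition_sum_def by (rule nn_integral_cong) simp

text \<open>Sorts the partitions by the multiplicity of k: deleting all copies of k is inverse to
  adding j copies to a partition without k.\<close>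

lemma partition_sum_split:
  assumes "k \<ge> 1"
  shows "partition_sum F = (\<Sum>j. \<integral>\<^sup>+p. F (p + replicate_mset j k) \<partial>count_space (partitions_without k))"
proof -
  define B where "B j = {p \<in> partitions. count p k = j}" for j
  have "partition_sum F = (\<integral>\<^sup>+p. (\<Sum>j. F p * indicator (B j) p) \<partial>count_space partitions)"
    unfolding partition_sum_def
  proof (rule nn_integral_cong)
    fix p assume "p \<in> space (count_space partitions)"
    then have p: "p \<in> partitions" by simp
    have "(\<Sum>j. F p * indicator (B j) p) = (\<Sum>j\<in>{count p k}. F p * indicator (B j) p)"
      by (rule suminf_finite) (auto simp: B_def)
    also have "\<dots> = F p" using p by (simp add: B_def)
    finally show "F p = (\<Sum>j. F p * indicator (B j) p)" by (rule sym)
  qed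
  also have "\<dots> = (\<Sum>j. \<integral>\<^sup>+p. F p * indicator (B j) p \<partial>count_space partitions)"
    by (rule nn_integral_suminf) simp
  also have "\<dots> = (\<Sum>j. \<integral>\<^sup>+p. F (p + replicate_mset j k) \<partial>count_space (partitions_without k))"
  proof (rule suminf_cong)
    fix j
    have "(\<integral>\<^sup>+p. F p * indicator (B j) p \<partial>count_space partitions) = (\<integral>\<^sup>+p. F p * indicator (B j) p * indicator partitions p \<partial>count_space UNIV)"
      by (rule nn_integral_count_space_indicator) simp
    also have "\<dots> = (\<integral>\<^sup>+p. F p * indicator (B j) p \<partial>count_space UNIV)"
      by (rule nn_integral_cong) (auto simp: B_def indicator_def)
    also have "\<dots> = (\<integral>\<^sup>+p. F p \<partial>count_space (B j))"
      by (rule nn_integral_count_space_indicator[symmetric]) simp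
    also have "\<dots> = (\<integral>\<^sup>+p. F (p + replicate_mset j k) \<partial>count_space (partitions_without k))"
    proof (rule nn_integral_bij_count_space[symmetric])
      show "bij_betw (\<lambda>p. p + replicate_mset j k) (partitions_without k) (B j)"
      proof (rule bij_betwI[where g = "filter_mset (\<lambda>i. i \<noteq> k)"])
        show "(\<lambda>p. p + replicate_mset j k) \<in> partitions_without k \<rightarrow> B j"
          using assms by (auto simp: partitions_without_def B_def partitions_def not_in_iff)
        show "filter_mset (\<lambda>i. i \<noteq> k) \<in> B j \<rightarrow> partitions_without k"
          by (auto simp: partitions_without_def B_def partitions_def)
        show "filter_mset (\<lambda>i. i \<noteq> k) (p + replicate_mset j k) = p" if "p \<in> partitions_without k" for p
          using that by (auto simp: partitions_without_def multiset_eq_iff not_in_iff)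
        show "filter_mset (\<lambda>i. i \<noteq> k) p + replicate_mset j k = p" if "p \<in> B j" for p
          using that by (auto simp: B_def multiset_eq_iff)
      qed
    qed
    finally show "(\<integral>\<^sup>+p. F p * indicator (B j) p \<partial>count_space partitions) = (\<integral>\<^sup>+p. F (p + replicate_mset j k) \<partial>count_space (partitions_without k))" .
  qed
  finally show ?thesis .
qed

lemma pweight_add_replicate:
  assumes "k \<notin># p" "w k 0 = 1"
  shows "pweight w (p + replicate_mset j k) = w k j * pweight w p"
proof (cases "j = 0")
  case True then show ?thesis using assms by simp
next
  case False
  have "(\<Prod>i\<in>set_mset p. w i (count (p + replicate_mset j k) i)) = (\<Prod>i\<in>set_mset p. w i (count p i))"
    using assms by (intro prod.cong) auto
  moreover have "set_mset (p + replicate_mset j k) = insert k (set_mset p)" using False by auto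
  moreover have "count p k = 0" using assms by (simp add: not_in_iff)
  ultimately show ?thesis using assms by (simp add: pweight_def)
qed

text \<open>Adding j copies of k multiplies \<open>pweight\<close> by \<open>w k j\<close> and
  leaves the other parts alone, so the sum over j separates for arbitrary test functions
  \<open>u\<close> and \<open>v\<close>.\<close>

lemma partition_sum_pweight_split:
  assumes k: "k \<ge> 1" and w: "w k 0 = 1"
  shows "partition_sum (\<lambda>p. pweight w p * (u (count p k) * v (filter_mset (\<lambda>i. i \<noteq> k) p))) =
    (\<Sum>j. w k j * u j) * (\<integral>\<^sup>+p. pweight w p * v p \<partial>count_space (partitions_without k))"
proof -
  have "(\<integral>\<^sup>+p. pweight w (p + replicate_mset j k) * (u (count (p + replicate_mset j k) k) * v (filter_mset (\<lambda>i. i \<noteq> k) (p + replicate_mset j k))) \<partial>count_space (partitions_without k))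
     = (\<integral>\<^sup>+p. (w k j * u j) * (pweight w p * v p) \<partial>count_space (partitions_without k))" for j
  proof (rule nn_integral_cong)
    fix p assume "p \<in> space (count_space (partitions_without k))"
    then have k: "k \<notin># p" by (simp add: partitions_without_def)
    then have "filter_mset (\<lambda>i. i \<noteq> k) (p + replicate_mset j k) = p"
      by (auto simp: multiset_eq_iff not_in_iff)
    then show "pweight w (p + replicate_mset j k) * (u (count (p + replicate_mset j k) k) * v (filter_mset (\<lambda>i. i \<noteq> k) (p + replicate_mset j k))) = (w k j * u j) * (pweight w p * v p)"
      using k by (simp add: pweight_add_replicate[where w = w, OF k w] not_in_iff mult_ac)
  qed
  then show ?thesis
    by (subst partition_sum_split[OF k]) (simp add: nn_integral_cmult)
qed

text \<open>The number of parts equal to \<open>k\<close> is independent of the rest of the partition.\<close>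

lemma partition_sum_factor:
  assumes k: "k \<ge> 1" and w: "w k 0 = 1" and m: "(\<Sum>j. w k j * u j) = m * (\<Sum>j. w k j)"
  shows "partition_sum (\<lambda>p. pweight w p * (u (count p k) * v (filter_mset (\<lambda>i. i \<noteq> k) p))) =
    m * partition_sum (\<lambda>p. pweight w p * v (filter_mset (\<lambda>i. i \<noteq> k) p))"
  using partition_sum_pweight_split[where u = u and v = v, of k w] partition_sum_pweight_split[where u = "\<lambda>_. 1" and v = v, of k w] k w
  by (simp add: m mult.assoc)

lemma partition_sum_factor1:
  assumes k: "k \<ge> 1" and w: "w k 0 = 1" and m: "(\<Sum>j. w k j * u j) = m * (\<Sum>j. w k j)"
  shows "partition_sum (\<lambda>p. pweight w p * u (count p k)) = m * partition_sum (pweight w)"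
  using partition_sum_factor[where w = w and u = u and m = m and v = "\<lambda>_. 1", OF k w m] by simp

text \<open>\<open>tail_count\<close> as a series over all k, so that it can be exchanged with
  \<open>partition_sum\<close> term by term.\<close>

definition tail_sum :: "real \<Rightarrow> nat multiset \<Rightarrow> ennreal" where
  "tail_sum s p = (\<Sum>k. if real k > s then of_nat (count p k) else 0)"

lemma tail_sum_eq: "tail_sum s p = of_nat (tail_count p s)"
proof -
  have "tail_sum s p = (\<Sum>k\<in>{k. k \<in># p \<and> real k > s}. if real k > s then of_nat (count p k) else 0)"
    unfolding tail_sum_def by (rule suminf_finite) (auto simp: not_in_iff)
  then show ?thesis by (simp add: tail_count_def of_nat_sum)
qed

lemma partition_sum_tail_sum:
  assumes w: "\<And>k. k \<ge> 1 \<Longrightarrow> w k 0 = 1" and s: "s \<ge> 0"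
    and r: "\<And>k. real k > s \<Longrightarrow> (\<Sum>j. w k j * of_nat j) = r k * (\<Sum>j. w k j)"
  shows "partition_sum (\<lambda>p. pweight w p * tail_sum s p) = (\<Sum>k. if real k > s then r k else 0) * partition_sum (pweight w)"
proof -
  have "partition_sum (\<lambda>p. pweight w p * tail_sum s p) = (\<Sum>k. partition_sum (\<lambda>p. pweight w p * (if real k > s then of_nat (count p k) else 0)))"
    unfolding tail_sum_def ennreal_suminf_cmult[symmetric] by (rule partition_sum_suminf)
  also have "\<dots> = (\<Sum>k. (if real k > s then r k else 0) * partition_sum (pweight w))"
  proof (rule suminf_cong)
    fix k
    show "partition_sum (\<lambda>p. pweight w p * (if real k > s then of_nat (count p k) else 0)) = (if real k > s then r k else 0) * partition_sum (pweight w)"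
    proof (cases "real k > s")
      case True
      then have "k \<ge> 1" using s by simp
      from partition_sum_factor1[where w = w and u = of_nat, OF this w[OF this] r[OF True]] True show ?thesis by simp
    qed (simp add: partition_sum_def)
  qed
  finally show ?thesis by simp
qed

text \<open>Let S be the sum of the independent counts X_k. Then E S^2 is the sum over k of E (X_k
  S), and S = X_k + S' with S' independent of X_k. From E X_k^2 <= r_k^2 + C r_k one gets E (X_k S)
  <= r_k (r_k + E S') + C r_k = r_k E S + C r_k. This avoids both a double sum over pairs and
  subtraction in \<open>ennreal\<close>.\<close>

lemma partition_sum_tail_sum_square:
  assumes w: "\<And>k. k \<ge> 1 \<Longrightarrow> w k 0 = 1" and s: "s \<ge> 0"
    and r: "\<And>k. real k > s \<Longrightarrow> (\<Sum>j. w k j * of_nat j) = r k * (\<Sum>j. w k j)"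
    and m: "\<And>k. real k > s \<Longrightarrow> (\<Sum>j. w k j * (of_nat j)\<^sup>2) = m k * (\<Sum>j. w k j)"
    and mr: "\<And>k. real k > s \<Longrightarrow> m k \<le> (r k)\<^sup>2 + C * r k"
    and rfin: "\<And>k. r k < top" and Zfin: "partition_sum (pweight w) < top"
  defines "R \<equiv> \<Sum>k. if real k > s then r k else 0"
  shows "partition_sum (\<lambda>p. pweight w p * (tail_sum s p)\<^sup>2) \<le> (R\<^sup>2 + C * R) * partition_sum (pweight w)"
proof -
  let ?Z = "partition_sum (pweight w)"
  define E1 where "E1 = partition_sum (\<lambda>p. pweight w p * tail_sum s p)"
  have E1: "E1 = R * ?Z" unfolding E1_def R_def by (rule partition_sum_tail_sum[OF w s r])
  have step: "partition_sum (\<lambda>p. pweight w p * (of_nat (count p k) * tail_sum s p)) \<le> r k * E1 + C * r k * ?Z" if k: "real k > s" for k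
  proof -
    have k1: "k \<ge> 1" using k s by simp
    note w = w[OF k1]
    have split: "tail_sum s p = of_nat (count p k) + tail_sum s (filter_mset (\<lambda>i. i \<noteq> k) p)" for p
    proof -
      have "tail_count p s = count p k + tail_count (filter_mset (\<lambda>i. i \<noteq> k) p) s"
      proof (cases "k \<in># p")
        case True
        have "{i. i \<in># p \<and> real i > s} = insert k {i. i \<in># filter_mset (\<lambda>i. i \<noteq> k) p \<and> real i > s}"
          using True k by auto
        then show ?thesis by (auto simp: tail_count_def intro!: sum.cong)
      next
        case False
        then have "filter_mset (\<lambda>i. i \<noteq> k) p = p" by (auto simp: multiset_eq_iff not_in_iff)
        then show ?thesis using False by (simp add: not_in_iff)
      qed
      then show ?thesis by (simp add: tail_sum_eq)
    qed
    define I where "I = partition_sum (\<lambda>p. pweight w p * tail_sum s (filter_mset (\<lambda>i. i \<noteq> k) p))"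
    have "partition_sum (\<lambda>p. pweight w p * (of_nat (count p k) * tail_sum s p)) = 
      partition_sum (\<lambda>p. pweight w p * (of_nat (count p k))\<^sup>2 + pweight w p * (of_nat (count p k) * tail_sum s (filter_mset (\<lambda>i. i \<noteq> k) p)))"
      by (rule partition_sum_cong, subst split) (simp add: power2_eq_square ring_distribs)
    also have "\<dots> = m k * ?Z + r k * I"
      unfolding partition_sum_add I_def
      using partition_sum_factor1[where w = w and u = "\<lambda>j. (of_nat j)\<^sup>2", OF k1 w m[OF k]]
        partition_sum_factor[where w = w and u = of_nat and v = "tail_sum s", OF k1 w r[OF k]] by simp
    finally have 1: "partition_sum (\<lambda>p. pweight w p * (of_nat (count p k) * tail_sum s p)) = m k * ?Z + r k * I" .
    have "E1 = partition_sum (\<lambda>p. pweight w p * of_nat (count p k) + pweight w p * tail_sum s (filter_mset (\<lambda>i. i \<noteq> k) p))"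
      unfolding E1_def by (rule partition_sum_cong, subst split) (simp add: ring_distribs)
    also have "\<dots> = r k * ?Z + I"
      unfolding partition_sum_add I_def
      using partition_sum_factor1[where w = w and u = of_nat, OF k1 w r[OF k]] by simp
    finally have 2: "E1 = r k * ?Z + I" .
    have "m k * ?Z + r k * I \<le> ((r k)\<^sup>2 + C * r k) * ?Z + r k * I"
      using mr[OF k] by (intro add_right_mono mult_right_mono) auto
    also have "\<dots> = r k * E1 + C * r k * ?Z"
      unfolding 2 by (simp add: power2_eq_square ring_distribs mult_ac add_ac)
    finally show ?thesis unfolding 1 .
  qed
  have "partition_sum (\<lambda>p. pweight w p * (tail_sum s p)\<^sup>2) = 
     partition_sum (\<lambda>p. \<Sum>k. pweight w p * ((if real k > s then of_nat (count p k) else 0) * tail_sum s p))"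
  proof (rule partition_sum_cong)
    fix p
    have "tail_sum s p * tail_sum s p = (\<Sum>k. (if real k > s then of_nat (count p k) else 0) * tail_sum s p)"
      unfolding ennreal_suminf_multc by (simp only: tail_sum_def)
    then show "pweight w p * (tail_sum s p)\<^sup>2 = (\<Sum>k. pweight w p * ((if real k > s then of_nat (count p k) else 0) * tail_sum s p))"
      by (simp only: power2_eq_square ennreal_suminf_cmult)
  qed
  also have "\<dots> = (\<Sum>k. partition_sum (\<lambda>p. pweight w p * ((if real k > s then of_nat (count p k) else 0) * tail_sum s p)))"
    by (rule partition_sum_suminf)
  also have "\<dots> \<le> (\<Sum>k. (if real k > s then r k else 0) * (E1 + C * ?Z))"
  proof (rule suminf_le)
    fix k
    show "partition_sum (\<lambda>p. pweight w p * ((if real k > s then of_nat (count p k) else 0) * tail_sum s p)) \<le> (if real k > s then r k else 0) * (E1 + C * ?Z)"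
      using step[of k] by (cases "real k > s") (auto simp: partition_sum_def ring_distribs mult_ac)
  qed auto
  also have "\<dots> = R * (E1 + C * ?Z)" by (simp add: R_def)
  also have "\<dots> = (R\<^sup>2 + C * R) * ?Z" by (simp add: E1 power2_eq_square ring_distribs mult_ac)
  finally show ?thesis .
qed

text \<open>The Euler product: expanding the first n factors gives exactly the partitions with all
  parts at most n, and monotone convergence exhausts the rest.\<close>

lemma partition_sum_total:
  assumes w: "\<And>k. k \<ge> 1 \<Longrightarrow> w k 0 = 1"
  shows "(\<lambda>n. \<Prod>k=1..n. \<Sum>j. w k j) \<longlonglongrightarrow> partition_sum (pweight w)"
proof -
  define G where "G n p = pweight w p * indicator {p. set_mset p \<subseteq> {..n}} p" for n p
  have Gn: "partition_sum (G n) = (\<Prod>k=1..n. \<Sum>j. w k j)" for n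
  proof (induction n)
    case 0
    have "partition_sum (G 0) = (\<integral>\<^sup>+p. indicator {{#}} p \<partial>count_space partitions)"
      unfolding partition_sum_def
    proof (rule nn_integral_cong)
      fix p assume "p \<in> space (count_space partitions)"
      then have "set_mset p \<subseteq> {..0} \<longleftrightarrow> p = {#}" by (auto simp: partitions_def)
      then show "G 0 p = indicator {{#}} p" by (auto simp: G_def indicator_def pweight_def)
    qed
    also have "\<dots> = emeasure (count_space partitions) {{#}}"
      by (rule nn_integral_indicator) (simp add: partitions_def)
    also have "\<dots> = 1" by (subst emeasure_count_space) (auto simp: partitions_def)
    finally show ?case by simp
  next
    case (Suc n)
    let ?k = "Suc n"
    \<comment> \<open>One formula for both bounds: under the bound n only multiplicity 0 of the part
      \<open>Suc n\<close> survives, under the bound \<open>Suc n\<close> all multiplicities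
      do.\<close>
    have sp: "partition_sum (G m) = (\<Sum>j. if j = 0 \<or> m = ?k then w ?k j * (\<integral>\<^sup>+p. G n p \<partial>count_space (partitions_without ?k)) else 0)" 
      if m: "m = n \<or> m = ?k" for m
    proof -
      have "(\<integral>\<^sup>+p. G m (p + replicate_mset j ?k) \<partial>count_space (partitions_without ?k)) = 
        (if j = 0 \<or> m = ?k then w ?k j * (\<integral>\<^sup>+p. G n p \<partial>count_space (partitions_without ?k)) else 0)" for j
      proof -
        have "G m (p + replicate_mset j ?k) = (if j = 0 \<or> m = ?k then w ?k j * G n p else 0)" if "p \<in> partitions_without ?k" for p
        proof -
          have k: "?k \<notin># p" using that by (simp add: partitions_without_def)
          have "set_mset p \<subseteq> {..?k} \<longleftrightarrow> set_mset p \<subseteq> {..n}"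
          proof
            assume "set_mset p \<subseteq> {..?k}"
            then show "set_mset p \<subseteq> {..n}" using k by (auto simp: le_Suc_eq dest!: subsetD)
          qed auto
          then have "set_mset (p + replicate_mset j ?k) \<subseteq> {..m} \<longleftrightarrow> (j = 0 \<or> m = ?k) \<and> set_mset p \<subseteq> {..n}"
            using m by (auto split: if_splits)
          then show ?thesis using pweight_add_replicate[where w = w and j = j, OF k] w[of ?k]
            by (auto simp: G_def indicator_def)
        qed
        then have "(\<integral>\<^sup>+p. G m (p + replicate_mset j ?k) \<partial>count_space (partitions_without ?k)) = 
          (\<integral>\<^sup>+p. (if j = 0 \<or> m = ?k then w ?k j * G n p else 0) \<partial>count_space (partitions_without ?k))"
          by (intro nn_integral_cong) simp
        then show ?thesis by (simp add: nn_integral_cmult)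
      qed
      then show ?thesis by (subst partition_sum_split[of ?k]) auto
    qed
    have "partition_sum (G n) = (\<Sum>j\<in>{0}. w ?k j * (\<integral>\<^sup>+p. G n p \<partial>count_space (partitions_without ?k)))"
      by (subst sp, simp, subst suminf_finite[of "{0}"]) auto
    then have "partition_sum (G n) = (\<integral>\<^sup>+p. G n p \<partial>count_space (partitions_without ?k))" using w[of ?k] by simp
    moreover have "partition_sum (G ?k) = (\<Sum>j. w ?k j) * (\<integral>\<^sup>+p. G n p \<partial>count_space (partitions_without ?k))"
      by (subst sp) auto
    ultimately show ?case using Suc by (simp add: mult.commute)
  qed
  have inc: "incseq G"
    by (auto simp: incseq_def le_fun_def G_def indicator_def)
  have sup: "(SUP n. G n p) = pweight w p" for p
  proof (rule antisym)
    show "(SUP n. G n p) \<le> pweight w p" by (rule SUP_least) (auto simp: G_def indicator_def)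
    have "set_mset p \<subseteq> {..Max (insert 0 (set_mset p))}" by auto
    then have "pweight w p = G (Max (insert 0 (set_mset p))) p" by (simp add: G_def)
    then show "pweight w p \<le> (SUP n. G n p)" by (metis SUP_upper UNIV_I)
  qed
  have "partition_sum (pweight w) = (SUP n. partition_sum (G n))"
    unfolding partition_sum_def sup[symmetric] by (rule nn_integral_monotone_convergence_SUP[OF inc]) simp
  moreover have "incseq (\<lambda>n. partition_sum (G n))"
    using inc by (auto simp: incseq_def le_fun_def intro!: partition_sum_mono)
  ultimately show ?thesis using LIMSEQ_SUP[of "\<lambda>n. partition_sum (G n)"] by (simp add: Gn)
qed

section \<open>The grand canonical measures\<close>

text \<open>\<open>has_prod\<close> tolerates finitely many zero factors by starting the product
  later; here every factor has constant term 1, so the plain partial products converge.\<close>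

lemma gen_fun_tendsto:
  fixes f :: "real fps"
  assumes f0: "fps_nth f 0 = 1"
  shows "(\<lambda>n. \<Prod>k\<le>n. fps_rpow f (b (Suc k)) oo fps_X ^ Suc k) \<longlonglongrightarrow> gen_fun f b"
proof -
  let ?A = "\<lambda>k. fps_rpow f (b (Suc k)) oo fps_X ^ Suc k"
  have "fps_nth (?A k) 0 = 1" for k using f0 by (simp add: fps_nth_compose_X_power)
  then have "?A k \<noteq> 0" for k by (metis fps_zero_nth zero_neq_one)
  with has_prod_gen_fun[OF f0, of b] have "raw_has_prod ?A 0 (gen_fun f b)" by (auto simp: has_prod_def)
  then show ?thesis by (simp add: raw_has_prod_def)
qed

text \<open>Shared by both cases of the theorem. The last two conditions locate the singularity of
  the sum of b_k x^k at 1, which is what the radius of F depends on besides f.\<close>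

locale multiplicative = pgf +
  fixes b :: "nat \<Rightarrow> real"
  assumes b_nonneg: "\<And>k. k \<ge> 1 \<Longrightarrow> b k \<ge> 0"
    and g_nonneg: "\<And>k j. k \<ge> 1 \<Longrightarrow> fps_nth (fps_rpow f (b k)) j \<ge> 0"
    and b1: "b 1 = 1"
    and b_summable: "\<And>x. 0 < x \<Longrightarrow> x < 1 \<Longrightarrow> summable (\<lambda>k. b k * x ^ k)"
    and b_not_summable: "\<not> summable b"
begin

abbreviation g :: "nat \<Rightarrow> real fps" where "g k \<equiv> fps_rpow f (b k)"

text \<open>The index is shifted as in \<open>gen_fun\<close>: \<open>factor k\<close> belongs to
  the part \<open>Suc k\<close>, so \<open>partial_prod n\<close> covers the parts 1 to
  \<open>Suc n\<close>.\<close>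

definition factor :: "nat \<Rightarrow> real fps" where "factor k = g (Suc k) oo fps_X ^ Suc k"

definition partial_prod :: "nat \<Rightarrow> real fps" where "partial_prod n = (\<Prod>k\<le>n. factor k)"

abbreviation F :: "real fps" where "F \<equiv> gen_fun f b"

lemma factor_nth: "fps_nth (factor k) n = (if Suc k dvd n then fps_nth (g (Suc k)) (n div Suc k) else 0)"
  unfolding factor_def by (rule fps_nth_compose_X_power)

lemma factor_nonneg: "fps_nth (factor k) n \<ge> 0"
  using g_nonneg[of "Suc k"] by (simp add: factor_nth)

lemma factor_nth_0: "fps_nth (factor k) 0 = 1"
  by (simp add: factor_nth f0)

lemma partial_prod_Suc: "partial_prod (Suc n) = partial_prod n * factor (Suc n)"
  by (simp add: partial_prod_def)

lemma partial_prod_nth_0: "fps_nth (partial_prod n) 0 = 1"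
  by (induction n) (simp_all add: partial_prod_Suc factor_nth_0, simp add: partial_prod_def factor_nth_0)

lemma partial_prod_nonneg: "fps_nth (partial_prod n) j \<ge> 0"
proof (induction n arbitrary: j)
  case 0 show ?case by (simp add: partial_prod_def factor_nonneg)
next
  case (Suc n)
  then show ?case by (auto simp: partial_prod_Suc fps_mult_nth intro!: sum_nonneg mult_nonneg_nonneg factor_nonneg)
qed

text \<open>Multiplying by a series with constant term 1 and nonnegative coefficients can only
  enlarge nonnegative coefficients. Every comparison with F below rests on this.\<close>

lemma partial_prod_nth_mono: "m \<le> n \<Longrightarrow> fps_nth (partial_prod m) j \<le> fps_nth (partial_prod n) j"
proof (induction n rule: dec_induct)
  case (step n)
  have "fps_nth (partial_prod n) j * fps_nth (factor (Suc n)) (j - j) 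
      \<le> (\<Sum>i=0..j. fps_nth (partial_prod n) i * fps_nth (factor (Suc n)) (j - i))"
    by (rule member_le_sum) (auto intro!: mult_nonneg_nonneg partial_prod_nonneg factor_nonneg)
  with step show ?case by (simp add: partial_prod_Suc fps_mult_nth factor_nth_0)
qed simp

lemma factor_le_partial_prod: "k \<le> n \<Longrightarrow> fps_nth (factor k) j \<le> fps_nth (partial_prod n) j"
proof (induction n rule: dec_induct)
  case base
  show ?case
  proof (cases k)
    case 0 then show ?thesis by (simp add: partial_prod_def)
  next
    case (Suc m)
    have "fps_nth (partial_prod m) 0 * fps_nth (factor k) (j - 0) 
        \<le> (\<Sum>i=0..j. fps_nth (partial_prod m) i * fps_nth (factor k) (j - i))"
      by (rule member_le_sum) (auto intro!: mult_nonneg_nonneg partial_prod_nonneg factor_nonneg)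
    then show ?thesis by (simp add: Suc partial_prod_Suc fps_mult_nth partial_prod_nth_0)
  qed
next
  case (step n)
  then show ?case using partial_prod_nth_mono[of n "Suc n" j] by simp
qed

lemma partial_prod_tendsto: "partial_prod \<longlonglongrightarrow> F"
  unfolding partial_prod_def[abs_def] factor_def[abs_def] by (rule gen_fun_tendsto[OF f0])

lemma partial_prod_nth_eventually: "eventually (\<lambda>n. fps_nth (partial_prod n) j = fps_nth F j) sequentially"
  using partial_prod_tendsto by (simp add: tendsto_fps_iff)

lemma partial_prod_nth_le: "fps_nth (partial_prod n) j \<le> fps_nth F j"
proof -
  obtain N where "\<And>m. m \<ge> N \<Longrightarrow> fps_nth (partial_prod m) j = fps_nth F j"
    using partial_prod_nth_eventually[of j] by (auto simp: eventually_sequentially)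
  then show ?thesis using partial_prod_nth_mono[of n "max n N" j] by simp
qed

lemma factor_nth_le: "fps_nth (factor k) j \<le> fps_nth F j"
  using factor_le_partial_prod[of k k j] partial_prod_nth_le[of k j] by simp

lemma F_nonneg: "fps_nth F j \<ge> 0"
  using factor_nonneg[of 0 j] factor_nth_le[of 0 j] by simp

lemma power_in_radius: "0 \<le> x \<Longrightarrow> x < 1 \<Longrightarrow> ereal x < fps_conv_radius f \<Longrightarrow> k \<ge> 1 \<Longrightarrow> ereal (x ^ k) < fps_conv_radius f"
  using power_decreasing[of 1 k x] by (intro radius_mono[of "x ^ k" x]) auto

lemma factor_sums:
  assumes "0 \<le> x" "x < 1" "ereal x < fps_conv_radius f"
  shows "(\<lambda>j. fps_nth (factor k) j * x ^ j) sums eval_fps (g (Suc k)) (x ^ Suc k)"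
proof -
  have "(\<lambda>j. fps_nth (g (Suc k)) j * (x ^ Suc k) ^ j) sums eval_fps (g (Suc k)) (x ^ Suc k)"
    using assms power_in_radius[of x "Suc k"] by (intro rpow_moments(1) b_nonneg g_nonneg) auto
  then have "(\<lambda>j. fps_nth (factor k) (Suc k * j) * x ^ (Suc k * j)) sums eval_fps (g (Suc k)) (x ^ Suc k)"
    by (simp add: factor_nth power_mult del: power_Suc mult_Suc)
  then show ?thesis
    by (subst (asm) sums_mono_reindex[of "\<lambda>j. Suc k * j" "\<lambda>j. fps_nth (factor k) j * x ^ j"])
       (auto simp: strict_mono_def factor_nth dvd_def simp del: mult_Suc)
qed

lemma factor_radius:
  assumes "0 \<le> x" "x < 1" "ereal x < fps_conv_radius f"
  shows "ereal x < fps_conv_radius (factor k)"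
proof -
  obtain y where y: "ereal x < ereal y" "ereal y < min 1 (fps_conv_radius f)"
    using ereal_dense2[of "ereal x" "min 1 (fps_conv_radius f)"] assms by auto
  then have "y > x" "y < 1" "0 \<le> y" "ereal y < fps_conv_radius f" using assms by (auto simp: one_ereal_def)
  then have "summable (\<lambda>j. fps_nth (factor k) j * y ^ j)" using factor_sums[of y k] by (auto simp: sums_iff)
  then have "ereal (norm y) \<le> fps_conv_radius (factor k)"
    unfolding fps_conv_radius_def by (rule conv_radius_geI)
  then have "ereal y \<le> fps_conv_radius (factor k)" using \<open>0 \<le> y\<close> by simp
  with y(1) show ?thesis by (rule less_le_trans)
qed

lemma partial_prod_radius:
  assumes "0 \<le> x" "x < 1" "ereal x < fps_conv_radius f"
  shows "ereal x < fps_conv_radius (partial_prod n)"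
proof (induction n)
  case 0 then show ?case using factor_radius[OF assms, of 0] by (simp add: partial_prod_def)
next
  case (Suc n)
  show ?case unfolding partial_prod_Suc
    by (rule less_le_trans[OF _ fps_conv_radius_mult]) (use Suc factor_radius[OF assms] in simp)
qed

lemma eval_partial_prod:
  assumes "0 \<le> x" "x < 1" "ereal x < fps_conv_radius f"
  shows "eval_fps (partial_prod n) x = (\<Prod>k=1..Suc n. eval_fps (g k) (x ^ k))"
proof -
  have e: "eval_fps (factor k) x = eval_fps (g (Suc k)) (x ^ Suc k)" for k
    using factor_sums[OF assms, of k] by (simp add: eval_fps_def sums_iff)
  have "eval_fps (partial_prod n) x = (\<Prod>k\<le>n. eval_fps (factor k) x)"
  proof (induction n)
    case 0 then show ?case by (simp add: partial_prod_def)
  next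
    case (Suc n)
    then show ?case using assms factor_radius[OF assms, of "Suc n"] partial_prod_radius[OF assms, of n]
      by (simp add: partial_prod_Suc eval_fps_mult)
  qed
  also have "\<dots> = (\<Prod>k=1..Suc n. eval_fps (g k) (x ^ k))"
    unfolding e by (rule prod.reindex_bij_witness[of _ "\<lambda>k. k - 1" Suc]) auto
  finally show ?thesis .
qed

text \<open>The point is that the bound does not depend on n: the exponential bounds on the factors
  multiply to the exponential of a partial sum of b_k x^k.\<close>

lemma eval_partial_prod_le:
  assumes "0 < x" "x < 1" "ereal x < fps_conv_radius f"
  shows "eval_fps (partial_prod n) x \<le> exp (E1 x * (\<Sum>k. b k * x ^ k) + \<bar>E1 x * b 0\<bar>)"
proof -
  have x0: "0 \<le> x" using assms by simp
  have E1: "E1 x \<ge> 0" using E1_ge[of x] f1 assms by simp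
  have "eval_fps (partial_prod n) x \<le> (\<Prod>k=1..Suc n. exp (b k * E1 x * x ^ k))"
    unfolding eval_partial_prod[OF x0 assms(2,3)]
  proof (rule prod_mono)
    fix k assume k: "k \<in> {1..Suc n}"
    then have k1: "k \<ge> 1" by simp
    have le: "x ^ k \<le> x" using power_decreasing[of 1 k x] k1 assms by simp
    have "eval_fps (g k) (x ^ k) \<ge> 1"
      by (rule rpow_moments(4)[OF b_nonneg g_nonneg _ power_in_radius]) (use k1 assms in auto)
    moreover have "eval_fps (g k) (x ^ k) \<le> exp (b k * E1 x * x ^ k)"
      by (rule rpow_eval_le[OF b_nonneg g_nonneg _ le]) (use k1 assms in auto)
    ultimately show "0 \<le> eval_fps (g k) (x ^ k) \<and> eval_fps (g k) (x ^ k) \<le> exp (b k * E1 x * x ^ k)" by simp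
  qed
  also have "\<dots> = exp (E1 x * (\<Sum>k=1..Suc n. b k * x ^ k))"
    by (simp only: exp_sum[symmetric, OF finite_atLeastAtMost] sum_distrib_left mult_ac)
  also have "\<dots> \<le> exp (E1 x * (\<Sum>k. b k * x ^ k) + \<bar>E1 x * b 0\<bar>)"
  proof -
    have s: "summable (\<lambda>k. b k * x ^ k)" using assms by (intro b_summable)
    then have s1: "summable (\<lambda>k. b (Suc k) * x ^ Suc k)" by (subst summable_Suc_iff)
    have "(\<Sum>k=1..Suc n. b k * x ^ k) = (\<Sum>k<Suc n. b (Suc k) * x ^ Suc k)"
      by (rule sum.reindex_bij_witness[of _ Suc "\<lambda>k. k - 1"]) auto
    also have "\<dots> \<le> (\<Sum>k. b (Suc k) * x ^ Suc k)"
      using b_nonneg assms by (intro sum_le_suminf[OF s1]) auto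
    \<comment> \<open>The full series contains the term \<open>b 0\<close>, which may have either
      sign; this is why the bound carries an extra absolute value.\<close>
    also have "\<dots> = (\<Sum>k. b k * x ^ k) - b 0" using suminf_split_head[OF s] by simp
    finally have "E1 x * (\<Sum>k=1..Suc n. b k * x ^ k) \<le> E1 x * ((\<Sum>k. b k * x ^ k) - b 0)"
      using E1 by (rule mult_left_mono)
    also have "\<dots> \<le> E1 x * (\<Sum>k. b k * x ^ k) + \<bar>E1 x * b 0\<bar>"
      by (simp add: right_diff_distrib)
    finally show ?thesis by simp
  qed
  finally show ?thesis .
qed

lemma F_partial_sum_le:
  assumes x: "0 < x" "x < 1" "ereal x < fps_conv_radius f"
  shows "eventually (\<lambda>n. (\<Sum>j<N. fps_nth F j * x ^ j) \<le> eval_fps (partial_prod n) x) sequentially"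
proof -
  have "eventually (\<lambda>n. \<forall>j\<in>{..<N}. fps_nth (partial_prod n) j = fps_nth F j) sequentially"
    by (rule eventually_ball_finite) (use partial_prod_nth_eventually in auto)
  then show ?thesis
  proof eventually_elim
    case (elim n)
    have "summable (\<lambda>j. fps_nth (partial_prod n) j * x ^ j)"
      using partial_prod_radius[of x n] x by (intro summable_fps) auto
    then have "(\<Sum>j<N. fps_nth (partial_prod n) j * x ^ j) \<le> eval_fps (partial_prod n) x"
      unfolding eval_fps_def using partial_prod_nonneg x by (intro sum_le_suminf) auto
    then show ?case using elim by simp
  qed
qed

lemma F_summable:
  assumes x: "0 < x" "x < 1" "ereal x < fps_conv_radius f"
  shows "summable (\<lambda>j. fps_nth F j * x ^ j)"
proof (rule summableI_nonneg_bounded)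
  show "0 \<le> fps_nth F j * x ^ j" for j using F_nonneg x by simp
  fix N
  obtain n where "(\<Sum>j<N. fps_nth F j * x ^ j) \<le> eval_fps (partial_prod n) x"
    using F_partial_sum_le[OF x, of N] by (auto simp: eventually_sequentially)
  also have "\<dots> \<le> exp (E1 x * (\<Sum>k. b k * x ^ k) + \<bar>E1 x * b 0\<bar>)" by (rule eval_partial_prod_le[OF x])
  finally show "(\<Sum>j<N. fps_nth F j * x ^ j) \<le> exp (E1 x * (\<Sum>k. b k * x ^ k) + \<bar>E1 x * b 0\<bar>)" .
qed

text \<open>F dominates each of its factors coefficientwise. The part k used once contributes b_k
  f_1 to the coefficient of x^k, so the series of F at 1 diverges with the sum of b_k; the factor of
  the part 1 is f itself because b_1 = 1. Conversely \<open>F_summable\<close> gives convergence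
  below both radii.\<close>

lemma radius_F: "fps_conv_radius F = min 1 (fps_conv_radius f)"
proof (rule antisym)
  show "min 1 (fps_conv_radius f) \<le> fps_conv_radius F"
    unfolding fps_conv_radius_def[of F]
  proof (rule conv_radius_geI_ex)
    fix r :: real assume "0 < r" "ereal r < min 1 (fps_conv_radius f)"
    then show "\<exists>z. norm z = r \<and> summable (\<lambda>n. fps_nth F n * z ^ n)"
      using F_summable[of r] by (intro exI[of _ r]) (auto simp: one_ereal_def)
  qed
  have "fps_conv_radius F \<le> 1"
  proof (rule ccontr)
    assume "\<not> fps_conv_radius F \<le> 1"
    then have "summable (\<lambda>j. fps_nth F j * 1 ^ j)" by (intro summable_fps) (auto simp: one_ereal_def not_le)
    then have "summable (\<lambda>j. fps_nth F (Suc j))" by (subst summable_Suc_iff) simp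
    then have "summable (\<lambda>j. b (Suc j) * fps_nth f 1)"
    proof (rule summable_comparison_test'[of _ 0])
      fix j :: nat
      have "b (Suc j) * fps_nth f 1 = fps_nth (factor j) (Suc j)"
        using fps_rpow_nth_1[OF f0, of "b (Suc j)"] by (simp add: factor_nth)
      then show "norm (b (Suc j) * fps_nth f 1) \<le> fps_nth F (Suc j)"
        using factor_nth_le[of j "Suc j"] b_nonneg[of "Suc j"] f1 factor_nonneg[of j "Suc j"] by simp
    qed
    from summable_mult2[OF this, of "inverse (fps_nth f 1)"]
    have "summable (\<lambda>j. b (Suc j))" using f1 by (simp add: mult.assoc)
    then show False using b_not_summable by (simp add: summable_Suc_iff)
  qed
  moreover have "fps_conv_radius F \<le> fps_conv_radius f"
    unfolding fps_conv_radius_def[of f]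
  proof (rule conv_radius_geI_ex)
    fix r :: real assume r: "0 < r" "ereal r < fps_conv_radius F"
    have "summable (\<lambda>n. fps_nth F n * r ^ n)" using r by (intro summable_fps) auto
    then have "summable (\<lambda>n. fps_nth f n * r ^ n)"
    proof (rule summable_comparison_test'[of _ 0])
      fix n :: nat
      have "g (Suc 0) = f" using b1 fps_rpow_1[OF f0] by simp
      then have "fps_nth f n = fps_nth (factor 0) n" by (simp add: factor_nth)
      then show "norm (fps_nth f n * r ^ n) \<le> fps_nth F n * r ^ n"
        using factor_nth_le[of 0 n] nonneg[of n] r by (auto intro!: mult_right_mono)
    qed
    then show "\<exists>z. norm z = r \<and> summable (\<lambda>n. fps_nth f n * z ^ n)" using r by (intro exI[of _ r]) auto
  qed
  ultimately show "fps_conv_radius F \<le> min 1 (fps_conv_radius f)" by simp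
qed

text \<open>Convergence of the partial products is only coefficientwise. Values converge because the
  coefficients increase to those of F: this bounds the values from above, and finitely many settled
  coefficients bound them from below.\<close>

lemma eval_F_limit:
  assumes x: "0 < x" "x < 1" "ereal x < fps_conv_radius f"
  shows "(\<lambda>n. eval_fps (partial_prod n) x) \<longlonglongrightarrow> eval_fps F x"
proof (rule order_tendstoI)
  fix a assume a: "a < eval_fps F x"
  have "(\<lambda>N. \<Sum>j<N. fps_nth F j * x ^ j) \<longlonglongrightarrow> eval_fps F x"
    unfolding eval_fps_def by (rule summable_LIMSEQ[OF F_summable[OF x]])
  then have "eventually (\<lambda>N. a < (\<Sum>j<N. fps_nth F j * x ^ j)) sequentially" by (rule order_tendstoD) (rule a)
  then obtain N where "a < (\<Sum>j<N. fps_nth F j * x ^ j)" by (auto simp: eventually_sequentially)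
  with F_partial_sum_le[OF x, of N] show "eventually (\<lambda>n. a < eval_fps (partial_prod n) x) sequentially"
    by (auto elim: eventually_mono)
next
  fix a assume a: "eval_fps F x < a"
  have "eval_fps (partial_prod n) x \<le> eval_fps F x" for n
    unfolding eval_fps_def
    using partial_prod_radius[of x n] x partial_prod_nth_le
    by (intro suminf_le F_summable mult_right_mono summable_fps) auto
  then show "eventually (\<lambda>n. eval_fps (partial_prod n) x < a) sequentially"
    using a by (intro always_eventually) (auto intro: le_less_trans)
qed

lemma eval_F_ge_1:
  assumes x: "0 < x" "x < 1" "ereal x < fps_conv_radius f"
  shows "eval_fps F x \<ge> 1"
proof -
  have "ereal x < fps_conv_radius F" using x by (simp add: radius_F one_ereal_def)
  then have "fps_nth F 0 * x ^ 0 \<le> eval_fps F x" using x by (intro eval_fps_ge_nth F_nonneg) auto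
  moreover have "fps_nth F 0 \<ge> 1" using factor_nth_le[of 0 0] by (simp add: factor_nth_0)
  ultimately show ?thesis by simp
qed

section \<open>Normalisation and moments of the measures\<close>

definition w :: "real \<Rightarrow> nat \<Rightarrow> nat \<Rightarrow> ennreal" where
  "w x k j = ennreal (fps_nth (g k) j * (x ^ k) ^ j)"

lemma w_0: "w x k 0 = 1" by (simp add: w_def f0)

lemma w_sums:
  assumes x: "0 < x" "x < 1" "ereal x < fps_conv_radius f" and k: "k \<ge> 1"
  defines "Q \<equiv> q (x ^ k)"
  shows "(\<Sum>j. w x k j) = ennreal (eval_fps (g k) (x ^ k))"
    and "(\<Sum>j. w x k j * of_nat j) = ennreal (b k * Q) * (\<Sum>j. w x k j)"
    and "(\<Sum>j. w x k j * (of_nat j)\<^sup>2) = ennreal ((b k)\<^sup>2 * Q\<^sup>2 + b k * (x ^ k * q' (x ^ k))) * (\<Sum>j. w x k j)"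
proof -
  have r: "0 \<le> x ^ k" "ereal (x ^ k) < fps_conv_radius f" using x k power_in_radius[of x k] by auto
  note m = rpow_moments[OF b_nonneg[OF k] g_nonneg[OF k] r]
  have gn: "0 \<le> fps_nth (g k) j * (x ^ k) ^ j" for j using g_nonneg[OF k] x by simp
  have q0: "q (x ^ k) \<ge> 0" "q' (x ^ k) \<ge> 0" using q_nonneg[OF r] q'_nonneg[OF r] by auto
  show 1: "(\<Sum>j. w x k j) = ennreal (eval_fps (g k) (x ^ k))"
    unfolding w_def by (rule suminf_ennreal_eq[OF gn m(1)])
  have "(\<Sum>j. w x k j * of_nat j) = (\<Sum>j. ennreal (real j * (fps_nth (g k) j * (x ^ k) ^ j)))"
    using gn by (intro suminf_cong) (simp add: w_def ennreal_mult ennreal_of_nat_eq_real_of_nat mult.commute)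
  also have "\<dots> = ennreal (b k * q (x ^ k) * eval_fps (g k) (x ^ k))"
    by (rule suminf_ennreal_eq[OF _ m(2)]) (use gn in simp)
  finally show "(\<Sum>j. w x k j * of_nat j) = ennreal (b k * Q) * (\<Sum>j. w x k j)"
    unfolding 1 Q_def using q0 b_nonneg[OF k] m(4) by (simp add: ennreal_mult)
  have "(\<Sum>j. w x k j * (of_nat j)\<^sup>2) = (\<Sum>j. ennreal ((real j)\<^sup>2 * (fps_nth (g k) j * (x ^ k) ^ j)))"
    using gn by (intro suminf_cong)
      (simp add: w_def ennreal_mult ennreal_of_nat_eq_real_of_nat mult.commute flip: ennreal_power)
  also have "\<dots> = ennreal (((b k)\<^sup>2 * (q (x ^ k))\<^sup>2 + b k * (x ^ k * q' (x ^ k))) * eval_fps (g k) (x ^ k))"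
    by (rule suminf_ennreal_eq[OF _ m(3)]) (use gn in simp)
  finally show "(\<Sum>j. w x k j * (of_nat j)\<^sup>2) = ennreal ((b k)\<^sup>2 * Q\<^sup>2 + b k * (x ^ k * q' (x ^ k))) * (\<Sum>j. w x k j)"
    unfolding 1 Q_def using q0 b_nonneg[OF k] m(4) r by (simp add: ennreal_mult)
qed

lemma partition_sum_w:
  assumes x: "0 < x" "x < 1" "ereal x < fps_conv_radius f"
  shows "partition_sum (pweight (w x)) = ennreal (eval_fps F x)"
proof (rule LIMSEQ_unique)
  show "(\<lambda>n. \<Prod>k=1..Suc n. \<Sum>j. w x k j) \<longlonglongrightarrow> partition_sum (pweight (w x))"
    by (rule LIMSEQ_Suc[OF partition_sum_total]) (rule w_0)
  have "(\<Prod>k=1..Suc n. \<Sum>j. w x k j) = ennreal (eval_fps (partial_prod n) x)" for n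
  proof -
    have "(\<Prod>k=1..Suc n. \<Sum>j. w x k j) = (\<Prod>k=1..Suc n. ennreal (eval_fps (g k) (x ^ k)))"
      using w_sums(1)[OF x] by (intro prod.cong) auto
    also have "\<dots> = ennreal (\<Prod>k=1..Suc n. eval_fps (g k) (x ^ k))"
    proof (rule prod_ennreal)
      fix k assume k: "k \<in> {1..Suc n}"
      have "1 \<le> eval_fps (g k) (x ^ k)"
        by (rule rpow_moments(4)[OF b_nonneg g_nonneg _ power_in_radius]) (use k x in auto)
      then show "0 \<le> eval_fps (g k) (x ^ k)" by simp
    qed
    also have "\<dots> = ennreal (eval_fps (partial_prod n) x)" using x by (subst eval_partial_prod) auto
    finally show ?thesis .
  qed
  then show "(\<lambda>n. \<Prod>k=1..Suc n. \<Sum>j. w x k j) \<longlonglongrightarrow> ennreal (eval_fps F x)"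
    using tendsto_ennrealI[OF eval_F_limit[OF x]] by simp
qed

lemma pweight_w:
  assumes "0 < x" "p \<in> partitions"
  shows "pweight (w x) p = ennreal (x ^ weight p * (\<Prod>k\<in>set_mset p. fps_nth (g k) (count p k)))"
proof -
  have k: "k \<ge> 1" if "k \<in># p" for k using that assms(2) by (cases k) (auto simp: partitions_def)
  have "pweight (w x) p = ennreal (\<Prod>k\<in>set_mset p. fps_nth (g k) (count p k) * (x ^ k) ^ count p k)"
    unfolding pweight_def w_def using g_nonneg k assms by (intro prod_ennreal) auto
  also have "(\<Prod>k\<in>set_mset p. fps_nth (g k) (count p k) * (x ^ k) ^ count p k) = 
     x ^ weight p * (\<Prod>k\<in>set_mset p. fps_nth (g k) (count p k))"
    by (simp add: prod.distrib weight_def power_sum power_mult mult.commute)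
  finally show ?thesis .
qed

abbreviation gc :: "real \<Rightarrow> nat multiset measure" where "gc \<equiv> grand_canonical f b"

lemma space_gc [simp]: "space (gc x) = partitions" and sets_gc [simp]: "sets (gc x) = Pow partitions"
  by (simp_all add: grand_canonical_def space_point_measure sets_point_measure)

lemma measurable_gc [simp]: "h \<in> borel_measurable (gc x)"
  by (simp add: grand_canonical_def)

lemma nn_integral_gc:
  assumes x: "0 < x" "x < 1" "ereal x < fps_conv_radius f"
  shows "(\<integral>\<^sup>+p. h p \<partial>gc x) = ennreal (1 / eval_fps F x) * partition_sum (\<lambda>p. pweight (w x) p * h p)"
proof -
  have F: "eval_fps F x > 0" using eval_F_ge_1[OF x] by simp
  have "(\<integral>\<^sup>+p. h p \<partial>gc x) = (\<integral>\<^sup>+p. ennreal (x ^ weight p / eval_fps F x * (\<Prod>k\<in>set_mset p. fps_nth (g k) (count p k))) * h p \<partial>count_space partitions)"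
    unfolding grand_canonical_def point_measure_def by (rule nn_integral_density) auto
  also have "\<dots> = partition_sum (\<lambda>p. ennreal (1 / eval_fps F x) * (pweight (w x) p * h p))"
    unfolding partition_sum_def
  proof (rule nn_integral_cong)
    fix p assume p: "p \<in> space (count_space partitions)"
    have "ennreal (x ^ weight p / eval_fps F x * (\<Prod>k\<in>set_mset p. fps_nth (g k) (count p k)))
       = ennreal ((1 / eval_fps F x) * (x ^ weight p * (\<Prod>k\<in>set_mset p. fps_nth (g k) (count p k))))"
      by simp
    also have "\<dots> = ennreal (1 / eval_fps F x) * ennreal (x ^ weight p * (\<Prod>k\<in>set_mset p. fps_nth (g k) (count p k)))"
      using F by (intro ennreal_mult') simp
    also have "\<dots> = ennreal (1 / eval_fps F x) * pweight (w x) p"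
      using p x by (subst pweight_w) auto
    finally show "ennreal (x ^ weight p / eval_fps F x * (\<Prod>k\<in>set_mset p. fps_nth (g k) (count p k))) * h p = 
      ennreal (1 / eval_fps F x) * (pweight (w x) p * h p)" by (simp add: mult.assoc)
  qed
  finally show ?thesis by (simp add: partition_sum_cmult)
qed

lemma F_cancel:
  assumes x: "0 < x" "x < 1" "ereal x < fps_conv_radius f"
  shows "ennreal (1 / eval_fps F x) * (c * partition_sum (pweight (w x))) = c"
proof -
  have F: "eval_fps F x > 0" using eval_F_ge_1[OF x] by simp
  have "ennreal (1 / eval_fps F x) * ennreal (eval_fps F x) = 1"
    using F by (simp add: ennreal_mult[symmetric])
  then show ?thesis unfolding partition_sum_w[OF x] by (metis mult.assoc mult.commute mult_1)
qed

lemma prob_space_gc: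
  assumes x: "0 < x" "x < 1" "ereal x < fps_conv_radius f"
  shows "prob_space (gc x)"
proof
  have "emeasure (gc x) (space (gc x)) = (\<integral>\<^sup>+p. 1 \<partial>gc x)" by simp
  also have "\<dots> = 1" unfolding nn_integral_gc[OF x] using F_cancel[OF x, of 1] by simp
  finally show "emeasure (gc x) (space (gc x)) = 1" .
qed

lemma expectation_count:
  assumes x: "0 < x" "x < 1" "ereal x < fps_conv_radius f" and k: "k \<ge> 1"
    and m: "(\<Sum>j. w x k j * u j) = m * (\<Sum>j. w x k j)"
  shows "(\<integral>\<^sup>+p. u (count p k) \<partial>gc x) = m"
  unfolding nn_integral_gc[OF x] partition_sum_factor1[where w = "w x" and u = u, OF k w_0 m] by (rule F_cancel[OF x])

lemma expectation_tail_sum: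
  assumes x: "0 < x" "x < 1" "ereal x < fps_conv_radius f" and s: "s \<ge> 0"
  shows "(\<integral>\<^sup>+p. tail_sum s p \<partial>gc x) = (\<Sum>k. ennreal (if real k > s then b k * q (x ^ k) else 0))"
proof -
  have "partition_sum (\<lambda>p. pweight (w x) p * tail_sum s p) = (\<Sum>k. if real k > s then ennreal (b k * q (x ^ k)) else 0) * partition_sum (pweight (w x))"
    by (rule partition_sum_tail_sum[OF w_0 s w_sums(2)[OF x]]) (use s in auto)
  then have "(\<integral>\<^sup>+p. tail_sum s p \<partial>gc x) = (\<Sum>k. if real k > s then ennreal (b k * q (x ^ k)) else 0)"
    unfolding nn_integral_gc[OF x] using F_cancel[OF x] by simp
  also have "\<dots> = (\<Sum>k. ennreal (if real k > s then b k * q (x ^ k) else 0))"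
    by (rule suminf_cong) simp
  finally show ?thesis .
qed

text \<open>The constant C bounds variance over mean for each single count above s; by independence
  the same ratio then bounds the whole tail count.\<close>

lemma expectation_tail_sum_square:
  assumes x: "0 < x" "x < 1" "ereal x < fps_conv_radius f" and s: "s \<ge> 0" and C: "C \<ge> 0"
    and le: "\<And>k. real k > s \<Longrightarrow> x ^ k * q' (x ^ k) \<le> C * q (x ^ k)"
  defines "R \<equiv> (\<Sum>k. ennreal (if real k > s then b k * q (x ^ k) else 0))"
  shows "(\<integral>\<^sup>+p. (tail_sum s p)\<^sup>2 \<partial>gc x) \<le> R\<^sup>2 + ennreal C * R"
proof -
  define m where "m = (\<lambda>k. (b k)\<^sup>2 * (q (x ^ k))\<^sup>2 + b k * (x ^ k * q' (x ^ k)))"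
  have "partition_sum (\<lambda>p. pweight (w x) p * (tail_sum s p)\<^sup>2) \<le> 
      ((\<Sum>k. if real k > s then ennreal (b k * q (x ^ k)) else 0)\<^sup>2 + 
        ennreal C * (\<Sum>k. if real k > s then ennreal (b k * q (x ^ k)) else 0)) * partition_sum (pweight (w x))"
  proof (rule partition_sum_tail_sum_square[OF w_0 s w_sums(2)[OF x] w_sums(3)[OF x]])
    fix k assume k: "real k > s"
    then have k1: "k \<ge> 1" using s by simp
    have r: "0 \<le> x ^ k" "ereal (x ^ k) < fps_conv_radius f" using x k1 power_in_radius[of x k] by auto
    have "b k * (x ^ k * q' (x ^ k)) \<le> b k * (C * q (x ^ k))"
      using le[OF k] b_nonneg[OF k1] by (rule mult_left_mono)
    then have "(b k)\<^sup>2 * (q (x ^ k))\<^sup>2 + b k * (x ^ k * q' (x ^ k)) \<le> (b k * q (x ^ k))\<^sup>2 + C * (b k * q (x ^ k))"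
      by (simp add: power_mult_distrib mult_ac)
    then have "ennreal ((b k)\<^sup>2 * (q (x ^ k))\<^sup>2 + b k * (x ^ k * q' (x ^ k))) \<le> ennreal ((b k * q (x ^ k))\<^sup>2 + C * (b k * q (x ^ k)))"
      by (rule ennreal_leI)
    also have "\<dots> = (ennreal (b k * q (x ^ k)))\<^sup>2 + ennreal C * ennreal (b k * q (x ^ k))"
    proof -
      have z: "0 \<le> b k * q (x ^ k)" using q_nonneg[OF r] b_nonneg[OF k1] by simp
      then show ?thesis unfolding ennreal_power[OF z] using C by (simp only: ennreal_plus ennreal_mult zero_le_power2 mult_nonneg_nonneg)
    qed
    finally show "ennreal ((b k)\<^sup>2 * (q (x ^ k))\<^sup>2 + b k * (x ^ k * q' (x ^ k))) \<le> (ennreal (b k * q (x ^ k)))\<^sup>2 + ennreal C * ennreal (b k * q (x ^ k))" .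
  qed (use s partition_sum_w[OF x] in auto)
  moreover have "(\<Sum>k. if real k > s then ennreal (b k * q (x ^ k)) else 0) = R"
    unfolding R_def by (rule suminf_cong) simp
  ultimately have "(\<integral>\<^sup>+p. (tail_sum s p)\<^sup>2 \<partial>gc x) \<le> ennreal (1 / eval_fps F x) * ((R\<^sup>2 + ennreal C * R) * partition_sum (pweight (w x)))"
    unfolding nn_integral_gc[OF x] by (intro mult_left_mono) auto
  then show ?thesis unfolding F_cancel[OF x] .
qed

lemma expectation_linear:
  assumes x: "0 < x" "x < 1" "ereal x < fps_conv_radius f" and c: "c 0 = 0"
  shows "(\<integral>\<^sup>+p. (\<Sum>k. c k * of_nat (count p k)) \<partial>gc x) = (\<Sum>k. c k * ennreal (b k * q (x ^ k)))"
proof -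
  have "(\<integral>\<^sup>+p. (\<Sum>k. c k * of_nat (count p k)) \<partial>gc x) = (\<Sum>k. \<integral>\<^sup>+p. c k * of_nat (count p k) \<partial>gc x)"
    by (rule nn_integral_suminf) simp
  also have "\<dots> = (\<Sum>k. c k * ennreal (b k * q (x ^ k)))"
  proof (rule suminf_cong)
    fix k
    show "(\<integral>\<^sup>+p. c k * of_nat (count p k) \<partial>gc x) = c k * ennreal (b k * q (x ^ k))"
    proof (cases "k = 0")
      case False
      then have k: "k \<ge> 1" by simp
      then show ?thesis
        using expectation_count[OF x k w_sums(2)[OF x k]] by (simp add: nn_integral_cmult)
    qed (simp add: c)
  qed
  finally show ?thesis .
qed

lemma expectation_weight:
  assumes x: "0 < x" "x < 1" "ereal x < fps_conv_radius f"
  shows "(\<integral>\<^sup>+p. of_nat (weight p) \<partial>gc x) = (\<Sum>k. ennreal (real k * b k * q (x ^ k)))"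
proof -
  have "of_nat (weight p) = (\<Sum>k. of_nat k * of_nat (count p k) :: ennreal)" for p
  proof -
    have "(\<Sum>k. of_nat k * of_nat (count p k) :: ennreal) = (\<Sum>k\<in>set_mset p. of_nat k * of_nat (count p k))"
      by (rule suminf_finite) (auto simp: not_in_iff)
    then show ?thesis by (simp add: weight_def)
  qed
  then have "(\<integral>\<^sup>+p. of_nat (weight p) \<partial>gc x) = (\<Sum>k. of_nat k * ennreal (b k * q (x ^ k)))"
    using expectation_linear[OF x, of of_nat] by simp
  also have "\<dots> = (\<Sum>k. ennreal (real k * b k * q (x ^ k)))"
    by (rule suminf_cong) (simp add: ennreal_of_nat_eq_real_of_nat ennreal_mult' mult.assoc)
  finally show ?thesis .
qed

end

section \<open>The limit shape\<close>

context tame_pgf begin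

lemma shape_integrand_integrable:
  assumes t: "t > 0" and \<beta>: "\<beta> > 0"
  shows "set_integrable lborel {0<..<1} (\<lambda>u. q' u * max 0 ((- ln u) powr \<beta> - t powr \<beta>))"
proof -
  \<comment> \<open>Since \<beta> may be at most 1, the power |log u|^\<beta> alone need not be
    integrable against q'. On the support of the cutoff |log u| >= t, so two extra powers cost only
    1/t^2.\<close>
  have "set_integrable lborel {0<..<1} (\<lambda>u. (1 / t powr 2) * (q' u * (- ln u) powr (\<beta> + 2)))"
    using integrable_q'_powr[of "\<beta> + 2"] \<beta> by (intro set_integrable_mult_right) simp
  then show ?thesis
  proof (rule set_integrable_bound)
    have "(\<lambda>u. (indicat_real {0<..<1} u * q' u) * max 0 ((- ln u) powr \<beta> - t powr \<beta>)) \<in> borel_measurable borel"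
      using q'_measurable by measurable
    then show "set_borel_measurable lborel {0<..<1} (\<lambda>u. q' u * max 0 ((- ln u) powr \<beta> - t powr \<beta>))"
      by (simp add: set_borel_measurable_def mult.assoc)
    show "AE u in lborel. u \<in> {0<..<1} \<longrightarrow> norm (q' u * max 0 ((- ln u) powr \<beta> - t powr \<beta>)) 
        \<le> norm (1 / t powr 2 * (q' u * (- ln u) powr (\<beta> + 2)))"
    proof (intro AE_I2 impI)
      fix u :: real assume u: "u \<in> {0<..<1}"
      have q0: "q' u \<ge> 0" using u q'_nonneg in_radius by simp
      have "max 0 ((- ln u) powr \<beta> - t powr \<beta>) \<le> 1 / t powr 2 * (- ln u) powr (\<beta> + 2)"
      proof (cases "- ln u \<le> t")
        case True
        then have "(- ln u) powr \<beta> \<le> t powr \<beta>" using u \<beta> by (intro powr_mono2) auto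
        then show ?thesis by simp
      next
        case False
        have "t powr 2 \<le> (- ln u) powr 2" using False t by (intro powr_mono2) auto
        then have "1 \<le> (- ln u) powr 2 / t powr 2" using t by simp
        then have "1 * (- ln u) powr \<beta> \<le> ((- ln u) powr 2 / t powr 2) * (- ln u) powr \<beta>"
          by (rule mult_right_mono) simp
        also have "\<dots> = 1 / t powr 2 * (- ln u) powr (\<beta> + 2)" by (simp add: powr_add)
        finally show ?thesis by (simp add: max_def) (smt (verit) powr_ge_zero)
      qed
      then have "q' u * max 0 ((- ln u) powr \<beta> - t powr \<beta>) \<le> q' u * (1 / t powr 2 * (- ln u) powr (\<beta> + 2))"
        using q0 by (rule mult_left_mono)
      then show "norm (q' u * max 0 ((- ln u) powr \<beta> - t powr \<beta>)) 
        \<le> norm (1 / t powr 2 * (q' u * (- ln u) powr (\<beta> + 2)))" using q0 by (simp add: abs_mult)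
    qed
  qed
qed

text \<open>The positive part is supported on u < exp (- t). There the subtracted t^\<beta> is
  constant, and q' integrates to q(exp (- t)) = exp (- t) h(exp (- t)), which is the boundary term
  of the limit shape.\<close>

lemma shape_integral_eq:
  assumes t: "t > 0" and \<beta>: "\<beta> > 0"
  shows "(\<lambda>u. (log_deriv f u + u * deriv (log_deriv f) u) * \<bar>ln u\<bar> powr \<beta>) integrable_on {0..exp (- t)}"
    "shape_integral \<beta> t = integral {0..exp (- t)} (\<lambda>u. (log_deriv f u + u * deriv (log_deriv f) u) * \<bar>ln u\<bar> powr \<beta>)
        - t powr \<beta> * log_deriv f (exp (- t)) * exp (- t)"
proof -
  define a where "a = exp (- t)"
  have a: "0 < a" "a < 1" using t by (auto simp: a_def)
  have lt: "- ln u > t" if "0 < u" "u < a" for u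
    using that ln_less_cancel_iff[of u a] a by (simp add: a_def)
  have le: "- ln u \<le> t" if "a \<le> u" for u
  proof -
    have "0 < u" using that a by linarith
    then have "ln a \<le> ln u" using that a by simp
    then show ?thesis by (simp add: a_def)
  qed
  have r: "ereal u < fps_conv_radius f" if "u \<le> a" for u using that a in_radius by simp
  have cq: "continuous_on {0..a} q" by (rule continuous_on_q[OF r]) simp
  have d: "(q has_real_derivative q' x) (at x)" if "0 < x" "x < a" for x
    using that r by (intro q_deriv) auto
  have c: "continuous_on {0<..<a} q'"
    by (rule continuous_on_subset[OF continuous_on_q'_01]) (use a in auto)
  have n: "0 \<le> q' x" if "0 < x" "x < a" for x using q'_nonneg[of x] r that by auto
  note I = set_integral_FTC_nonneg[OF a(1) d c n continuous_on_Icc_at_rightD[OF cq a(1)] continuous_on_Icc_at_leftD[OF cq a(1)]]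
  define m where "m = (\<lambda>u. q' u * max 0 ((- ln u) powr \<beta> - t powr \<beta>))"
  have m0: "indicat_real {0<..<1} u * m u = indicat_real {0<..<a} u * m u" for u
  proof (cases "a \<le> u \<and> 0 < u \<and> u < 1")
    case True
    then have "(- ln u) powr \<beta> \<le> t powr \<beta>" using le[of u] \<beta> by (intro powr_mono2) auto
    then show ?thesis by (simp add: m_def)
  qed (use a in \<open>auto simp: indicator_def\<close>)
  have mi: "set_integrable lborel {0<..<a} m"
    using shape_integrand_integrable[OF t \<beta>] m0 unfolding set_integrable_def m_def by simp
  have sm: "shape_integral \<beta> t = (LINT u:{0<..<a}|lborel. m u)"
  proof -
    have "(\<lambda>u. indicat_real {0<..<1} u * m u) = (\<lambda>u. indicat_real {0<..<a} u * m u)" by (rule ext) (rule m0)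
    then show ?thesis unfolding shape_integral_def set_lebesgue_integral_def real_scaleR_def m_def by (rule arg_cong)
  qed
  have G: "set_integrable lborel {0<..<a} (\<lambda>u. m u + t powr \<beta> * q' u)"
    using mi I(1) by (intro set_integral_add set_integrable_mult_right)
  have Gv: "(LINT u:{0<..<a}|lborel. m u + t powr \<beta> * q' u) = shape_integral \<beta> t + t powr \<beta> * q a"
    using mi I by (subst set_integral_add) (auto simp: sm intro!: set_integrable_mult_right)
  have Geq: "m u + t powr \<beta> * q' u = (log_deriv f u + u * deriv (log_deriv f) u) * \<bar>ln u\<bar> powr \<beta>" if "u \<in> {0<..<a}" for u
  proof -
    have "t powr \<beta> \<le> (- ln u) powr \<beta>" using lt[of u] that t \<beta> by (intro powr_mono2) auto
    moreover have "\<bar>ln u\<bar> = - ln u" using that a by simp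
    ultimately show ?thesis by (simp add: m_def q'_def[symmetric] algebra_simps)
  qed
  let ?G = "\<lambda>u. (log_deriv f u + u * deriv (log_deriv f) u) * \<bar>ln u\<bar> powr \<beta>"
  have "?G integrable_on {0<..<a}"
    by (rule integrable_eq[OF set_borel_integral_eq_integral(1)[OF G] Geq])
  moreover have "integral {0<..<a} ?G = shape_integral \<beta> t + t powr \<beta> * q a"
    using integral_cong[of "{0<..<a}", OF Geq] set_borel_integral_eq_integral(2)[OF G] Gv by simp
  ultimately show "?G integrable_on {0..exp (- t)}"
    "shape_integral \<beta> t = integral {0..exp (- t)} (\<lambda>u. (log_deriv f u + u * deriv (log_deriv f) u) * \<bar>ln u\<bar> powr \<beta>)
        - t powr \<beta> * log_deriv f (exp (- t)) * exp (- t)"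
    by (simp_all add: a_def integrable_on_open_interval_real integral_open_interval_real q_def)
qed

lemma q_le_near_0: "0 \<le> u \<Longrightarrow> u \<le> 1/2 \<Longrightarrow> q u \<le> E1 (1/2) * u"
proof -
  assume u: "0 \<le> u" "u \<le> 1/2"
  have r: "ereal u < fps_conv_radius f" "ereal (1/2) < fps_conv_radius f" using u in_radius[of u] in_radius[of "1/2"] by auto
  have "E1 u / E u \<le> E1 u / 1" using E_ge_1[OF u(1) r(1)] E1_ge[OF u(1) r(1)] f1 by (intro divide_left_mono) auto
  also have "\<dots> \<le> E1 (1/2)" using E1_mono[OF u r(2)] by simp
  finally have "u * (E1 u / E u) \<le> u * E1 (1/2)" using u by (intro mult_left_mono) auto
  then show ?thesis using q_eq[OF u(1) r(1)] by (simp add: mult.commute)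
qed

text \<open>Integration by parts: |log u|^(\<beta>+1) q(u) vanishes at both ends, so the integral of
  its derivative, |log u|^(\<beta>+1) q' - (\<beta>+1) |log u|^\<beta> h, is 0. This removes h from
  the constant and leaves the factor 1 - 1/(\<beta>+1).\<close>

lemma shape_const_eq:
  assumes \<beta>: "\<beta> > 0"
  shows "shape_const f \<beta> = \<beta> / (\<beta> + 1) * shape_integral (\<beta> + 1) 0"
proof -
  \<comment> \<open>Extended by 0 to the endpoints, so that it is continuous on [0,1].\<close>
  define A where "A = (\<lambda>u. if u \<in> {0<..<1} then (- ln u) powr (\<beta> + 1) * q u else 0)"
  define A' where "A' = (\<lambda>u. (- ln u) powr (\<beta> + 1) * q' u - (\<beta> + 1) * ((- ln u) powr \<beta> * log_deriv f u))"
  have dA: "(A has_real_derivative A' u) (at u)" if u: "u \<in> {0<..<1}" for u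
  proof -
    have r: "ereal u < fps_conv_radius f" using u in_radius by simp
    have dq: "(q has_real_derivative q' u) (at u)" using u r by (intro q_deriv) auto
    have "((\<lambda>u. (- ln u) powr (\<beta> + 1)) has_real_derivative (\<beta> + 1) * (- ln u) powr \<beta> * (- (1 / u))) (at u)"
      using u by (auto intro!: derivative_eq_intros)
    from DERIV_mult[OF this dq]
    have "((\<lambda>u. (- ln u) powr (\<beta> + 1) * q u) has_real_derivative A' u) (at u)"
      by (rule DERIV_cong) (use u in \<open>simp add: A'_def q_def field_simps\<close>)
    moreover have "eventually (\<lambda>v. A v = (- ln v) powr (\<beta> + 1) * q v) (nhds u)"
      using eventually_nhds_in_open[of "{0<..<1}" u] u by (auto elim!: eventually_mono simp: A_def)
    ultimately show ?thesis by (subst DERIV_cong_ev[OF refl _ refl]) auto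
  qed
  have lim0: "(A \<longlongrightarrow> 0) (at_right 0)"
  proof (rule real_tendsto_sandwich)
    show "eventually (\<lambda>u. 0 \<le> A u) (at_right 0)"
      using q_nonneg in_radius by (auto simp: A_def intro!: always_eventually)
    have "eventually (\<lambda>u::real. u \<in> {0<..<1/2}) (at_right 0)" by (rule eventually_at_right_real) simp
    then show "eventually (\<lambda>u. A u \<le> E1 (1/2) * ((- ln u) powr (\<beta> + 1) * u)) (at_right 0)"
    proof eventually_elim
      case (elim u)
      then have "(- ln u) powr (\<beta> + 1) * q u \<le> (- ln u) powr (\<beta> + 1) * (E1 (1/2) * u)"
        using q_le_near_0[of u] by (intro mult_left_mono) auto
      then show ?case using elim by (simp add: A_def mult_ac)
    qed
    have "((\<lambda>u::real. (- ln u) powr (\<beta> + 1) * u) \<longlongrightarrow> 0) (at_right 0)" using \<beta> by real_asymp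
    then show "((\<lambda>u. E1 (1/2) * ((- ln u) powr (\<beta> + 1) * u)) \<longlongrightarrow> 0) (at_right 0)"
      by (rule tendsto_mult_right_zero)
  qed simp
  \<comment> \<open>Here the bound on q itself enters: the product is O((1 - u)^(\<beta>+1) / (1 -
    u)).\<close>
  have lim1: "(A \<longlongrightarrow> 0) (at_left 1)"
  proof (rule real_tendsto_sandwich)
    show "eventually (\<lambda>u. 0 \<le> A u) (at_left 1)"
      using q_nonneg in_radius by (auto simp: A_def intro!: always_eventually)
    have "eventually (\<lambda>u::real. u \<in> {1/2<..<1}) (at_left 1)" by (rule eventually_at_left_real) simp
    then show "eventually (\<lambda>u. A u \<le> D * ((2 * (1 - u)) powr (\<beta> + 1) / (1 - u))) (at_left 1)"
    proof eventually_elim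
      case (elim u)
      have "(- ln u) powr (\<beta> + 1) * q u \<le> (2 * (1 - u)) powr (\<beta> + 1) * (D / (1 - u))"
        using neg_ln_le_near_1[of u] q_le[of u] elim \<beta> q_nonneg[of u] in_radius[of u]
        by (intro mult_mono powr_mono2) auto
      then show ?case using elim by (simp add: A_def mult_ac)
    qed
    have "((\<lambda>u::real. (2 * (1 - u)) powr (\<beta> + 1) / (1 - u)) \<longlongrightarrow> 0) (at_left 1)" using \<beta> by real_asymp
    then show "((\<lambda>u. D * ((2 * (1 - u)) powr (\<beta> + 1) / (1 - u))) \<longlongrightarrow> 0) (at_left 1)"
      by (rule tendsto_mult_right_zero)
  qed simp
  have "continuous_on {0..1} A"
  proof (rule continuous_on_IccI)
    show "(A \<longlongrightarrow> A 0) (at_right 0)" "(A \<longlongrightarrow> A 1) (at_left 1)" using lim0 lim1 by (auto simp: A_def)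
    show "A \<midarrow>x\<rightarrow> A x" if "0 < x" "x < 1" for x
      using DERIV_isCont[OF dA[of x]] that by (simp add: isCont_def)
  qed simp
  then have "(A' has_integral (A 1 - A 0)) {0..1}"
    by (intro fundamental_theorem_of_calculus_interior)
       (use dA in \<open>auto simp: has_real_derivative_iff_has_vector_derivative[symmetric]\<close>)
  then have i1: "(A' has_integral 0) {0..1}" by (simp add: A_def)
  have "set_integrable lborel {0<..<1} (\<lambda>u. q' u * (- ln u) powr (\<beta> + 1))"
    using \<beta> by (intro integrable_q'_powr) simp
  from set_borel_integral_eq_integral[OF this]
  have "((\<lambda>u. q' u * (- ln u) powr (\<beta> + 1)) has_integral shape_integral (\<beta> + 1) 0) {0<..<1}"
    by (simp add: shape_integral_0 integrable_integral)
  then have i2: "((\<lambda>u. q' u * (- ln u) powr (\<beta> + 1)) has_integral shape_integral (\<beta> + 1) 0) {0..1}"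
    by (simp add: has_integral_iff integrable_on_open_interval_real integral_open_interval_real)
  have "((\<lambda>u. (1 / (\<beta> + 1)) * A' u + \<beta> / (\<beta> + 1) * (q' u * (- ln u) powr (\<beta> + 1))) has_integral
     (1 / (\<beta> + 1)) * 0 + \<beta> / (\<beta> + 1) * shape_integral (\<beta> + 1) 0) {0..1}"
    by (intro has_integral_add has_integral_mult_right i1 i2)
  then have "((\<lambda>u. \<bar>ln u\<bar> powr (\<beta> + 1) * (log_deriv f u + u * deriv (log_deriv f) u) - \<bar>ln u\<bar> powr \<beta> * log_deriv f u)
     has_integral (1 / (\<beta> + 1)) * 0 + \<beta> / (\<beta> + 1) * shape_integral (\<beta> + 1) 0) {0..1}"
  proof (rule has_integral_spike_finite[of "{0, 1}", rotated 2])
    fix u :: real assume "u \<in> {0..1} - {0, 1}"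
    then have abs: "\<bar>ln u\<bar> = - ln u" by auto
    \<comment> \<open>The integrand is a combination of the exact derivative and of the q' term
      alone, so the term with h never has to be integrated separately.\<close>
    have K: "X - Y = (1 / (\<beta> + 1)) * (X - (\<beta> + 1) * Y) + \<beta> / (\<beta> + 1) * X" for X Y
    proof -
      have c: "\<beta> / (\<beta> + 1) = 1 - 1 / (\<beta> + 1)" using \<beta> by (simp add: field_simps)
      have "(1 / (\<beta> + 1)) * ((\<beta> + 1) * Y) = Y" using \<beta> by simp
      then show ?thesis unfolding c by (simp only: right_diff_distrib left_diff_distrib)
    qed
    show "\<bar>ln u\<bar> powr (\<beta> + 1) * (log_deriv f u + u * deriv (log_deriv f) u) - \<bar>ln u\<bar> powr \<beta> * log_deriv f u
      = (1 / (\<beta> + 1)) * A' u + \<beta> / (\<beta> + 1) * (q' u * (- ln u) powr (\<beta> + 1))"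
      unfolding A'_def q'_def[symmetric] abs mult.commute[of "q' u" "(- ln u) powr (\<beta> + 1)"] by (rule K)
  qed simp
  from integral_unique[OF this] show ?thesis by (simp add: shape_const_def Let_def)
qed

lemma shape_const_pos: "\<beta> > 0 \<Longrightarrow> shape_const f \<beta> > 0"
  using shape_integral_pos[of "\<beta> + 1"] by (simp add: shape_const_eq)

lemma limit_shape_eq: "t > 0 \<Longrightarrow> \<beta> > 0 \<Longrightarrow> limit_shape f \<beta> t = shape_integral \<beta> t / shape_const f \<beta>"
  by (simp add: limit_shape_def Let_def shape_integral_eq(2))

lemma shape_integral_nonneg: "shape_integral \<gamma> t \<ge> 0"
  unfolding shape_integral_def set_lebesgue_integral_def
  by (rule Bochner_Integration.integral_nonneg) (auto simp: indicator_def q'_nonneg in_radius)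

lemma limit_shape_nonneg:
  assumes \<beta>: "\<beta> > 0" and t: "t \<ge> 0"
  shows "limit_shape f \<beta> t \<ge> 0"
proof (cases "t = 0")
  case False
  then show ?thesis using t \<beta> shape_const_pos[OF \<beta>] shape_integral_nonneg[of \<beta> t] by (simp add: limit_shape_eq)
next
  \<comment> \<open>At t = 0 the boundary term vanishes because \<open>0 powr \<beta> = 0\<close>.
    If the integral over (0,1) does not exist, the limit shape being unbounded near 0,
    \<open>integral\<close> takes its default value 0.\<close>
  case True
  let ?G = "\<lambda>u. (log_deriv f u + u * deriv (log_deriv f) u) * \<bar>ln u\<bar> powr \<beta>"
  have "integral {0..1} ?G \<ge> 0"
  proof (cases "?G integrable_on {0..1}")
    case True
    then show ?thesis
    proof (rule Henstock_Kurzweil_Integration.integral_nonneg)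
      fix u :: real assume u: "u \<in> {0..1}"
      show "?G u \<ge> 0"
      proof (cases "u = 1")
        case False
        then have "q' u \<ge> 0" using u by (intro q'_nonneg in_radius) auto
        then show ?thesis by (simp add: q'_def)
      qed simp
    qed
  qed (simp add: not_integrable_integral)
  then show ?thesis using shape_const_pos[OF \<beta>] by (simp add: limit_shape_def Let_def True)
qed

lemma isCont_limit_shape:
  assumes \<beta>: "\<beta> > 0" and t: "t > 0"
  shows "isCont (limit_shape f \<beta>) t"
proof -
  let ?G = "\<lambda>u. (log_deriv f u + u * deriv (log_deriv f) u) * \<bar>ln u\<bar> powr \<beta>"
  let ?I = "\<lambda>a. integral {0..a} ?G"
  \<comment> \<open>The upper limit belongs to t/2, so that exp (- t) is an interior point.\<close>
  have "continuous_on {0..exp (- (t / 2))} ?I"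
    by (rule indefinite_integral_continuous_1) (rule shape_integral_eq(1), use t \<beta> in auto)
  then have "continuous_on {0<..<exp (- (t / 2))} ?I" by (rule continuous_on_subset) auto
  then have I: "isCont ?I (exp (- t))" using t by (simp add: continuous_on_eq_continuous_at)
  have h: "isCont (log_deriv f) (exp (- t))"
    using t by (intro DERIV_isCont[OF log_deriv_has_deriv] in_radius) auto
  have e: "isCont (\<lambda>t. exp (- t)) t" by (intro continuous_intros)
  have "isCont (\<lambda>t. ?I (exp (- t))) t" by (rule isCont_o2[OF e I])
  moreover have "isCont (\<lambda>t. log_deriv f (exp (- t))) t" by (rule isCont_o2[OF e h])
  ultimately show ?thesis
    unfolding limit_shape_def[abs_def] Let_def using t by (intro continuous_intros) auto
qed

lemma nn_integral_power_gap:
  assumes r: "r > 0" and \<beta>: "\<beta> > 0"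
  shows "(\<integral>\<^sup>+t. ennreal (indicator {0<..} t * max 0 (r powr \<beta> - t powr \<beta>)) \<partial>lborel) = ennreal (\<beta> / (\<beta> + 1) * r powr (\<beta> + 1))"
proof -
  let ?P = "\<lambda>t. r powr \<beta> * t - t powr (\<beta> + 1) / (\<beta> + 1)"
  have a: "(?P \<longlongrightarrow> 0) (at_right 0)" using \<beta> by real_asymp
  have b: "(?P \<longlongrightarrow> ?P r) (at_left r)" using r \<beta> by (intro tendsto_intros) auto
  have d: "(?P has_real_derivative (r powr \<beta> - x powr \<beta>)) (at x)" if "0 < x" "x < r" for x
    using that \<beta> by (auto intro!: derivative_eq_intros)
  have c: "continuous_on {0<..<r} (\<lambda>t. r powr \<beta> - t powr \<beta>)" by (intro continuous_intros) auto
  have n: "0 \<le> r powr \<beta> - x powr \<beta>" if "0 < x" "x < r" for x using that \<beta> by (simp add: powr_mono2)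
  have I: "set_integrable lborel {0<..<r} (\<lambda>t. r powr \<beta> - t powr \<beta>)"
    by (rule set_integral_FTC_nonneg(1)[OF r d c n a b])
  have I2: "(LINT t:{0<..<r}|lborel. r powr \<beta> - t powr \<beta>) = ?P r - 0"
    by (rule set_integral_FTC_nonneg(2)[OF r d c n a b])
  have "(\<integral>\<^sup>+t. ennreal (indicator {0<..} t * max 0 (r powr \<beta> - t powr \<beta>)) \<partial>lborel) = 
     (\<integral>\<^sup>+t. ennreal (indicator {0<..<r} t *\<^sub>R (r powr \<beta> - t powr \<beta>)) \<partial>lborel)"
  proof (rule nn_integral_cong)
    fix t :: real
    have "r powr \<beta> \<le> t powr \<beta>" if "r \<le> t" using that r \<beta> by (intro powr_mono2) auto
    then show "ennreal (indicator {0<..} t * max 0 (r powr \<beta> - t powr \<beta>)) = ennreal (indicator {0<..<r} t *\<^sub>R (r powr \<beta> - t powr \<beta>))"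
      using n[of t] by (auto simp: indicator_def)
  qed
  also have "\<dots> = ennreal (LINT t:{0<..<r}|lborel. r powr \<beta> - t powr \<beta>)"
    unfolding set_lebesgue_integral_def
    by (rule nn_integral_eq_integral) (use I n in \<open>auto simp: set_integrable_def indicator_def\<close>)
  also have "(LINT t:{0<..<r}|lborel. r powr \<beta> - t powr \<beta>) = \<beta> / (\<beta> + 1) * r powr (\<beta> + 1)"
    unfolding I2 using r \<beta> by (simp add: powr_add field_simps)
  finally show ?thesis .
qed

text \<open>By Tonelli the variable t is integrated first. The gap |log u|^\<beta> - t^\<beta>
  integrates to \<beta>/(\<beta>+1) |log u|^(\<beta>+1), and integrating this against q' gives
  \<open>shape_const\<close> by \<open>shape_const_eq\<close>.\<close>

lemma limit_shape_has_integral: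
  assumes \<beta>: "\<beta> > 0"
  shows "(limit_shape f \<beta> has_integral 1) {0..}"
proof -
  let ?\<Omega> = "shape_const f \<beta>"
  have \<Omega>: "?\<Omega> > 0" by (rule shape_const_pos[OF \<beta>])
  define H where "H = (\<lambda>u t. ennreal ((indicat_real {0<..<1} u * q' u) * (indicat_real {0<..} t * max 0 ((- ln u) powr \<beta> - t powr \<beta>))))"
  have q'0: "q' u \<ge> 0" if "0 < u" "u < 1" for u using that q'_nonneg[of u] in_radius by simp
  have S: "ennreal (indicat_real {0<..} t * shape_integral \<beta> t) = (\<integral>\<^sup>+u. H u t \<partial>lborel)" for t
  proof (cases "t > 0")
    case True
    have "ennreal (shape_integral \<beta> t) = (\<integral>\<^sup>+u. ennreal (indicator {0<..<1} u *\<^sub>R (q' u * max 0 ((- ln u) powr \<beta> - t powr \<beta>))) \<partial>lborel)"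
      unfolding shape_integral_def set_lebesgue_integral_def
      by (rule nn_integral_eq_integral[symmetric])
         (use shape_integrand_integrable[OF True \<beta>] q'0 in \<open>auto simp: set_integrable_def indicator_def\<close>)
    then show ?thesis using True by (simp add: H_def mult.assoc)
  qed (simp add: H_def)
  have meas: "case_prod H \<in> borel_measurable (lborel \<Otimes>\<^sub>M lborel)"
  proof -
    have "(\<lambda>z. (indicat_real {0<..<1} (fst z) * q' (fst z)) * (indicat_real {0<..} (snd z) * max 0 ((- ln (fst z)) powr \<beta> - snd z powr \<beta>))) \<in> borel_measurable (lborel \<Otimes>\<^sub>M lborel)"
    proof (rule borel_measurable_times)
      show "(\<lambda>z. indicat_real {0<..<1} (fst z) * q' (fst z)) \<in> borel_measurable (lborel \<Otimes>\<^sub>M lborel)"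
        by (rule measurable_compose[OF measurable_fst]) (use q'_measurable in simp)
      show "(\<lambda>z. indicat_real {0<..} (snd z) * max 0 ((- ln (fst z)) powr \<beta> - snd z powr \<beta>)) \<in> borel_measurable (lborel \<Otimes>\<^sub>M lborel)"
        by measurable
    qed
    then show ?thesis by (simp add: H_def case_prod_beta')
  qed
  have "(\<integral>\<^sup>+t. ennreal (indicat_real {0<..} t * shape_integral \<beta> t) \<partial>lborel) = (\<integral>\<^sup>+t. \<integral>\<^sup>+u. H u t \<partial>lborel \<partial>lborel)"
    unfolding S ..
  also have "\<dots> = (\<integral>\<^sup>+u. \<integral>\<^sup>+t. H u t \<partial>lborel \<partial>lborel)"
    by (rule lborel_pair.Fubini'[OF meas])
  also have "\<dots> = (\<integral>\<^sup>+u. ennreal (\<beta> / (\<beta> + 1)) * ennreal (indicator {0<..<1} u *\<^sub>R (q' u * (- ln u) powr (\<beta> + 1))) \<partial>lborel)"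
  proof (rule nn_integral_cong)
    fix u :: real
    show "(\<integral>\<^sup>+t. H u t \<partial>lborel) = ennreal (\<beta> / (\<beta> + 1)) * ennreal (indicator {0<..<1} u *\<^sub>R (q' u * (- ln u) powr (\<beta> + 1)))"
    proof (cases "u \<in> {0<..<1}")
      case True
      have "(\<integral>\<^sup>+t. H u t \<partial>lborel) = (\<integral>\<^sup>+t. ennreal (q' u) * ennreal (indicator {0<..} t * max 0 ((- ln u) powr \<beta> - t powr \<beta>)) \<partial>lborel)"
        using True q'0 by (intro nn_integral_cong) (simp add: H_def ennreal_mult' mult.assoc)
      also have "\<dots> = ennreal (q' u) * ennreal (\<beta> / (\<beta> + 1) * (- ln u) powr (\<beta> + 1))"
        using True \<beta> by (subst nn_integral_cmult) (auto simp: nn_integral_power_gap)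
      finally show ?thesis using True \<beta> q'0[of u] by (simp add: ennreal_mult[symmetric] mult_ac)
    qed (simp add: H_def)
  qed
  also have "\<dots> = ennreal (\<beta> / (\<beta> + 1)) * ennreal (shape_integral (\<beta> + 1) 0)"
  proof (subst nn_integral_cmult)
    have i: "integrable lborel (\<lambda>u. indicator {0<..<1} u *\<^sub>R (q' u * (- ln u) powr (\<beta> + 1)))"
      using integrable_q'_powr[of "\<beta> + 1"] \<beta> by (simp add: set_integrable_def)
    then show "(\<lambda>u. ennreal (indicator {0<..<1} u *\<^sub>R (q' u * (- ln u) powr (\<beta> + 1)))) \<in> borel_measurable lborel"
      using borel_measurable_integrable by (intro measurable_compose[OF _ measurable_ennreal]) blast
    have "(\<integral>\<^sup>+u. ennreal (indicator {0<..<1} u *\<^sub>R (q' u * (- ln u) powr (\<beta> + 1))) \<partial>lborel) = ennreal (shape_integral (\<beta> + 1) 0)"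
      unfolding shape_integral_0 set_lebesgue_integral_def
      by (rule nn_integral_eq_integral[OF i]) (auto simp: indicator_def q'0)
    then show "ennreal (\<beta> / (\<beta> + 1)) * (\<integral>\<^sup>+u. ennreal (indicator {0<..<1} u *\<^sub>R (q' u * (- ln u) powr (\<beta> + 1))) \<partial>lborel) = ennreal (\<beta> / (\<beta> + 1)) * ennreal (shape_integral (\<beta> + 1) 0)"
      by simp
  qed
  also have "\<dots> = ennreal ?\<Omega>" unfolding shape_const_eq[OF \<beta>]
    by (rule ennreal_mult[symmetric]) (use \<beta> shape_integral_nonneg in auto)
  finally have nn: "(\<integral>\<^sup>+t. ennreal (indicat_real {0<..} t * shape_integral \<beta> t) \<partial>lborel) = ennreal ?\<Omega>" .
  have eq: "indicat_real {0<..} t *\<^sub>R limit_shape f \<beta> t = (indicat_real {0<..} t * shape_integral \<beta> t) / ?\<Omega>" for t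
    using \<beta> by (auto simp: indicator_def limit_shape_eq)
  have cont: "continuous_on {0<..} (limit_shape f \<beta>)"
    using isCont_limit_shape[OF \<beta>] by (auto intro: continuous_at_imp_continuous_on)
  have m: "(\<lambda>t. indicat_real {0<..} t *\<^sub>R limit_shape f \<beta> t) \<in> borel_measurable borel"
    by (rule borel_measurable_continuous_on_indicator[OF _ cont]) simp
  have m': "(\<lambda>t. indicat_real {0<..} t * shape_integral \<beta> t) \<in> borel_measurable lborel"
  proof -
    have "(\<lambda>t. ?\<Omega> * (indicat_real {0<..} t *\<^sub>R limit_shape f \<beta> t)) \<in> borel_measurable borel" using m by measurable
    also have "(\<lambda>t. ?\<Omega> * (indicat_real {0<..} t *\<^sub>R limit_shape f \<beta> t)) = (\<lambda>t. indicat_real {0<..} t * shape_integral \<beta> t)"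
      unfolding eq using \<Omega> by simp
    finally show ?thesis by simp
  qed
  have int: "has_bochner_integral lborel (\<lambda>t. indicat_real {0<..} t * shape_integral \<beta> t) ?\<Omega>"
    by (rule has_bochner_integral_nn_integral[OF m' _ _ nn]) (use \<Omega> shape_integral_nonneg in auto)
  have "has_bochner_integral lborel (\<lambda>t. indicat_real {0<..} t *\<^sub>R limit_shape f \<beta> t) (?\<Omega> / ?\<Omega>)"
    unfolding eq by (rule has_bochner_integral_divide_zero[OF int])
  then have hb: "has_bochner_integral lborel (\<lambda>t. indicat_real {0<..} t *\<^sub>R limit_shape f \<beta> t) 1" using \<Omega> by simp
  then have "set_integrable lborel {0<..} (limit_shape f \<beta>)" "(LINT t:{0<..}|lborel. limit_shape f \<beta> t) = 1"
    by (auto simp: set_integrable_def set_lebesgue_integral_def has_bochner_integral_iff)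
  from set_borel_integral_eq_integral[OF this(1)] this(2)
  have "(limit_shape f \<beta> has_integral 1) {0<..}" by (simp add: has_integral_iff)
  moreover have "negligible {t. t \<in> {0<..} - {0..} \<or> t \<in> {0..} - {0<..} \<and> limit_shape f \<beta> t \<noteq> (0::real)}"
    by (rule negligible_subset[of "{0}"]) auto
  ultimately show ?thesis
    by (subst has_integral_spike_set_eq[of "{0..}" "{0<..}"]) (auto intro: negligible_subset[of "{0}"])
qed

lemma limit_shape_function_limit_shape:
  assumes \<beta>: "\<beta> > 0"
  shows "limit_shape_function (limit_shape f \<beta>)"
proof -
  have "{t \<in> {0<..a}. \<not> isCont (limit_shape f \<beta>) t} = {}" for a using isCont_limit_shape[OF \<beta>] by auto
  moreover have "(limit_shape f \<beta> \<longlongrightarrow> limit_shape f \<beta> t) (at_left t)" "(limit_shape f \<beta> \<longlongrightarrow> limit_shape f \<beta> t) (at_right t)" if "t > 0" for t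
    using isCont_limit_shape[OF \<beta> that] by (auto simp: isCont_def filterlim_at_split)
  ultimately have "piecewise_continuous (limit_shape f \<beta>)"
    unfolding piecewise_continuous_def by (metis finite.emptyI)
  then show ?thesis using limit_shape_nonneg[OF \<beta>] limit_shape_has_integral[OF \<beta>] by (simp add: limit_shape_function_def)
qed

end

section \<open>Ergodicity\<close>

lemma filtercomap_ereal_at_left: "filtercomap ereal (at_left (ereal r)) = at_left r"
proof (rule filter_eqI)
  fix P :: "real \<Rightarrow> bool"
  show "eventually P (filtercomap ereal (at_left (ereal r))) \<longleftrightarrow> eventually P (at_left r)"
    unfolding at_left_ereal eventually_filtercomap eventually_filtermap
  proof
    assume "eventually P (at_left r)"
    then show "\<exists>Q. eventually (\<lambda>x. Q (ereal x)) (at_left r) \<and> (\<forall>x. Q (ereal x) \<longrightarrow> P x)"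
      by (intro exI[of _ "\<lambda>y. P (real_of_ereal y)"]) simp
  qed (auto elim: eventually_mono)
qed

lemma integral_real_of_nat:
  assumes "(\<integral>\<^sup>+p. of_nat (N p) \<partial>M) = ennreal m" "m \<ge> 0" "(\<lambda>p. real (N p)) \<in> borel_measurable M"
  shows "(\<integral>p. real (N p) \<partial>M) = m" "integrable M (\<lambda>p. real (N p))"
proof -
  have "(\<integral>\<^sup>+p. ennreal (real (N p)) \<partial>M) = ennreal m" using assms(1) by (simp add: ennreal_of_nat_eq_real_of_nat)
  from has_bochner_integral_nn_integral[OF assms(3) _ assms(2) this]
  have "has_bochner_integral M (\<lambda>p. real (N p)) m" by simp
  then show "(\<integral>p. real (N p) \<partial>M) = m" "integrable M (\<lambda>p. real (N p))" by (auto simp: has_bochner_integral_iff)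
qed

locale regular_multiplicative = tame_pgf f D + multiplicative f b for f D b +
  fixes \<beta> :: real
  assumes rv: "regularly_varying (psum b) \<beta>"
begin

lemma \<beta>_pos: "\<beta> > 0"
  using rv by (simp add: regularly_varying_def)

text \<open>For k > t/(1 - x) the inequality ln x <= x - 1 gives x^k <= exp (- t) =: a. On [0, a],
  away from the possible singularity at 1, q' is bounded while q(u) >= f_1 u / f(a), so u q'(u) /
  q(u) is bounded.\<close>

lemma variance_bound:
  assumes t: "t > 0"
  obtains C where "C \<ge> 0"
    "\<And>x k. 0 < x \<Longrightarrow> x < 1 \<Longrightarrow> real k > 1 / (1 - x) * t \<Longrightarrow> x ^ k * q' (x ^ k) \<le> C * q (x ^ k)"
proof -
  define a where "a = exp (- t)"
  have a: "0 < a" "a < 1" using t by (auto simp: a_def)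
  define C where "C = \<bar>D\<bar> / (1 - a)\<^sup>2 * E a / fps_nth f 1"
  have ra: "ereal a < fps_conv_radius f" by (rule in_radius[OF a(2)])
  have Ea: "E a \<ge> 1" using E_ge_1 a ra by simp
  show thesis
  proof (rule that[of C])
    show "C \<ge> 0" using Ea f1 by (simp add: C_def)
    fix x :: real and k :: nat
    assume x: "0 < x" "x < 1" and k: "real k > 1 / (1 - x) * t"
    have "real k * ln x \<le> real k * (x - 1)" using ln_le_minus_one[of x] x by (intro mult_left_mono) auto
    also have "\<dots> \<le> - t" using k x by (simp add: field_simps)
    finally have "exp (real k * ln x) \<le> a" by (simp add: a_def)
    then have u: "x ^ k \<le> a" using x by (simp add: exp_of_nat_mult)
    define v where "v = x ^ k"
    have v: "0 \<le> v" "v \<le> a" "v < 1" using u x a by (auto simp: v_def)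
    have rv: "ereal v < fps_conv_radius f" by (rule in_radius[OF v(3)])
    have "q' v \<le> D / (1 - v)\<^sup>2" using q'_le v by simp
    also have "\<dots> \<le> \<bar>D\<bar> / (1 - v)\<^sup>2" by (intro divide_right_mono) auto
    also have "\<dots> \<le> \<bar>D\<bar> / (1 - a)\<^sup>2"
      using v a by (intro divide_left_mono power_mono) auto
    finally have 1: "q' v \<le> \<bar>D\<bar> / (1 - a)\<^sup>2" .
    have "fps_nth f 1 * v \<le> E1 v * v" using E1_ge[OF v(1) rv] v by (intro mult_right_mono) auto
    also have "\<dots> = q v * E v" using q_eq[OF v(1) rv] E_ge_1[OF v(1) rv] by simp
    also have "\<dots> \<le> q v * E a" using v ra q_nonneg[OF v(1) rv] by (intro mult_left_mono E_mono) auto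
    finally have 2: "v \<le> E a / fps_nth f 1 * q v" using f1 by (simp add: field_simps)
    have "v * q' v \<le> (E a / fps_nth f 1 * q v) * (\<bar>D\<bar> / (1 - a)\<^sup>2)"
      using 1 2 v q'_nonneg[OF v(1) rv] q_nonneg[OF v(1) rv] Ea f1 by (intro mult_mono) auto
    also have "\<dots> = C * q v" by (simp add: C_def mult_ac)
    finally show "x ^ k * q' (x ^ k) \<le> C * q (x ^ k)" by (simp add: v_def)
  qed
qed

text \<open>Chebyshev with variance at most C \<Phi>. The rescaled variance factors into \<alpha>/M,
  which tends to 0, and \<alpha> \<Phi> / M, which converges.\<close>

lemma deviation_bound:
  assumes x: "0 < x" "x < 1"
    and M: "(\<Sum>k. ennreal (real k * b k * q (x ^ k))) = ennreal M" "M > 0"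
    and \<Phi>: "(\<Sum>k. ennreal (if real k > 1 / (1 - x) * t then b k * q (x ^ k) else 0)) = ennreal \<Phi>" "\<Phi> \<ge> 0"
    and t: "t > 0" and C: "C \<ge> 0"
    and le: "\<And>k. real k > 1 / (1 - x) * t \<Longrightarrow> x ^ k * q' (x ^ k) \<le> C * q (x ^ k)"
    and \<epsilon>: "\<epsilon> > 0" and close: "\<bar>1 / (1 - x) * \<Phi> / M - y\<bar> < \<epsilon> / 2"
  shows "measure (gc x) {p \<in> partitions. \<bar>scaled_tail gc (\<lambda>x. 1 / (1 - x)) x p t - y\<bar> \<ge> \<epsilon>}
    \<le> 4 * C / \<epsilon>\<^sup>2 * (1 / (1 - x) / M) * (1 / (1 - x) * \<Phi> / M)"
proof -
  define \<alpha> where "\<alpha> = 1 / (1 - x)"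
  have \<alpha>: "\<alpha> > 0" using x by (simp add: \<alpha>_def)
  have r: "ereal x < fps_conv_radius f" by (rule in_radius[OF x(2)])
  interpret prob_space "gc x" by (rule prob_space_gc[OF x r])
  have s: "\<alpha> * t \<ge> 0" using \<alpha> t by simp
  let ?N = "\<lambda>p. real (tail_count p (\<alpha> * t))"
  have EN: "(\<integral>q. real (weight q) \<partial>gc x) = M"
    by (rule integral_real_of_nat) (use expectation_weight[OF x r] M in auto)
  have "(\<integral>\<^sup>+p. of_nat (tail_count p (\<alpha> * t)) \<partial>gc x) = ennreal \<Phi>"
    using expectation_tail_sum[OF x r s] \<Phi> by (simp add: tail_sum_eq \<alpha>_def)
  from integral_real_of_nat[OF this \<Phi>(2)]
  have E: "expectation ?N = \<Phi>" and I: "integrable (gc x) ?N" by auto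
  have "(\<integral>\<^sup>+p. (tail_sum (\<alpha> * t) p)\<^sup>2 \<partial>gc x) \<le> (ennreal \<Phi>)\<^sup>2 + ennreal C * ennreal \<Phi>"
    using expectation_tail_sum_square[OF x r s C] le \<Phi> unfolding \<alpha>_def by simp
  also have "\<dots> = ennreal (\<Phi>\<^sup>2 + C * \<Phi>)"
    unfolding ennreal_power[OF \<Phi>(2)] using C \<Phi>(2) by (simp only: ennreal_plus ennreal_mult zero_le_power2 mult_nonneg_nonneg)
  finally have le2: "(\<integral>\<^sup>+p. ennreal (?N p ^ 2) \<partial>gc x) \<le> ennreal (\<Phi>\<^sup>2 + C * \<Phi>)"
    by (simp add: tail_sum_eq ennreal_of_nat_eq_real_of_nat ennreal_power)
  have I2: "integrable (gc x) (\<lambda>p. ?N p ^ 2)"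
    by (rule integrableI_bounded) (use le2 in \<open>auto intro: le_less_trans\<close>)
  have "ennreal (expectation (\<lambda>p. ?N p ^ 2)) \<le> ennreal (\<Phi>\<^sup>2 + C * \<Phi>)"
    using nn_integral_eq_integral[OF I2] le2 by simp
  then have E2: "expectation (\<lambda>p. ?N p ^ 2) \<le> \<Phi>\<^sup>2 + C * \<Phi>"
    using C \<Phi>(2) by (subst (asm) ennreal_le_iff) auto
  have V: "variance ?N \<le> C * \<Phi>"
    using variance_eq[OF I I2] E E2 by simp
  \<comment> \<open>Half of \<epsilon> is spent on the distance of the mean from y; the other half,
    in the original scale, is the allowed fluctuation.\<close>
  define a where "a = \<epsilon> / 2 * M / \<alpha>"
  have a: "a > 0" using \<epsilon> M \<alpha> by (simp add: a_def)
  have "measure (gc x) {p \<in> partitions. \<bar>scaled_tail gc (\<lambda>x. 1 / (1 - x)) x p t - y\<bar> \<ge> \<epsilon>} \<le> prob {p\<in>space (gc x). \<bar>?N p - expectation ?N\<bar> \<ge> a}"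
  proof (rule finite_measure_mono)
    show "{p \<in> partitions. \<bar>scaled_tail gc (\<lambda>x. 1 / (1 - x)) x p t - y\<bar> \<ge> \<epsilon>} \<subseteq> {p\<in>space (gc x). \<bar>?N p - expectation ?N\<bar> \<ge> a}"
    proof safe
      fix p assume p: "p \<in> partitions" and dev: "\<epsilon> \<le> \<bar>scaled_tail gc (\<lambda>x. 1 / (1 - x)) x p t - y\<bar>"
      have "\<bar>\<alpha> / M * ?N p - \<alpha> * \<Phi> / M\<bar> \<ge> \<epsilon> / 2"
        using dev close unfolding scaled_tail_def EN \<alpha>_def by linarith
      moreover have "\<bar>\<alpha> / M * ?N p - \<alpha> * \<Phi> / M\<bar> = \<alpha> / M * \<bar>?N p - \<Phi>\<bar>"
        using \<alpha> M by (simp add: abs_mult right_diff_distrib[symmetric] flip: times_divide_eq_left)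
      ultimately show "a \<le> \<bar>?N p - expectation ?N\<bar>" unfolding E a_def using \<alpha> M by (simp add: field_simps)
    qed simp
  qed simp
  also have "\<dots> \<le> variance ?N / a\<^sup>2"
    by (rule Chebyshev_inequality[OF _ I2 a]) simp
  also have "\<dots> \<le> C * \<Phi> / a\<^sup>2" using V by (intro divide_right_mono) auto
  also have "\<dots> = 4 * C / \<epsilon>\<^sup>2 * (\<alpha> / M) * (\<alpha> * \<Phi> / M)"
    using \<epsilon> M \<alpha> by (simp add: a_def power2_eq_square field_simps)
  finally show ?thesis by (simp add: \<alpha>_def)
qed

lemma deviation_tendsto_0:
  assumes t: "t > 0" and \<epsilon>: "\<epsilon> > 0"
  shows "((\<lambda>x. measure (gc x) {p \<in> partitions. \<bar>scaled_tail gc (\<lambda>x. 1 / (1 - x)) x p t - limit_shape f \<beta> t\<bar> \<ge> \<epsilon>}) \<longlongrightarrow> 0) (at_left 1)"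
proof -
  let ?\<alpha> = "\<lambda>T::real. 1 / (1 - exp (- 1 / T))"
  obtain M where M:
    "eventually (\<lambda>T. M T > 0 \<and> (\<Sum>k. ennreal (real k * b k * q (exp (- 1 / T) ^ k))) = ennreal (M T)) at_top"
    "((\<lambda>T. ?\<alpha> T / M T) \<longlongrightarrow> 0) at_top"
    "\<And>t. t > 0 \<Longrightarrow> \<exists>\<Phi>. eventually (\<lambda>T. \<Phi> T \<ge> 0 \<and> (\<Sum>k. ennreal (if real k > ?\<alpha> T * t then b k * q (exp (- 1 / T) ^ k) else 0)) = ennreal (\<Phi> T)) at_top \<and>
       ((\<lambda>T. ?\<alpha> T * \<Phi> T / M T) \<longlongrightarrow> shape_integral \<beta> t / (\<beta> / (\<beta> + 1) * shape_integral (\<beta> + 1) 0)) at_top"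
  proof (rule mean_asymptotics[OF b_nonneg rv], goal_cases)
    case (2 M)
    show ?case by (rule 2(1)) (rule 2(2), rule 2(3), erule 2(4))
  qed
  obtain \<Phi> where \<Phi>: "eventually (\<lambda>T. \<Phi> T \<ge> 0 \<and> (\<Sum>k. ennreal (if real k > ?\<alpha> T * t then b k * q (exp (- 1 / T) ^ k) else 0)) = ennreal (\<Phi> T)) at_top"
    "((\<lambda>T. ?\<alpha> T * \<Phi> T / M T) \<longlongrightarrow> limit_shape f \<beta> t) at_top"
    using M(3)[OF t] \<beta>_pos t by (auto simp: limit_shape_eq shape_const_eq)
  obtain C where C: "C \<ge> 0" "\<And>x k. 0 < x \<Longrightarrow> x < 1 \<Longrightarrow> real k > 1 / (1 - x) * t \<Longrightarrow> x ^ k * q' (x ^ k) \<le> C * q (x ^ k)"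
    using variance_bound[OF t] by metis
  define B where "B T = 4 * C / \<epsilon>\<^sup>2 * (?\<alpha> T / M T) * (?\<alpha> T * \<Phi> T / M T)" for T
  have "(B \<longlongrightarrow> 4 * C / \<epsilon>\<^sup>2 * 0 * limit_shape f \<beta> t) at_top"
    unfolding B_def[abs_def] by (intro tendsto_intros M \<Phi>)
  then have B: "(B \<longlongrightarrow> 0) at_top" by simp
  have "eventually (\<lambda>T. dist (?\<alpha> T * \<Phi> T / M T) (limit_shape f \<beta> t) < \<epsilon> / 2) at_top"
    by (rule tendstoD[OF \<Phi>(2)]) (use \<epsilon> in simp)
  with M(1) \<Phi>(1) eventually_gt_at_top[of 0]
  have "eventually (\<lambda>T. measure (gc (exp (- 1 / T))) {p \<in> partitions. \<bar>scaled_tail gc (\<lambda>x. 1 / (1 - x)) (exp (- 1 / T)) p t - limit_shape f \<beta> t\<bar> \<ge> \<epsilon>} \<le> B T) at_top"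
  proof eventually_elim
    case (elim T)
    show ?case unfolding B_def
      by (rule deviation_bound[OF _ _ _ _ _ _ t C(1) C(2) \<epsilon>]) (use elim in \<open>auto simp: dist_real_def\<close>)
  qed
  then have "((\<lambda>T. measure (gc (exp (- 1 / T))) {p \<in> partitions. \<bar>scaled_tail gc (\<lambda>x. 1 / (1 - x)) (exp (- 1 / T)) p t - limit_shape f \<beta> t\<bar> \<ge> \<epsilon>}) \<longlongrightarrow> 0) at_top"
    by (intro real_tendsto_sandwich[OF _ _ tendsto_const B]) auto
  \<comment> \<open>The substitution T = - 1 / ln x inverts x = exp (- 1/T) and returns to the limit
    in x.\<close>
  moreover have "filterlim (\<lambda>x::real. - 1 / ln x) at_top (at_left 1)" by real_asymp
  ultimately have lim: "((\<lambda>x. measure (gc (exp (- 1 / (- 1 / ln x)))) {p \<in> partitions. \<bar>scaled_tail gc (\<lambda>x. 1 / (1 - x)) (exp (- 1 / (- 1 / ln x))) p t - limit_shape f \<beta> t\<bar> \<ge> \<epsilon>}) \<longlongrightarrow> 0) (at_left 1)"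
    by (rule filterlim_compose)
  have "eventually (\<lambda>x::real. x \<in> {0<..<1}) (at_left 1)" by (rule eventually_at_left_real) simp
  then have "eventually (\<lambda>x. measure (gc (exp (- 1 / (- 1 / ln x)))) {p \<in> partitions. \<bar>scaled_tail gc (\<lambda>x. 1 / (1 - x)) (exp (- 1 / (- 1 / ln x))) p t - limit_shape f \<beta> t\<bar> \<ge> \<epsilon>}
    = measure (gc x) {p \<in> partitions. \<bar>scaled_tail gc (\<lambda>x. 1 / (1 - x)) x p t - limit_shape f \<beta> t\<bar> \<ge> \<epsilon>}) (at_left 1)"
  proof eventually_elim
    case (elim x)
    then have "exp (- 1 / (- 1 / ln x)) = x" by simp
    then show ?case by (simp only:)
  qed
  from Lim_transform_eventually[OF lim this] show ?thesis .
qed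

theorem ergodic_with_limit_shape: "ergodic_with (fps_conv_radius F) gc (\<lambda>x. 1 / (1 - x)) (limit_shape f \<beta>)"
proof -
  let ?S = "\<lambda>x p t. scaled_tail gc (\<lambda>x. 1 / (1 - x)) x p t"
  have rad: "fps_conv_radius F = ereal 1" unfolding radius_F using radius_ge_1 by (simp add: min_def one_ereal_def)
  have "((\<lambda>x. measure (gc x) {p \<in> partitions. \<forall>t\<in>T. \<bar>?S x p t - limit_shape f \<beta> t\<bar> < \<epsilon>}) \<longlongrightarrow> 1) (at_left 1)"
    if \<epsilon>: "\<epsilon> > 0" and T: "finite T" "T \<subseteq> {t. t > 0 \<and> isCont (limit_shape f \<beta>) t}" for \<epsilon> T
  proof -
    let ?bad = "\<lambda>x t. {p \<in> partitions. \<bar>?S x p t - limit_shape f \<beta> t\<bar> \<ge> \<epsilon>}"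
    have "((\<lambda>x. 1 - (\<Sum>t\<in>T. measure (gc x) (?bad x t))) \<longlongrightarrow> 1 - (\<Sum>t\<in>T. 0)) (at_left 1)"
      by (intro tendsto_intros deviation_tendsto_0) (use T \<epsilon> in auto)
    then have lim: "((\<lambda>x. 1 - (\<Sum>t\<in>T. measure (gc x) (?bad x t))) \<longlongrightarrow> 1) (at_left 1)" by simp
    have ev: "eventually (\<lambda>x::real. x \<in> {0<..<1}) (at_left 1)" by (rule eventually_at_left_real) simp
    show ?thesis
    proof (rule real_tendsto_sandwich[OF _ _ lim tendsto_const])
      show "eventually (\<lambda>x. 1 - (\<Sum>t\<in>T. measure (gc x) (?bad x t)) \<le> measure (gc x) {p \<in> partitions. \<forall>t\<in>T. \<bar>?S x p t - limit_shape f \<beta> t\<bar> < \<epsilon>}) (at_left 1)"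
        using ev
      proof eventually_elim
        case (elim x)
        interpret prob_space "gc x" by (rule prob_space_gc) (use elim in_radius in auto)
        have eq: "{p \<in> partitions. \<forall>t\<in>T. \<bar>?S x p t - limit_shape f \<beta> t\<bar> < \<epsilon>} = space (gc x) - (\<Union>t\<in>T. ?bad x t)"
          by (auto simp: not_le)
        have "prob (\<Union>t\<in>T. ?bad x t) \<le> (\<Sum>t\<in>T. prob (?bad x t))"
          by (rule finite_measure_subadditive_finite[OF T(1)]) auto
        moreover have "prob (space (gc x) - (\<Union>t\<in>T. ?bad x t)) = 1 - prob (\<Union>t\<in>T. ?bad x t)"
          by (rule prob_compl) auto
        ultimately show ?case unfolding eq by simp
      qed
      show "eventually (\<lambda>x. measure (gc x) {p \<in> partitions. \<forall>t\<in>T. \<bar>?S x p t - limit_shape f \<beta> t\<bar> < \<epsilon>} \<le> 1) (at_left 1)"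
        using ev
      proof eventually_elim
        case (elim x)
        interpret prob_space "gc x" by (rule prob_space_gc) (use elim in_radius in auto)
        show ?case by (rule prob_le_1)
      qed
    qed
  qed
  then show ?thesis
    unfolding ergodic_with_def rad filtercomap_ereal_at_left
    using limit_shape_function_limit_shape[OF \<beta>_pos] by simp
qed

end

section \<open>Failure of ergodicity\<close>

definition weight_ge_2 :: "nat multiset \<Rightarrow> nat" where
  "weight_ge_2 p = (\<Sum>k | k \<in># p \<and> k \<ge> 2. k * count p k)"

lemma weight_eq_weight_ge_2: "p \<in> partitions \<Longrightarrow> weight p = count p 1 + weight_ge_2 p"
proof -
  assume p: "p \<in> partitions"
  have "weight p = (\<Sum>k\<in>set_mset p. (if k = 1 then count p 1 else 0) + (if k \<ge> 2 then k * count p k else 0))"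
    unfolding weight_def
  proof (rule sum.cong[OF refl])
    fix k assume "k \<in># p"
    then have "k \<noteq> 0" using p by (metis partitions_def mem_Collect_eq)
    then have "k = 1 \<or> k \<ge> 2" by linarith
    then show "k * count p k = (if k = 1 then count p 1 else 0) + (if k \<ge> 2 then k * count p k else 0)" by auto
  qed
  also have "\<dots> = (\<Sum>k\<in>set_mset p. if k = 1 then count p 1 else 0) + (\<Sum>k\<in>set_mset p. if k \<ge> 2 then k * count p k else 0)"
    by (rule sum.distrib)
  also have "(\<Sum>k\<in>set_mset p. if k = 1 then count p 1 else 0) = count p 1"
    by (simp add: not_in_iff)
  also have "(\<Sum>k\<in>set_mset p. if k \<ge> 2 then k * count p k else 0) = weight_ge_2 p"
    unfolding weight_ge_2_def by (subst sum.inter_filter[symmetric]) auto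
  finally show ?thesis .
qed

text \<open>For s >= 1 every counted part is at least 2 and contributes more than s to the
  weight.\<close>

lemma tail_count_le_weight_ge_2:
  assumes s: "s \<ge> 1"
  shows "s * real (tail_count p s) \<le> real (weight_ge_2 p)"
proof -
  have "s * real (tail_count p s) = (\<Sum>k | k \<in># p \<and> real k > s. s * real (count p k))"
    by (simp add: tail_count_def sum_distrib_left)
  also have "\<dots> \<le> (\<Sum>k | k \<in># p \<and> real k > s. real k * real (count p k))"
    by (intro sum_mono mult_right_mono) auto
  also have "\<dots> \<le> (\<Sum>k | k \<in># p \<and> k \<ge> 2. real k * real (count p k))"
    using s by (intro sum_mono2) auto
  finally show ?thesis by (simp add: weight_ge_2_def)
qed

text \<open>For s < 1 the tail count is the number of all parts, and the parts above 1 are at most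
  as many as their total weight.\<close>

lemma tail_count_near_count_1:
  assumes p: "p \<in> partitions" and s: "0 \<le> s" "s < 1"
  shows "count p 1 \<le> tail_count p s" "tail_count p s \<le> count p 1 + weight_ge_2 p"
proof -
  have "{k. k \<in># p \<and> real k > s} = set_mset p"
  proof -
    have "real k > s" if "k \<in># p" for k
    proof -
      have "k \<noteq> 0" using p that by (metis partitions_def mem_Collect_eq)
      then have "real k \<ge> 1" by simp
      then show ?thesis using s by linarith
    qed
    then show ?thesis by auto
  qed
  then have t: "tail_count p s = (\<Sum>k\<in>set_mset p. count p k)" by (simp add: tail_count_def)
  show "count p 1 \<le> tail_count p s"
  proof (cases "1 \<in># p")
    case True
    then show ?thesis unfolding t by (intro member_le_sum) auto
  qed (simp add: not_in_iff)
  have "tail_count p s \<le> weight p" unfolding t weight_def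
  proof (rule sum_mono)
    fix k assume "k \<in># p"
    then have "k \<noteq> 0" using p by (metis partitions_def mem_Collect_eq)
    then show "count p k \<le> k * count p k" by simp
  qed
  then show "tail_count p s \<le> count p 1 + weight_ge_2 p" using weight_eq_weight_ge_2[OF p] by simp
qed

text \<open>The bound is uniform in L: a relative error \<eta> in the exponent changes the
  exponential by at most a multiple of \<eta> L exp (- L/2), and L exp (- L/2) is bounded. Later L
  is - d ln y with an uncontrolled d.\<close>

lemma exp_gap_le:
  fixes L \<eta> :: real
  assumes "L \<ge> 0" "0 \<le> \<eta>" "\<eta> \<le> 1/2"
  shows "exp (- L * (1 - \<eta>)) - exp (- L * (1 + \<eta>)) \<le> 4 * \<eta>"
proof -
  have "exp (- L * (1 - \<eta>)) - exp (- L * (1 + \<eta>)) = exp (- L * (1 - \<eta>)) * (1 - exp (- 2 * \<eta> * L))"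
    by (simp add: right_diff_distrib algebra_simps flip: exp_add)
  also have "\<dots> \<le> exp (- L / 2) * (2 * \<eta> * L)"
  proof (rule mult_mono)
    have "L * (1 / 2) \<le> L * (1 - \<eta>)" using assms by (intro mult_left_mono) auto
    then show "exp (- L * (1 - \<eta>)) \<le> exp (- L / 2)" by simp
    show "1 - exp (- 2 * \<eta> * L) \<le> 2 * \<eta> * L" using exp_ge_add_one_self[of "- 2 * \<eta> * L"] by simp
  qed (use assms in auto)
  also have "\<dots> = 2 * \<eta> * (L * exp (- L / 2))" by simp
  also have "\<dots> \<le> 2 * \<eta> * 2"
  proof (rule mult_left_mono)
    have "L \<le> 2 * exp (L / 2)" using exp_ge_add_one_self[of "L / 2"] by linarith
    then show "L * exp (- L / 2) \<le> 2" by (simp add: exp_minus field_simps)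
  qed (use assms in auto)
  finally show ?thesis by simp
qed

text \<open>If R lies within relative error \<eta> of d, then y^R lies within 4 \<eta> of a = y^d,
  whatever the sizes of d and y. The exceptional event costs at most its probability because values
  stay in [0,1].\<close>

lemma (in prob_space) power_variance_le:
  fixes R :: "'a \<Rightarrow> nat"
  assumes R: "R \<in> measurable M (count_space UNIV)" and y: "0 < y" "y < 1" and d: "d > 0" and \<eta>: "0 < \<eta>" "\<eta> \<le> 1/2"
    and P: "prob {w \<in> space M. \<bar>real (R w) - d\<bar> < \<eta> * d} \<ge> 1 - \<delta>"
  shows "expectation (\<lambda>w. (y ^ R w)\<^sup>2) - (expectation (\<lambda>w. y ^ R w))\<^sup>2 \<le> (4 * \<eta>)\<^sup>2 + \<delta>"
proof -
  define L where "L = - ln y * d"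
  define a where "a = exp (- L)"
  have L: "L \<ge> 0" using y d by (simp add: L_def mult_nonpos_nonneg)
  have a: "0 \<le> a" "a \<le> 1" using L by (auto simp: a_def)
  define G where "G = {w \<in> space M. \<bar>real (R w) - d\<bar> < \<eta> * d}"
  have G: "G \<in> events"
  proof -
    have "G = R -` {n. \<bar>real n - d\<bar> < \<eta> * d} \<inter> space M" by (auto simp: G_def)
    also have "\<dots> \<in> events" by (rule measurable_sets[OF R]) simp
    finally show ?thesis .
  qed
  let ?X = "\<lambda>w. y ^ R w"
  have X: "?X w \<ge> 0" "?X w \<le> 1" for w using y by (auto simp: power_le_one)
  have m: "?X \<in> borel_measurable M" by (rule measurable_compose[OF R]) simp
  have I: "integrable M ?X" by (rule integrable_const_bound[of _ 1]) (use X m in auto)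
  have I2: "integrable M (\<lambda>w. (?X w)\<^sup>2)"
  proof (rule integrable_const_bound[of _ 1])
    have "(?X w)\<^sup>2 \<le> 1" for w using X[of w] by (rule power_le_one)
    then show "AE w in M. norm ((?X w)\<^sup>2) \<le> 1" by simp
  qed (use m in simp)
  have le: "(?X w - a)\<^sup>2 \<le> (4 * \<eta>)\<^sup>2 + indicator (space M - G) w" if w: "w \<in> space M" for w
  proof (cases "w \<in> G")
    case True
    then have dev: "\<bar>real (R w) - d\<bar> < \<eta> * d" by (simp add: G_def)
    have Xe: "?X w = exp (- (- ln y * real (R w)))" using y by (simp add: exp_of_nat2_mult flip: powr_realpow)
    have "- ln y * real (R w) \<le> - ln y * (d * (1 + \<eta>))" using dev y by (intro mult_left_mono) (auto simp: algebra_simps)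
    then have 1: "- ln y * real (R w) \<le> L * (1 + \<eta>)" by (simp add: L_def mult.assoc)
    have "- ln y * (d * (1 - \<eta>)) \<le> - ln y * real (R w)" using dev y by (intro mult_left_mono) (auto simp: algebra_simps)
    then have 2: "L * (1 - \<eta>) \<le> - ln y * real (R w)" by (simp add: L_def mult.assoc)
    have "exp (- L * (1 + \<eta>)) \<le> ?X w" "?X w \<le> exp (- L * (1 - \<eta>))" unfolding Xe using 1 2 by auto
    moreover have "exp (- L * (1 + \<eta>)) \<le> a" "a \<le> exp (- L * (1 - \<eta>))" unfolding a_def using L \<eta> by (auto simp: algebra_simps)
    ultimately have "\<bar>?X w - a\<bar> \<le> 4 * \<eta>" using exp_gap_le[OF L _ \<eta>(2)] \<eta> by linarith
    then have "(?X w - a)\<^sup>2 \<le> (4 * \<eta>)\<^sup>2" by (metis abs_le_square_iff abs_of_nonneg abs_ge_zero order_trans)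
    then show ?thesis by (simp add: indicator_def)
  next
    case False
    have "\<bar>?X w - a\<bar> \<le> 1" using X[of w] a by linarith
    then have "(?X w - a)\<^sup>2 \<le> 1" by (simp add: abs_square_le_1)
    then show ?thesis using False w by (simp add: add_increasing)
  qed
  \<comment> \<open>The variance is at most the second moment about any point, here about a.\<close>
  have "expectation (\<lambda>w. (?X w)\<^sup>2) - (expectation ?X)\<^sup>2 \<le> expectation (\<lambda>w. (?X w)\<^sup>2) - 2 * a * expectation ?X + a\<^sup>2"
    using zero_le_power2[of "expectation ?X - a"] by (simp add: power2_eq_square algebra_simps)
  also have "\<dots> = expectation (\<lambda>w. (?X w)\<^sup>2 - 2 * a * ?X w + a\<^sup>2)"
    using I I2 by (simp add: prob_space)
  also have "\<dots> = expectation (\<lambda>w. (?X w - a)\<^sup>2)"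
    by (simp add: power2_eq_square algebra_simps)
  also have "\<dots> \<le> expectation (\<lambda>w. (4 * \<eta>)\<^sup>2 + indicator (space M - G) w)"
  proof (rule integral_mono)
    have "integrable M (\<lambda>w. (?X w)\<^sup>2 - 2 * a * ?X w + a\<^sup>2)" using I I2 by simp
    then show "integrable M (\<lambda>w. (?X w - a)\<^sup>2)" by (simp add: power2_eq_square algebra_simps)
    show "integrable M (\<lambda>w. (4 * \<eta>)\<^sup>2 + indicat_real (space M - G) w)" using G by (simp add: emeasure_eq_measure)
  qed (rule le)
  also have "\<dots> = (4 * \<eta>)\<^sup>2 + prob (space M - G)"
    using G by (simp add: emeasure_eq_measure prob_space)
  also have "prob (space M - G) \<le> \<delta>" using P prob_compl[OF G] by (simp add: G_def)
  finally show ?thesis by simp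
qed

section \<open>Parts near a pole inside the unit disc\<close>

context multiplicative begin

lemma expectation_power_count:
  assumes x: "0 < x" "x < 1" "ereal x < fps_conv_radius f" and y: "0 \<le> y" "y \<le> 1"
  shows "(\<integral>p. y ^ count p 1 \<partial>gc x) = E (x * y) / E x"
proof -
  have xy: "0 \<le> x * y" "x * y \<le> x" using x y by (auto simp: mult_left_le)
  have rxy: "ereal (x * y) < fps_conv_radius f" by (rule radius_mono[OF xy(2) x(3)])
  have Ex: "E x \<ge> 1" using E_ge_1 x by simp
  have Exy: "E (x * y) \<ge> 1" using E_ge_1 xy rxy by simp
  have g1: "g 1 = f" using b1 fps_rpow_1[OF f0] by simp
  have s: "(\<lambda>j. fps_nth f j * v ^ j) sums E v" if "0 \<le> v" "ereal v < fps_conv_radius f" for v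
    using summable_fps[of v f] that by (simp add: eval_fps_def summable_sums)
  have W: "(\<Sum>j. w x 1 j) = ennreal (E x)"
    using w_sums(1)[OF x, of 1] g1 by simp
  have "(\<Sum>j. w x 1 j * ennreal (y ^ j)) = (\<Sum>j. ennreal (fps_nth f j * (x * y) ^ j))"
    unfolding w_def g1 using nonneg x y by (intro suminf_cong) (simp add: ennreal_mult[symmetric] power_mult_distrib mult_ac)
  also have "\<dots> = ennreal (E (x * y))"
    by (rule suminf_ennreal_eq[OF _ s[OF xy(1) rxy]]) (use nonneg xy in simp)
  also have "\<dots> = ennreal (E (x * y) / E x) * (\<Sum>j. w x 1 j)"
    unfolding W using Ex Exy by (simp add: ennreal_mult[symmetric])
  finally have "(\<integral>\<^sup>+p. ennreal (y ^ count p 1) \<partial>gc x) = ennreal (E (x * y) / E x)"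
    by (intro expectation_count[OF x]) auto
  from has_bochner_integral_nn_integral[OF measurable_gc _ _ this] show ?thesis
    using Ex Exy y by (simp add: has_bochner_integral_iff)
qed

text \<open>Parts k >= 2 only see arguments x^k <= R^2 < R, away from the singularity, where q(v) <=
  f'(R^2) v. The bound is then a multiple of the sum of k b_k R^k, the termwise derivative of a
  power series with radius at least 1 > R.\<close>

lemma expectation_weight_ge_2:
  assumes R: "fps_conv_radius f = ereal R" "R < 1"
  obtains C where "C \<ge> 0" "\<And>x. 0 < x \<Longrightarrow> x < R \<Longrightarrow> (\<integral>\<^sup>+p. of_nat (weight_ge_2 p) \<partial>gc x) \<le> ennreal C"
proof -
  have R0: "R > 0" using radius_pos R by simp
  have R2: "R\<^sup>2 < R" using R0 R by (simp add: power2_eq_square)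
  define K where "K = E1 (R\<^sup>2)"
  have K: "K \<ge> 0" using E1_ge[of "R\<^sup>2"] f1 R R2 by (simp add: K_def)
  define c where "c k = (if k \<ge> 2 then real k * (b k * (K * R ^ k)) else 0)" for k :: nat
  have "summable (\<lambda>n. diffs b n * R ^ n)"
  proof (rule termdiff_converges)
    show "norm R < 1" using R0 R by simp
    show "summable (\<lambda>n. b n * y ^ n)" if y: "norm y < 1" for y :: real
    proof -
      have "summable (\<lambda>n. b n * ((\<bar>y\<bar> + 1) / 2) ^ n)" using y by (intro b_summable) auto
      then show ?thesis by (rule powser_inside) (use y in auto)
    qed
  qed
  then have "summable (\<lambda>n. K * R * (diffs b n * R ^ n))" by (rule summable_mult)
  then have "summable (\<lambda>n. real (Suc n) * (b (Suc n) * (K * R ^ Suc n)))"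
    by (simp add: diffs_def mult_ac del: of_nat_Suc)
  then have "summable (\<lambda>k. real k * (b k * (K * R ^ k)))" by (subst (asm) summable_Suc_iff)
  then have sc: "summable c"
    by (rule summable_comparison_test'[of _ 2]) (use b_nonneg K R0 in \<open>auto simp: c_def\<close>)
  have c0: "c k \<ge> 0" for k using b_nonneg[of k] K R0 by (simp add: c_def)
  show thesis
  proof (rule that[of "suminf c"])
    show "suminf c \<ge> 0" using sc c0 by (rule suminf_nonneg)
    fix x assume x: "0 < x" "x < R"
    then have x': "0 < x" "x < 1" "ereal x < fps_conv_radius f" using R by auto
    let ?c = "\<lambda>k. if k \<ge> 2 then of_nat k else 0 :: ennreal"
    have "of_nat (weight_ge_2 p) = (\<Sum>k. ?c k * of_nat (count p k))" for p
    proof -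
      have "(\<Sum>k. ?c k * of_nat (count p k)) = (\<Sum>k | k \<in># p \<and> k \<ge> 2. ?c k * of_nat (count p k))"
        by (rule suminf_finite) (auto simp: not_in_iff)
      then show ?thesis by (simp add: weight_ge_2_def)
    qed
    then have "(\<integral>\<^sup>+p. of_nat (weight_ge_2 p) \<partial>gc x) = (\<Sum>k. ?c k * ennreal (b k * q (x ^ k)))"
      using expectation_linear[OF x', of ?c] by simp
    also have "\<dots> \<le> (\<Sum>k. ennreal (c k))"
    proof (rule suminf_le)
      fix k
      show "?c k * ennreal (b k * q (x ^ k)) \<le> ennreal (c k)"
      proof (cases "k \<ge> 2")
        case True
        have xR: "x ^ k \<le> R ^ k" using x by (intro power_mono) auto
        have "R ^ k \<le> R\<^sup>2" using True R0 R by (intro power_decreasing) auto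
        then have v: "0 \<le> x ^ k" "x ^ k \<le> R\<^sup>2" using x xR by auto
        have rv: "ereal (x ^ k) < fps_conv_radius f" "ereal (R\<^sup>2) < fps_conv_radius f" using v R2 R by auto
        have "q (x ^ k) = x ^ k * (E1 (x ^ k) / E (x ^ k))" using q_eq[OF v(1) rv(1)] by simp
        also have "\<dots> \<le> R ^ k * (K / 1)"
          using xR x E_ge_1[OF v(1) rv(1)] E1_mono[OF v rv(2)] E1_ge[OF v(1) rv(1)] f1 R0 K
          by (intro mult_mono frac_le) (auto simp: K_def)
        finally have "b k * q (x ^ k) \<le> b k * (K * R ^ k)"
          using b_nonneg[of k] True by (intro mult_left_mono) (auto simp: mult.commute)
        then have "real k * (b k * q (x ^ k)) \<le> c k" using True by (simp add: c_def mult_left_mono)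
        then show ?thesis using True by (simp add: ennreal_of_nat_eq_real_of_nat ennreal_leI flip: ennreal_mult')
      qed simp
    qed auto
    also have "\<dots> = ennreal (suminf c)" by (rule suminf_ennreal_eq[OF c0 summable_sums[OF sc]])
    finally show "(\<integral>\<^sup>+p. of_nat (weight_ge_2 p) \<partial>gc x) \<le> ennreal (suminf c)" .
  qed
qed

text \<open>The Laurent expansion need not be differentiated: ln f tends to infinity, and the mean
  value theorem writes its increase from R/2 to x as (x - R/2) f'(z)/f(z). Since x - R/2 < z, this
  is at most q(z) <= q(x).\<close>

lemma q_at_top_of_pole:
  assumes R: "fps_conv_radius f = ereal R" and m: "m \<ge> 1" "c > 0"
    and lim: "((\<lambda>x. (R - x) ^ m * E x) \<longlongrightarrow> c) (at_left R)"
  shows "filterlim q at_top (at_left R)"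
proof -
  have R0: "R > 0" using radius_pos R by simp
  have ev: "eventually (\<lambda>x. x \<in> {R/2<..<R}) (at_left R)" by (rule eventually_at_left_real) (use R0 in auto)
  have "((\<lambda>x. (R - x) ^ m) \<longlongrightarrow> (R - R) ^ m) (at_left R)" by (intro tendsto_intros)
  then have z: "((\<lambda>x. (R - x) ^ m) \<longlongrightarrow> 0) (at_left R)" using m by (simp add: power_0_left)
  have "filterlim (\<lambda>x. inverse ((R - x) ^ m)) at_top (at_left R)"
    by (rule filterlim_inverse_at_top[OF z]) (use ev in \<open>auto elim!: eventually_mono\<close>)
  from filterlim_tendsto_pos_mult_at_top[OF lim m(2) this]
  have "filterlim (\<lambda>x. (R - x) ^ m * E x * inverse ((R - x) ^ m)) at_top (at_left R)" .
  moreover have "eventually (\<lambda>x. (R - x) ^ m * E x * inverse ((R - x) ^ m) = E x) (at_left R)"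
    using ev by eventually_elim auto
  ultimately have "filterlim E at_top (at_left R)" by (simp cong: filterlim_cong)
  then have "filterlim (\<lambda>x. ln (E x)) at_top (at_left R)" by (rule filterlim_compose[OF ln_at_top])
  from filterlim_tendsto_add_at_top[OF tendsto_const[of "- ln (E (R/2))"] this]
  have lnE: "filterlim (\<lambda>x. ln (E x) - ln (E (R/2))) at_top (at_left R)" by simp
  show ?thesis
  proof (rule filterlim_at_top_mono[OF lnE])
    show "eventually (\<lambda>x. ln (E x) - ln (E (R/2)) \<le> q x) (at_left R)"
      using ev
    proof eventually_elim
      case (elim x)
      then have x: "R/2 < x" "x < R" by auto
      have r: "ereal v < fps_conv_radius f" if "v < R" for v using that R by simp
      have pos: "E v > 0" if "0 \<le> v" "v < R" for v using E_ge_1[of v] r that by force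
      have "\<exists>z>R/2. z < x \<and> ln (E x) - ln (E (R/2)) = (x - R/2) * (E1 z / E z)"
      proof (rule MVT2[OF x(1)])
        fix v assume v: "R/2 \<le> v" "v \<le> x"
        then have v': "0 \<le> v" "v < R" using R0 x by auto
        show "((\<lambda>x. ln (E x)) has_real_derivative E1 v / E v) (at v)"
          using DERIV_chain2[OF DERIV_ln_divide[OF pos[OF v']] E_deriv[of v UNIV]] v' r[of v] by simp
      qed
      then obtain z where z: "R/2 < z" "z < x" "ln (E x) - ln (E (R/2)) = (x - R/2) * (E1 z / E z)" by blast
      have z0: "0 \<le> z" "ereal z < fps_conv_radius f" "z > 0" using z R0 r[of z] x by auto
      have "(x - R/2) * (E1 z / E z) \<le> z * (E1 z / E z)"
        using z x pos[of z] z0 E1_ge[OF z0(1,2)] f1 by (intro mult_right_mono divide_nonneg_pos) auto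
      also have "\<dots> = q z" using q_eq[OF z0(1,2)] by simp
      also have "\<dots> \<le> q x" using z z0 x r by (intro q_mono) auto
      finally show ?case using z by simp
    qed
  qed
qed

theorem not_ergodic:
  assumes R: "fps_conv_radius f = ereal R" "R < 1" and pole: "has_pole_at f (complex_of_real R)"
  shows "\<not> ergodic (fps_conv_radius F) gc"
proof
  assume "ergodic (fps_conv_radius F) gc"
  moreover have rad: "fps_conv_radius F = ereal R" using R by (simp add: radius_F min_def one_ereal_def)
  ultimately obtain \<alpha> \<phi> where erg: "ergodic_with (ereal R) gc \<alpha> \<phi>" by (auto simp: ergodic_def)
  have R0: "R > 0" using radius_pos R by simp
  have \<alpha>: "\<alpha> x > 0" if "0 < x" "x < R" for x using erg that by (simp add: ergodic_with_def)
  have \<phi>: "\<And>t. t \<ge> 0 \<Longrightarrow> \<phi> t \<ge> 0" "piecewise_continuous \<phi>" "(\<phi> has_integral 1) {0..}"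
    using erg by (auto simp: ergodic_with_def limit_shape_function_def)
  define W where "W x = (\<integral>q. real (weight q) \<partial>gc x)" for x
  have conv: "((\<lambda>x. measure (gc x) {p \<in> partitions. \<bar>\<alpha> x / W x * real (tail_count p (\<alpha> x * t)) - \<phi> t\<bar> < \<epsilon>}) \<longlongrightarrow> 1) (at_left R)"
    if t: "t > 0" "isCont \<phi> t" and \<epsilon>: "\<epsilon> > 0" for t \<epsilon>
  proof -
    have "\<forall>\<epsilon>>0. \<forall>T. finite T \<and> T \<subseteq> {t. t > 0 \<and> isCont \<phi> t} \<longrightarrow>
        ((\<lambda>x. measure (gc x) {p \<in> partitions. \<forall>t\<in>T. \<bar>scaled_tail gc \<alpha> x p t - \<phi> t\<bar> < \<epsilon>}) \<longlongrightarrow> 1) (at_left R)"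
      using erg by (simp add: ergodic_with_def filtercomap_ereal_at_left)
    from this[rule_format, OF \<epsilon>, of "{t}"] t show ?thesis by (simp add: scaled_tail_def W_def)
  qed
  \<comment> \<open>A limit shape vanishing at all its positive continuity points would vanish off a
    countable set, contrary to its integral being 1.\<close>
  obtain t0 where t0: "t0 > 0" "isCont \<phi> t0" "\<phi> t0 > 0"
  proof (rule ccontr)
    assume no: "\<not> thesis"
    have z: "\<phi> t = 0" if "t > 0" "isCont \<phi> t" for t
      using no \<phi>(1)[of t] that \<open>\<And>t0. 0 < t0 \<Longrightarrow> isCont \<phi> t0 \<Longrightarrow> 0 < \<phi> t0 \<Longrightarrow> thesis\<close> by force
    define N where "N = insert 0 (\<Union>n::nat. {t \<in> {0<..real (Suc n)}. \<not> isCont \<phi> t})"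
    have fin: "finite {t \<in> {0<..real (Suc n)}. \<not> isCont \<phi> t}" for n
      using \<phi>(2) by (simp add: piecewise_continuous_def del: of_nat_Suc)
    have "countable N" unfolding N_def
      by (rule countable_insert[OF countable_UN[OF countableI_type countable_finite[OF fin]]])
    then have neg: "negligible N" by (simp add: negligible_iff_null_sets countable_imp_null_set_lborel null_sets_completionI)
    have "(\<phi> has_integral 0) {0..}"
    proof (rule has_integral_negligible[OF neg])
      fix t assume t: "t \<in> {0..} - N"
      then have "t > 0" by (auto simp: N_def)
      obtain n where "t \<le> real n" using real_arch_simple by blast
      then have "t \<le> real (Suc n)" by simp
      then have "isCont \<phi> t" using t \<open>t > 0\<close> by (auto simp: N_def)
      then show "\<phi> t = 0" using z \<open>t > 0\<close> by simp
    qed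
    from has_integral_unique[OF this \<phi>(3)] show False by simp
  qed
  define c0 where "c0 = \<phi> t0"
  have c0: "c0 > 0" using t0 by (simp add: c0_def)
  obtain m c where m: "m \<ge> 1" "c > 0" and lim: "((\<lambda>x. (R - x) ^ m * E x) \<longlongrightarrow> c) (at_left R)"
    by (rule pole_asymptotics[OF R(1) pole])
  obtain C where C: "C \<ge> 0" "\<And>x. 0 < x \<Longrightarrow> x < R \<Longrightarrow> (\<integral>\<^sup>+p. of_nat (weight_ge_2 p) \<partial>gc x) \<le> ennreal C"
  proof (rule expectation_weight_ge_2[OF R], goal_cases)
    case (1 C)
    show ?case by (rule 1(1)) (rule 1(2), erule (1) 1(3))
  qed
  have ev: "eventually (\<lambda>x. 0 < x \<and> x < R) (at_left R)"
    using eventually_at_left_real[OF R0] by eventually_elim auto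
  have inr: "0 < x" "x < 1" "ereal x < fps_conv_radius f" if "0 < x" "x < R" for x using that R by auto
  have mean_weight_ge_2: "\<exists>r. 0 \<le> r \<and> r \<le> C \<and> (\<integral>\<^sup>+p. of_nat (weight_ge_2 p) \<partial>gc x) = ennreal r" if x: "0 < x" "x < R" for x
  proof -
    have "(\<integral>\<^sup>+p. of_nat (weight_ge_2 p) \<partial>gc x) < top" using C(2)[OF x] by (rule le_less_trans) simp
    then obtain r where "0 \<le> r" "(\<integral>\<^sup>+p. of_nat (weight_ge_2 p) \<partial>gc x) = ennreal r"
      by (cases "\<integral>\<^sup>+p. of_nat (weight_ge_2 p) \<partial>gc x") auto
    then show ?thesis using C(2)[OF x] C(1) by (auto simp: ennreal_le_iff)
  qed
  have W_ge: "q x \<le> W x" if x: "0 < x" "x < R" for x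
  proof -
    obtain r where r: "0 \<le> r" "(\<integral>\<^sup>+p. of_nat (weight_ge_2 p) \<partial>gc x) = ennreal r" using mean_weight_ge_2[OF x] by auto
    have q0: "q x \<ge> 0" using inr[OF x] by (intro q_nonneg) auto
    have "(\<integral>\<^sup>+p. of_nat (weight p) \<partial>gc x) = (\<integral>\<^sup>+p. of_nat (count p 1) + of_nat (weight_ge_2 p) \<partial>gc x)"
      by (rule nn_integral_cong) (simp add: weight_eq_weight_ge_2)
    also have "\<dots> = (\<integral>\<^sup>+p. of_nat (count p 1) \<partial>gc x) + (\<integral>\<^sup>+p. of_nat (weight_ge_2 p) \<partial>gc x)"
      by (rule nn_integral_add) auto
    also have "(\<integral>\<^sup>+p. of_nat (count p 1) \<partial>gc x) = ennreal (b 1 * q (x ^ 1))"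
      by (rule expectation_count[OF inr[OF x] _ w_sums(2)[OF inr[OF x]]]) auto
    also have "ennreal (b 1 * q (x ^ 1)) + (\<integral>\<^sup>+p. of_nat (weight_ge_2 p) \<partial>gc x) = ennreal (q x + r)"
      using r b1 q0 by simp
    finally have "W x = q x + r" unfolding W_def by (rule integral_real_of_nat) (use r q0 in auto)
    then show ?thesis using r by simp
  qed
  have W_top: "filterlim W at_top (at_left R)"
    by (rule filterlim_at_top_mono[OF q_at_top_of_pole[OF R(1) m lim]])
       (use ev W_ge in \<open>auto elim: eventually_mono\<close>)
  have markov: "measure (gc x) {p \<in> partitions. a \<le> real (weight_ge_2 p)} \<le> C / a" if x: "0 < x" "x < R" and a: "a > 0" for x a
  proof -
    interpret prob_space "gc x" by (rule prob_space_gc[OF inr[OF x]])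
    obtain r where r: "0 \<le> r" "r \<le> C" "(\<integral>\<^sup>+p. of_nat (weight_ge_2 p) \<partial>gc x) = ennreal r" using mean_weight_ge_2[OF x] by auto
    note I = integral_real_of_nat[OF r(3,1) measurable_gc]
    have "prob {p \<in> space (gc x). a \<le> real (weight_ge_2 p)} \<le> expectation (\<lambda>p. real (weight_ge_2 p)) / a"
      by (rule integral_Markov_inequality_measure[where A = "{}"]) (use I a in auto)
    also have "\<dots> \<le> C / a" using I r a by (simp add: divide_right_mono)
    finally show ?thesis by simp
  qed
  \<comment> \<open>If \<alpha> t0 >= 1, the tail at t0 contains only parts above 1, and filling it
    to height c0/2 takes weight at least c0 t0 W / 2. Beyond the chosen threshold for W, Markov's
    inequality allows this with probability at most 1/2, while ergodicity demands more.\<close>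
  have small: "eventually (\<lambda>x. \<alpha> x * t0 < 1) (at_left R)"
  proof -
    have "eventually (\<lambda>x. measure (gc x) {p \<in> partitions. \<bar>\<alpha> x / W x * real (tail_count p (\<alpha> x * t0)) - \<phi> t0\<bar> < c0 / 2} > 1/2) (at_left R)"
      by (rule order_tendstoD[OF conv[OF t0(1,2)]]) (use c0 in auto)
    moreover have "eventually (\<lambda>x. W x > 4 * C / (c0 * t0)) (at_left R)"
      using W_top by (simp add: filterlim_at_top_dense)
    ultimately show ?thesis using ev
    proof eventually_elim
      case (elim x)
      interpret prob_space "gc x" by (rule prob_space_gc[OF inr]) (use elim in auto)
      have W: "W x > 0" using elim C c0 t0 by (smt (verit) divide_nonneg_pos mult_pos_pos)
      show ?case
      proof (rule ccontr)
        assume "\<not> \<alpha> x * t0 < 1"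
        then have ge: "\<alpha> x * t0 \<ge> 1" by simp
        have "measure (gc x) {p \<in> partitions. \<bar>\<alpha> x / W x * real (tail_count p (\<alpha> x * t0)) - \<phi> t0\<bar> < c0 / 2}
           \<le> measure (gc x) {p \<in> partitions. c0 * t0 * W x / 2 \<le> real (weight_ge_2 p)}"
        proof (rule finite_measure_mono)
          show "{p \<in> partitions. \<bar>\<alpha> x / W x * real (tail_count p (\<alpha> x * t0)) - \<phi> t0\<bar> < c0 / 2}
            \<subseteq> {p \<in> partitions. c0 * t0 * W x / 2 \<le> real (weight_ge_2 p)}"
          proof safe
            fix p assume "\<bar>\<alpha> x / W x * real (tail_count p (\<alpha> x * t0)) - \<phi> t0\<bar> < c0 / 2"
            then have "c0 / 2 < \<alpha> x / W x * real (tail_count p (\<alpha> x * t0))" unfolding c0_def by linarith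
            then have "c0 / 2 < \<alpha> x * real (tail_count p (\<alpha> x * t0)) / W x" by simp
            then have "c0 / 2 * W x \<le> \<alpha> x * real (tail_count p (\<alpha> x * t0))" using W by (simp add: pos_less_divide_eq)
            then have "c0 / 2 * W x * t0 \<le> \<alpha> x * real (tail_count p (\<alpha> x * t0)) * t0" using t0 by (intro mult_right_mono) auto
            also have "\<dots> = (\<alpha> x * t0) * real (tail_count p (\<alpha> x * t0))" by simp
            also have "\<dots> \<le> real (weight_ge_2 p)" by (rule tail_count_le_weight_ge_2[OF ge])
            finally show "c0 * t0 * W x / 2 \<le> real (weight_ge_2 p)" by (simp add: mult_ac)
          qed
        qed simp
        also have "\<dots> \<le> C / (c0 * t0 * W x / 2)" by (rule markov) (use elim W c0 t0 in auto)
        also have "\<dots> \<le> 1/2" using elim W c0 t0 by (simp add: field_simps)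
        finally show False using elim by simp
      qed
    qed
  qed
  \<comment> \<open>The centre is d = c0 W / \<alpha>. One \<eta> d comes from the deviation of the
    tail count, the other from parts above 1; as d >= c0 t0 W, the threshold for W keeps the latter
    failure below \<eta>/2.\<close>
  have conc: "eventually (\<lambda>x. \<exists>d>0. measure (gc x) {p \<in> partitions. \<bar>real (count p 1) - d\<bar> < 2 * \<eta> * d} \<ge> 1 - \<eta>) (at_left R)"
    if \<eta>: "0 < \<eta>" for \<eta>
  proof -
    have "eventually (\<lambda>x. measure (gc x) {p \<in> partitions. \<bar>\<alpha> x / W x * real (tail_count p (\<alpha> x * t0)) - \<phi> t0\<bar> < \<eta> * c0} > 1 - \<eta> / 2) (at_left R)"
      by (rule order_tendstoD[OF conv[OF t0(1,2)]]) (use c0 \<eta> in auto)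
    moreover have "eventually (\<lambda>x. W x > 2 * C / (\<eta> * \<eta> * c0 * t0)) (at_left R)"
      using W_top by (simp add: filterlim_at_top_dense)
    ultimately show ?thesis using ev small
    proof eventually_elim
      case (elim x)
      interpret prob_space "gc x" by (rule prob_space_gc[OF inr]) (use elim in auto)
      have \<alpha>x: "\<alpha> x > 0" using \<alpha> elim by simp
      have "2 * C / (\<eta> * \<eta> * c0 * t0) \<ge> 0" using C \<eta> c0 t0 by simp
      then have W: "W x > 0" using elim by linarith
      define d where "d = c0 * W x / \<alpha> x"
      have d: "d > 0" using c0 W \<alpha>x by (simp add: d_def)
      have "c0 * W x * (\<alpha> x * t0) \<le> c0 * W x * 1" using elim c0 W by (intro mult_left_mono) auto
      then have d_ge: "c0 * W x * t0 \<le> d" using \<alpha>x by (simp add: d_def field_simps)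
      let ?A = "{p \<in> partitions. \<bar>\<alpha> x / W x * real (tail_count p (\<alpha> x * t0)) - \<phi> t0\<bar> < \<eta> * c0}"
      let ?B = "{p \<in> partitions. \<bar>real (count p 1) - d\<bar> < 2 * \<eta> * d}"
      let ?C = "{p \<in> partitions. \<eta> * d \<le> real (weight_ge_2 p)}"
      have "?A \<subseteq> ?B \<union> ?C"
      proof safe
        fix p assume p: "p \<in> partitions" and A: "\<bar>\<alpha> x / W x * real (tail_count p (\<alpha> x * t0)) - \<phi> t0\<bar> < \<eta> * c0"
          and nC: "\<not> \<eta> * d \<le> real (weight_ge_2 p)"
        have "real (tail_count p (\<alpha> x * t0)) - d = (W x / \<alpha> x) * (\<alpha> x / W x * real (tail_count p (\<alpha> x * t0)) - \<phi> t0)"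
          using W \<alpha>x by (simp add: d_def c0_def field_simps)
        then have "\<bar>real (tail_count p (\<alpha> x * t0)) - d\<bar> = (W x / \<alpha> x) * \<bar>\<alpha> x / W x * real (tail_count p (\<alpha> x * t0)) - \<phi> t0\<bar>"
          using W \<alpha>x by (simp add: abs_mult)
        also have "\<dots> < (W x / \<alpha> x) * (\<eta> * c0)" using A W \<alpha>x by (intro mult_strict_left_mono) auto
        also have "\<dots> = \<eta> * d" by (simp add: d_def)
        finally have 1: "\<bar>real (tail_count p (\<alpha> x * t0)) - d\<bar> < \<eta> * d" .
        have s: "0 \<le> \<alpha> x * t0" using \<alpha>x t0 by simp
        have "count p 1 \<le> tail_count p (\<alpha> x * t0)" "tail_count p (\<alpha> x * t0) \<le> count p 1 + weight_ge_2 p"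
          using tail_count_near_count_1[OF p s] elim by auto
        then have "real (count p 1) \<le> real (tail_count p (\<alpha> x * t0))"
          "real (tail_count p (\<alpha> x * t0)) \<le> real (count p 1) + real (weight_ge_2 p)" by linarith+
        with 1 nC show "\<bar>real (count p 1) - d\<bar> < 2 * \<eta> * d" by linarith
      qed
      then have "prob ?A \<le> prob (?B \<union> ?C)" by (rule finite_measure_mono) auto
      also have "\<dots> \<le> prob ?B + prob ?C" by (rule measure_Un_le) auto
      finally have "prob ?A \<le> prob ?B + prob ?C" .
      moreover have "prob ?C \<le> \<eta> / 2"
      proof -
        have "prob ?C \<le> C / (\<eta> * d)" by (rule markov) (use elim \<eta> d in auto)
        also have "\<dots> \<le> C / (\<eta> * (c0 * W x * t0))"
          using d_ge C \<eta> c0 W t0 d by (intro divide_left_mono mult_left_mono) auto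
        also have "\<dots> \<le> \<eta> / 2" using elim \<eta> c0 W t0 by (simp add: field_simps)
        finally show ?thesis .
      qed
      ultimately have "prob ?B \<ge> 1 - \<eta>" using elim by simp
      with d show ?case by blast
    qed
  qed
  define H where "H x = (R - x) ^ m * E x" for x
  have H: "(H \<longlongrightarrow> c) (at_left R)" using lim by (simp add: H_def[abs_def])
  \<comment> \<open>Here k is the quotient of the distances R - x and R - g x to the pole. The
    leading constants cancel, so the m-th power of its limit is the limit of the values of
    f.\<close>
  have ratio: "((\<lambda>x. E (g x) / E x) \<longlongrightarrow> l ^ m) (at_left R)"
    if g: "(g \<longlongrightarrow> R) (at_left R)" "\<And>x. 0 < x \<Longrightarrow> x < R \<Longrightarrow> 0 < g x \<and> g x < R"
      and k: "(k \<longlongrightarrow> l) (at_left R)" "\<And>x. 0 < x \<Longrightarrow> x < R \<Longrightarrow> R - x = k x * (R - g x)" for g k l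
  proof -
    have "filterlim g (at_left R) (at_left R)"
      by (rule filterlim_at_withinI[OF g(1)]) (use ev g(2) in \<open>auto elim!: eventually_mono\<close>)
    from filterlim_compose[OF H this] have "((\<lambda>x. H (g x) / H x * k x ^ m) \<longlongrightarrow> c / c * l ^ m) (at_left R)"
      by (intro tendsto_intros H k) (use m in auto)
    moreover have "eventually (\<lambda>x. H (g x) / H x * k x ^ m = E (g x) / E x) (at_left R)"
      using ev
    proof eventually_elim
      case (elim x)
      have x: "R - g x \<noteq> 0" "R - x \<noteq> 0" using g(2)[of x] elim by auto
      have eq: "R - x = k x * (R - g x)" using k(2)[of x] elim by simp
      with x have "k x \<noteq> 0" by auto
      then show ?case using x unfolding H_def eq by (simp add: power_mult_distrib)
    qed
    ultimately show ?thesis using m by (simp add: tendsto_cong)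
  qed
  \<comment> \<open>The variance of y^(R_1) at y = x/R, expressed by values of f. This y makes x y
    and x y^2 approach R at rates 2 and 3 times that of x.\<close>
  define V where "V x = E (x * (x / R)\<^sup>2) / E x - (E (x * (x / R)) / E x)\<^sup>2" for x
  define v where "v = (1/3::real) ^ m - ((1/2) ^ m)\<^sup>2"
  have V: "(V \<longlongrightarrow> v) (at_left R)"
  proof -
    have "((\<lambda>x. E (x * (x / R)\<^sup>2) / E x) \<longlongrightarrow> (1/3) ^ m) (at_left R)"
    proof (rule ratio)
      have "((\<lambda>x. x * (x / R)\<^sup>2) \<longlongrightarrow> R * (R / R)\<^sup>2) (at_left R)" by (intro tendsto_intros) (use R0 in auto)
      then show "((\<lambda>x. x * (x / R)\<^sup>2) \<longlongrightarrow> R) (at_left R)" using R0 by simp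
      \<comment> \<open>The quotient of distances, from the factorisation of R^3 - x^3; three equal
        terms in the limit give 1/3.\<close>
      have "((\<lambda>x. R\<^sup>2 / (R\<^sup>2 + R * x + x\<^sup>2)) \<longlongrightarrow> R\<^sup>2 / (R\<^sup>2 + R * R + R\<^sup>2)) (at_left R)"
        by (intro tendsto_intros) (use R0 in \<open>auto simp: power2_eq_square\<close>)
      then show "((\<lambda>x. R\<^sup>2 / (R\<^sup>2 + R * x + x\<^sup>2)) \<longlongrightarrow> 1/3) (at_left R)" using R0 by (simp add: power2_eq_square)
      fix x assume x: "0 < x" "x < R"
      have "(x / R)\<^sup>2 \<le> 1" using x by (simp add: power_le_one)
      then have "x * (x / R)\<^sup>2 \<le> x * 1" using x by (intro mult_left_mono) auto
      then have "x * (x / R)\<^sup>2 < R" using x by linarith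
      moreover have "0 < x * (x / R)\<^sup>2" using x R0 by simp
      ultimately show "0 < x * (x / R)\<^sup>2 \<and> x * (x / R)\<^sup>2 < R" by simp
      have p: "R\<^sup>2 + R * x + x\<^sup>2 > 0" using x R0 by (intro add_pos_pos) auto
      have "R - x * (x / R)\<^sup>2 = (R - x) * (R\<^sup>2 + R * x + x\<^sup>2) / R\<^sup>2"
        using R0 by (simp add: field_simps power2_eq_square)
      then show "R - x = R\<^sup>2 / (R\<^sup>2 + R * x + x\<^sup>2) * (R - x * (x / R)\<^sup>2)" using p R0 by simp
    qed
    moreover have "((\<lambda>x. E (x * (x / R)) / E x) \<longlongrightarrow> (1/2) ^ m) (at_left R)"
    proof (rule ratio)
      have "((\<lambda>x. x * (x / R)) \<longlongrightarrow> R * (R / R)) (at_left R)" by (intro tendsto_intros) (use R0 in auto)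
      then show "((\<lambda>x. x * (x / R)) \<longlongrightarrow> R) (at_left R)" using R0 by simp
      have "((\<lambda>x. R / (R + x)) \<longlongrightarrow> R / (R + R)) (at_left R)"
        by (intro tendsto_intros) (use R0 in auto)
      then show "((\<lambda>x. R / (R + x)) \<longlongrightarrow> 1/2) (at_left R)" using R0 by simp
      fix x assume x: "0 < x" "x < R"
      have "x * (x / R) \<le> x * 1" using x by (intro mult_left_mono) auto
      then have "x * (x / R) < R" using x by linarith
      moreover have "0 < x * (x / R)" using x R0 by simp
      ultimately show "0 < x * (x / R) \<and> x * (x / R) < R" by simp
      have "R - x * (x / R) = (R - x) * (R + x) / R" using R0 by (simp add: field_simps power2_eq_square)
      then show "R - x = R / (R + x) * (R - x * (x / R))" using x R0 by simp
    qed
    ultimately show ?thesis unfolding V_def[abs_def] v_def by (intro tendsto_intros)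
  qed
  have v: "v > 0"
  proof -
    have "((1/2::real) ^ m)\<^sup>2 = (1/4) ^ m" by (simp add: power2_eq_square flip: power_mult_distrib)
    also have "\<dots> < (1/3) ^ m" using m by (intro power_strict_mono) auto
    finally show ?thesis by (simp add: v_def)
  qed
  \<comment> \<open>\<open>power_variance_le\<close> is applied with 2 \<eta> <= 1/2 and gives at
    most 64 \<eta>^2 + \<eta> <= 17 \<eta>, which is below v/2 when \<eta> <= v/200.\<close>
  define \<eta> where "\<eta> = min (1/4) (v / 200)"
  have \<eta>: "0 < \<eta>" "\<eta> \<le> 1/4" "\<eta> \<le> v / 200" using v by (auto simp: \<eta>_def)
  have "eventually (\<lambda>x. V x > v / 2) (at_left R)" by (rule order_tendstoD[OF V]) (use v in simp)
  then have "eventually (\<lambda>x. False) (at_left R)"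
    using conc[OF \<eta>(1)] ev
  proof eventually_elim
    case (elim x)
    then have x: "0 < x" "x < R" by auto
    interpret prob_space "gc x" by (rule prob_space_gc[OF inr[OF x]])
    define y where "y = x / R"
    have y: "0 < y" "y < 1" using x by (auto simp: y_def)
    obtain d where d: "d > 0" "prob {p \<in> space (gc x). \<bar>real (count p 1) - d\<bar> < 2 * \<eta> * d} \<ge> 1 - \<eta>"
      using elim by auto
    have "expectation (\<lambda>p. (y ^ count p 1)\<^sup>2) - (expectation (\<lambda>p. y ^ count p 1))\<^sup>2 \<le> (4 * (2 * \<eta>))\<^sup>2 + \<eta>"
      by (rule power_variance_le[OF _ y d(1) _ _ d(2)]) (use \<eta> in \<open>auto simp: grand_canonical_def\<close>)
    moreover have "expectation (\<lambda>p. (y ^ count p 1)\<^sup>2) = E (x * y\<^sup>2) / E x"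
    proof -
      have "(y ^ n)\<^sup>2 = (y\<^sup>2) ^ n" for n by (simp add: power2_eq_square power_mult_distrib)
      then show ?thesis using expectation_power_count[OF inr[OF x], of "y\<^sup>2"] y by (simp add: power_le_one)
    qed
    moreover have "expectation (\<lambda>p. y ^ count p 1) = E (x * y) / E x"
      using expectation_power_count[OF inr[OF x], of y] y by simp
    ultimately have "V x \<le> 64 * \<eta>\<^sup>2 + \<eta>" by (simp add: V_def y_def power2_eq_square)
    moreover have "\<eta>\<^sup>2 \<le> 1/4 * \<eta>" unfolding power2_eq_square using \<eta> by (intro mult_right_mono) auto
    ultimately have "V x \<le> 17 * \<eta>" by linarith
    then show False using elim \<eta> v by linarith
  qed
  then show False by simp
qed

end

text \<open>Only the factor of the part 1 reaches degree 1. Together with b_1 = 1, positivity of a_1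
  thus yields f_1 > 0, as \<open>pgf\<close> requires.\<close>

lemma gen_fun_nth_1:
  fixes f :: "real fps"
  assumes f0: "fps_nth f 0 = 1"
  shows "fps_nth (gen_fun f b) 1 = b 1 * fps_nth f 1"
proof -
  define A where "A k = fps_rpow f (b (Suc k)) oo fps_X ^ Suc k" for k
  have A: "fps_nth (A k) j = (if Suc k dvd j then fps_nth (fps_rpow f (b (Suc k))) (j div Suc k) else 0)" for k j
    unfolding A_def by (rule fps_nth_compose_X_power)
  have 0: "fps_nth (\<Prod>k\<le>n. A k) 0 = 1" for n
    by (induction n) (simp_all add: A f0)
  have "fps_nth (\<Prod>k\<le>n. A k) 1 = b 1 * fps_nth f 1" for n
  proof (induction n)
    case 0
    then show ?case using fps_rpow_nth_1[OF f0, of "b 1"] by (simp add: A)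
  next
    case (Suc n)
    then show ?case using 0[of n] by (simp add: fps_mult_nth A f0)
  qed
  moreover have "eventually (\<lambda>n. fps_nth (\<Prod>k\<le>n. A k) 1 = fps_nth (gen_fun f b) 1) sequentially"
    using gen_fun_tendsto[OF f0, of b] by (simp add: A_def tendsto_fps_iff)
  ultimately show ?thesis by simp
qed

text \<open>A single term b_k is at most the partial sum up to k, which grows polynomially by the
  upper Potter bound.\<close>

lemma summable_regularly_varying:
  assumes rv: "regularly_varying (psum b) \<beta>" and b: "\<And>k. k \<ge> 1 \<Longrightarrow> b k \<ge> 0" and x: "0 < x" "x < 1"
  shows "summable (\<lambda>k. b k * x ^ k)"
proof -
  interpret regularly_varying "psum b" \<beta> by (rule rv)
  obtain C where C: "C \<ge> 0" "\<And>T r. T \<ge> 1 \<Longrightarrow> r \<ge> 1 \<Longrightarrow> psum b (r * T) \<le> C * r powr (\<beta> + 1) * psum b T"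
    using upper_bound[of "\<beta> + 1"] by (metis less_add_one)
  have "summable (\<lambda>k. real k powr (\<beta> + 1) * x ^ k)"
  proof (rule summable_comparison_test_bigo)
    show "summable (\<lambda>k. norm (((1 + x) / 2) ^ k))" using x by (simp add: power_abs)
    show "(\<lambda>k. real k powr (\<beta> + 1) * x ^ k) \<in> O(\<lambda>k. ((1 + x) / 2) ^ k)" using x by real_asymp
  qed
  then have "summable (\<lambda>k. C * psum b 1 * (real k powr (\<beta> + 1) * x ^ k))" by (rule summable_mult)
  then show ?thesis
  proof (rule summable_comparison_test'[of _ 1])
    fix k :: nat assume k: "k \<ge> 1"
    have "b k \<le> (\<Sum>j=1..k. b j)" by (rule member_le_sum) (use k b in auto)
    also have "\<dots> \<le> C * real k powr (\<beta> + 1) * psum b 1" using C(2)[of 1 "real k"] k by (simp add: psum_of_nat)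
    finally have "b k * x ^ k \<le> C * real k powr (\<beta> + 1) * psum b 1 * x ^ k" using x by (intro mult_right_mono) auto
    then show "norm (b k * x ^ k) \<le> C * psum b 1 * (real k powr (\<beta> + 1) * x ^ k)" using b[OF k] x by (simp add: mult_ac)
  qed
qed

lemma not_summable_regularly_varying:
  assumes rv: "regularly_varying (psum b) \<beta>" and b: "\<And>k. k \<ge> 1 \<Longrightarrow> b k \<ge> 0"
  shows "\<not> summable b"
proof
  assume "summable b"
  then have s: "summable (\<lambda>k. b (Suc k))" by (simp add: summable_Suc_iff)
  interpret regularly_varying "psum b" \<beta> by (rule rv)
  have "filterlim (\<lambda>n. psum b (real n)) at_top sequentially"
    by (rule filterlim_compose[OF U_at_top filterlim_real_sequentially])
  then obtain n where n: "psum b (real n) > (\<Sum>k. b (Suc k))"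
    by (auto simp: filterlim_at_top_dense eventually_sequentially)
  have "psum b (real n) = (\<Sum>k<n. b (Suc k))"
    unfolding psum_of_nat by (rule sum.reindex_bij_witness[of _ Suc "\<lambda>k. k - 1"]) auto
  also have "\<dots> \<le> (\<Sum>k. b (Suc k))" using b by (intro sum_le_suminf[OF s]) auto
  finally show False using n by simp
qed

theorem theorem6:
  fixes f :: "real fps" and b :: "nat \<Rightarrow> real" and \<beta> :: real and L :: "real \<Rightarrow> real"
    and \<rho>\<^sub>1 \<rho> :: ereal and \<mu> :: "real \<Rightarrow> nat multiset measure"
  assumes f0: "fps_nth f 0 = 1"
    and rho1: "\<rho>\<^sub>1 = fps_conv_radius f" "\<rho>\<^sub>1 > 0"
    and singular: "\<rho>\<^sub>1 < \<infinity> \<Longrightarrow> \<not> removable_at f (complex_of_real (real_of_ereal \<rho>\<^sub>1))"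
    and b1: "b 1 = 1"
    and b_nonneg: "\<And>k. k \<ge> 1 \<Longrightarrow> b k \<ge> 0"
    and g_nonneg: "\<And>k j. k \<ge> 1 \<Longrightarrow> fps_nth (fps_rpow f (b k)) j \<ge> 0"
    and beta: "\<beta> > 0"
    and L: "slowly_varying L"
    and B: "\<And>k. k \<ge> 1 \<Longrightarrow> (\<Sum>j=1..k. b j) = real k powr \<beta> * L (real k)"
    and a_pos: "\<And>n. fps_nth (gen_fun f b) n > 0"
    and rho: "\<rho> = fps_conv_radius (gen_fun f b)"
    and mu: "\<mu> = grand_canonical f b"
  shows "(\<rho>\<^sub>1 > 1 \<or> \<rho>\<^sub>1 = 1 \<and> has_pole_at f 1 \<longrightarrow>
            ergodic \<rho> \<mu> \<and> ergodic_with \<rho> \<mu> (\<lambda>x. 1 / (1 - x)) (limit_shape f \<beta>)) \<and>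
         (\<rho>\<^sub>1 < 1 \<and> has_pole_at f (complex_of_real (real_of_ereal \<rho>\<^sub>1)) \<longrightarrow> \<not> ergodic \<rho> \<mu>)"
proof -
  \<comment> \<open>Nonnegativity of f itself is the case k = 1 of the hypothesis, since f^(b_1) =
    f.\<close>
  have fnn: "fps_nth f j \<ge> 0" for j using g_nonneg[of 1 j] b1 fps_rpow_1[OF f0] by simp
  have f1: "fps_nth f 1 > 0" using a_pos[of 1] b1 unfolding gen_fun_nth_1[OF f0] by simp
  interpret pgf f by unfold_locales (use f0 fnn f1 rho1 in auto)
  have rv: "regularly_varying (psum b) \<beta>"
    by (rule regularly_varying_psum[OF b_nonneg _ beta L B]) (use b1 in auto)
  interpret multiplicative f b
  proof
    show "summable (\<lambda>k. b k * x ^ k)" if "0 < x" "x < 1" for x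
      by (rule summable_regularly_varying[OF rv b_nonneg that])
    show "\<not> summable b" by (rule not_summable_regularly_varying[OF rv b_nonneg])
  qed (use b_nonneg g_nonneg b1 in auto)
  show ?thesis
  proof (intro conjI impI)
    assume "\<rho>\<^sub>1 > 1 \<or> \<rho>\<^sub>1 = 1 \<and> has_pole_at f 1"
    then have R: "fps_conv_radius f \<ge> 1" and C: "\<exists>C. \<forall>u. 0 \<le> u \<longrightarrow> u < 1 \<longrightarrow> E ((1 + u) / 2) \<le> C * E u"
      using ratio_bounded_of_radius_gt_1 ratio_bounded_of_pole by (auto simp: rho1(1)) metis
    from C obtain C where C: "\<And>u. 0 \<le> u \<Longrightarrow> u < 1 \<Longrightarrow> E ((1 + u) / 2) \<le> C * E u" by blast
    obtain D where D: "\<And>u. 0 \<le> u \<Longrightarrow> u < 1 \<Longrightarrow> q' u \<le> D / (1 - u)\<^sup>2"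
      "\<And>u. 0 \<le> u \<Longrightarrow> u < 1 \<Longrightarrow> q u \<le> D / (1 - u)"
      using q_bounds_of_ratio[OF R C] by metis
    interpret regular_multiplicative f D b \<beta>
      by (intro regular_multiplicative.intro tame_pgf.intro tame_pgf_axioms.intro
          regular_multiplicative_axioms.intro pgf_axioms multiplicative_axioms R D rv)
    show "ergodic_with \<rho> \<mu> (\<lambda>x. 1 / (1 - x)) (limit_shape f \<beta>)"
      unfolding rho mu by (rule ergodic_with_limit_shape)
    then show "ergodic \<rho> \<mu>" unfolding ergodic_def by blast
  next
    assume *: "\<rho>\<^sub>1 < 1 \<and> has_pole_at f (complex_of_real (real_of_ereal \<rho>\<^sub>1))"
    then obtain R where R: "\<rho>\<^sub>1 = ereal R" using rho1(2) by (cases \<rho>\<^sub>1) auto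
    show "\<not> ergodic \<rho> \<mu>"
      unfolding rho mu by (rule not_ergodic[of R]) (use * R rho1 in \<open>auto simp: one_ereal_def\<close>)
  qed
qed

end
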